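(* Let $T$ be a tiling of a compact connected surface $S$ without boundary. The quadrilateral subdivision $T(4)$ of $T$ is (pentagonally) subdivisible if and only if $S$ is orientable.
   Context: A tiling of a compact connected surface without boundary is a graph embedded in the surface such that the complementary regions (tiles) are open disks; tilings are edge-to-edge, every vertex has degree at least $3$, every tile has at least $3$ edges, and tiles may be degenerate (boundary not a simple closed curve). Quadrilateral subdivision: given a tiling $T$, choose a middle point on each edge and a center point in each tile, and join the center of each tile to the middle point of each edge on the tile's boundary; the resulting quadrilateral tiling is $T(4)$. A simple pentagonal subdivision of a quadrilateral tiling is obtained by placing a new vertex at the middle point of every edge and, inside each quadrilateral tile, joining by an arc the middle points of one of the two pairs of opposite edges of the tile, such that the middle point of each edge is used exactly once. A quadrilateral tiling is (pentagonally) subdivisible if it admits a simple pentagonal subdivision. *)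

theory Defs
  imports "HOL-Complex_Analysis.Complex_Analysis"
begin

section \<open>Closed surfaces and orientability\<close>

text \<open>Charts take values in the complex plane, viewed as the real plane.  Second
countability is automatic, since the space is compact.\<close>

definition chart :: "'a::t2_space set \<Rightarrow> 'a set \<Rightarrow> ('a \<Rightarrow> complex) \<Rightarrow> bool" where
  "chart S U f \<longleftrightarrow>
     openin (top_of_set S) U \<and> open (f ` U) \<and> (\<exists>g. homeomorphism U (f ` U) f g)"

definition closed_surface :: "'a::t2_space set \<Rightarrow> bool" where
  "closed_surface S \<longleftrightarrow>
     S \<noteq> {} \<and> compact S \<and> connected S \<and> (\<forall>x\<in>S. \<exists>U f. x \<in> U \<and> chart S U f)"

text \<open>A homeomorphism between plane open sets preserves orientation if it maps small
positively oriented circles about each point to loops of winding number 1 about the image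
point, i.e. has local degree 1 everywhere.  The surface is only a topological manifold, so
no Jacobian is available.\<close>

definition orientation_preserving_on :: "complex set \<Rightarrow> (complex \<Rightarrow> complex) \<Rightarrow> bool" where
  "orientation_preserving_on A h \<longleftrightarrow>
     (\<forall>z\<in>A. \<forall>r>0. cball z r \<subseteq> A \<longrightarrow> winding_number (h \<circ> circlepath z r) (h z) = 1)"

definition orientable :: "'a::t2_space set \<Rightarrow> bool" where
  "orientable S \<longleftrightarrow>
     (\<exists>\<A>. (\<forall>(U, f)\<in>\<A>. chart S U f) \<and> (\<Union>(U, f)\<in>\<A>. U) = S \<and>
          (\<forall>(U, f)\<in>\<A>. \<forall>(W, g)\<in>\<A>.
             orientation_preserving_on (f ` (U \<inter> W)) (g \<circ> inv_into U f)))"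

section \<open>Embedded graphs\<close>

text \<open>An edge is represented by the set of its points without its end vertices; it may be
a loop.  Parallel edges are allowed.\<close>

definition open_edge :: "'a::t2_space set \<Rightarrow> 'a set \<Rightarrow> bool" where
  "open_edge V e \<longleftrightarrow>
     (\<exists>\<gamma>. simple_path \<gamma> \<and> pathstart \<gamma> \<in> V \<and> pathfinish \<gamma> \<in> V \<and>
          e = path_image \<gamma> - {pathstart \<gamma>, pathfinish \<gamma>} \<and> e \<inter> V = {})"

definition embedded_graph :: "'a::t2_space set \<Rightarrow> 'a set \<Rightarrow> 'a set set \<Rightarrow> bool" where
  "embedded_graph S V E \<longleftrightarrow>
     finite V \<and> V \<subseteq> S \<and> finite E \<and> (\<forall>e\<in>E. e \<subseteq> S \<and> open_edge V e) \<and> pairwise disjnt E"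

definition edge_ends :: "'a::t2_space set \<Rightarrow> 'a set" where
  "edge_ends e = closure e - e"

text \<open>A loop contributes 2 to the degree of its vertex.\<close>

definition vertex_degree :: "'a::t2_space set set \<Rightarrow> 'a \<Rightarrow> nat" where
  "vertex_degree E v = (\<Sum>e | e \<in> E \<and> v \<in> edge_ends e. if edge_ends e = {v} then 2 else 1)"

definition tiles :: "'a::t2_space set \<Rightarrow> 'a set \<Rightarrow> 'a set set \<Rightarrow> 'a set set" where
  "tiles S V E = components (S - (V \<union> \<Union>E))"

section \<open>Tilings\<close>

text \<open>The model n-gon is the closed unit disk, its vertices being the n-th roots of unity.
The point \<open>circle_point n t\<close> is vertex k for t = k and the middle of side k for t = k + 1/2.\<close>

definition circle_point :: "nat \<Rightarrow> real \<Rightarrow> complex" where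
  "circle_point n t = cis (2 * pi * t / real n)"

definition polygon_side :: "nat \<Rightarrow> nat \<Rightarrow> complex set" where
  "polygon_side n k = circle_point n ` {real k<..<real k + 1}"

definition side_middle :: "nat \<Rightarrow> nat \<Rightarrow> complex" where
  "side_middle n k = circle_point n (real k + 1 / 2)"

text \<open>The region R is a tile with n edges: it is an open disk, and the boundary of the
n-gon runs along edges of the graph.  Edges and vertices may be visited several times, so
degenerate tiles are included, and edges are counted as often as they occur along
the boundary.\<close>

definition polygon_map ::
  "'a::t2_space set \<Rightarrow> 'a set set \<Rightarrow> nat \<Rightarrow> (complex \<Rightarrow> 'a) \<Rightarrow> 'a set \<Rightarrow> bool" where
  "polygon_map V E n \<phi> R \<longleftrightarrow>
     3 \<le> n \<and> continuous_on (cball 0 1) \<phi> \<and>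
     (\<exists>\<psi>. homeomorphism (ball 0 1) R \<phi> \<psi>) \<and>
     (\<forall>k<n. \<phi> (circle_point n (real k)) \<in> V \<and>
            \<phi> ` polygon_side n k \<in> E \<and> inj_on \<phi> (polygon_side n k))"

definition tiling :: "'a::t2_space set \<Rightarrow> 'a set \<Rightarrow> 'a set set \<Rightarrow> bool" where
  "tiling S V E \<longleftrightarrow>
     embedded_graph S V E \<and> (\<forall>v\<in>V. 3 \<le> vertex_degree E v) \<and>
     (\<forall>R\<in>tiles S V E. \<exists>n \<phi>. polygon_map V E n \<phi> R)"

section \<open>Subdivisions\<close>

definition half_edges :: "('a::t2_space set \<Rightarrow> 'a) \<Rightarrow> 'a set set \<Rightarrow> 'a set set" where
  "half_edges m E = (\<Union>e\<in>E. components (e - {m e}))"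

text \<open>The function m gives the middle points of the edges.  The coordinates \<open>\<Phi> R\<close> on the
tile R are chosen such that the center of R is the origin and the new edges are the straight
segments from the origin to the middles of the sides; thus an edge occurring twice along
the boundary of R is joined to the center twice, once from each of its two sides.\<close>

definition quadrilateral_subdivision ::
  "'a::t2_space set \<Rightarrow> 'a set \<Rightarrow> 'a set set \<Rightarrow> 'a set \<Rightarrow> 'a set set \<Rightarrow> bool" where
  "quadrilateral_subdivision S V E V' E' \<longleftrightarrow>
     (\<exists>m n \<Phi>.
        (\<forall>e\<in>E. m e \<in> e) \<and>
        (\<forall>R\<in>tiles S V E. polygon_map V E (n R) (\<Phi> R) R \<and>
           (\<forall>k<n R. \<Phi> R (side_middle (n R) k) = m (\<Phi> R ` polygon_side (n R) k))) \<and>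
        V' = V \<union> m ` E \<union> (\<lambda>R. \<Phi> R 0) ` tiles S V E \<and>
        E' = half_edges m E \<union>
             {\<Phi> R ` open_segment 0 (side_middle (n R) k) | R k. R \<in> tiles S V E \<and> k < n R})"

text \<open>Sides 0 and 2 of the 4-gon carry the chosen pair of opposite edges of the tile R; as
coordinates may be rotated, either pair can be chosen.  The arc \<open>\<gamma> R\<close>, drawn in the
4-gon, joins the middle points of this pair inside the tile.  The uniqueness clause
says that every middle point is used exactly once, counting ends of arcs.\<close>

definition simple_pentagonal_subdivision ::
  "'a::t2_space set \<Rightarrow> 'a set \<Rightarrow> 'a set set \<Rightarrow> 'a set \<Rightarrow> 'a set set \<Rightarrow> bool" where
  "simple_pentagonal_subdivision S V E V' E' \<longleftrightarrow>
     (\<exists>m \<Phi> \<gamma>.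
        (\<forall>e\<in>E. m e \<in> e) \<and>
        (\<forall>R\<in>tiles S V E. polygon_map V E 4 (\<Phi> R) R \<and>
           arc (\<gamma> R) \<and> \<gamma> R ` {0<..<1} \<subseteq> ball 0 1 \<and>
           pathstart (\<gamma> R) \<in> polygon_side 4 0 \<and>
           \<Phi> R (pathstart (\<gamma> R)) = m (\<Phi> R ` polygon_side 4 0) \<and>
           pathfinish (\<gamma> R) \<in> polygon_side 4 2 \<and>
           \<Phi> R (pathfinish (\<gamma> R)) = m (\<Phi> R ` polygon_side 4 2)) \<and>
        (\<forall>e\<in>E. \<exists>!(R, i). R \<in> tiles S V E \<and> i \<in> {0, 2} \<and> \<Phi> R ` polygon_side 4 i = e) \<and>
        V' = V \<union> m ` E \<and>
        E' = half_edges m E \<union> {\<Phi> R ` \<gamma> R ` {0<..<1} | R. R \<in> tiles S V E})"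

definition pentagonally_subdivisible ::
  "'a::t2_space set \<Rightarrow> 'a set \<Rightarrow> 'a set set \<Rightarrow> bool" where
  "pentagonally_subdivisible S V E \<longleftrightarrow> (\<exists>V' E'. simple_pentagonal_subdivision S V E V' E')"

end

theory Submission imports Defs begin

text \<open>Orienting the tiles of T amounts to choosing a direction of rotation in each of them.
A choice is coherent if at every edge the two adjacent sides traverse the edge in
opposite directions after correction by the signs of their tiles.

S is orientable iff a coherent choice exists: two sides at an edge can be glued to a
parametrization of a neighbourhood of the edge by a strip, and comparing local degrees
in its upper and lower half relates signs to directions.  Orientations extend over
vertices because a punctured disk is connected.

T(4) is subdivisible iff a coherent choice exists: as every edge at a center is used once,
the chosen pairs of opposite edges rotate consistently around the center of each tile R, which
is a direction of rotation in R, and each side uses the half of its edge picked out by this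
direction.  Every half edge is used once iff the two sides of each edge use different
halves, which is coherence.\<close>

text \<open>Since the surface is only a topological manifold, orientation is carried by a local
  degree with values 1 and -1 that is multiplicative, locally constant, and computed for explicit
  maps by straight-line homotopies. Two obstacles come from the generality of the definitions.
  First, a tiling asserts neither that there are finitely many tiles nor that an edge borders tiles
  on two sides; both follow from invariance of domain, as does the fact that every injective
  parametrization by a plane open set is the inverse of a chart. Second, a pentagonal subdivision
  brings its own coordinates on each quadrilateral, so the notion of opposite edges must be shown
  not to depend on them. Two coordinate maps of a tile with equally many sides differ by a
  homeomorphism of the closed disk that permutes the sides, and opposite sides of a 4-gon are
  recognized topologically: their closures are disjoint. A polygon map may identify boundary points,
  so the homeomorphism is not just a composition with an inverse; it has to be extended from the
  open disk.\<close>

section \<open>Local degree of plane maps\<close>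

text \<open>The eventual value for small radii depends only on the germ of \<open>h\<close> at
  \<open>z\<close>, which permits comparisons on arbitrary neighbourhoods.\<close>

definition local_degree :: "(complex \<Rightarrow> complex) \<Rightarrow> complex \<Rightarrow> complex" where
  "local_degree h z =
     (THE d. \<forall>\<^sub>F r in at_right 0. winding_number (h \<circ> circlepath z r) (h z) = d)"

lemma local_degree_eventuallyI:
  assumes "\<forall>\<^sub>F r in at_right 0. winding_number (h \<circ> circlepath z r) (h z) = d"
  shows "local_degree h z = d"
  unfolding local_degree_def
proof (rule the_equality)
  fix d' assume "\<forall>\<^sub>F r in at_right 0. winding_number (h \<circ> circlepath z r) (h z) = d'"
  with assms have "\<forall>\<^sub>F r in at_right (0::real). d' = d"
    by eventually_elim auto
  then show "d' = d" by simp
qed (fact assms)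

lemma eventually_small_circle:
  assumes "open A" "z \<in> A"
    and "\<And>r. 0 < r \<Longrightarrow> cball z r \<subseteq> A \<Longrightarrow> P r"
  shows "eventually P (at_right (0::real))"
proof -
  obtain r0 where "r0 > 0" "cball z r0 \<subseteq> A"
    using assms by (meson open_contains_cball)
  then show ?thesis
    unfolding eventually_at_right_field
    by (intro exI[of _ r0]) (auto intro!: assms(3))
qed

lemma local_degree_eqI:
  assumes "open A" "z \<in> A"
    and "\<And>r. 0 < r \<Longrightarrow> cball z r \<subseteq> A \<Longrightarrow> winding_number (h \<circ> circlepath z r) (h z) = d"
  shows "local_degree h z = d"
  by (rule local_degree_eventuallyI, rule eventually_small_circle[OF assms])

lemma path_image_circle_subset:
  assumes "0 < r" shows "path_image (circlepath z r) \<subseteq> cball z r - {z}"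
  using assms by (auto simp: path_image_circlepath)

text \<open>Neither degree has to exist beforehand: the predicates under the two THE operators are
  equivalent.\<close>

lemma local_degree_winding_cong:
  assumes "open A" "z \<in> A"
    and "\<And>r. 0 < r \<Longrightarrow> cball z r \<subseteq> A \<Longrightarrow>
           winding_number (h \<circ> circlepath z r) (h z) = winding_number (g \<circ> circlepath z r) (g z)"
  shows "local_degree h z = local_degree g z"
proof -
  have "\<forall>\<^sub>F r in at_right 0.
          winding_number (h \<circ> circlepath z r) (h z) = winding_number (g \<circ> circlepath z r) (g z)"
    by (rule eventually_small_circle[OF assms])
  then have "(\<forall>\<^sub>F r in at_right 0. winding_number (h \<circ> circlepath z r) (h z) = d) \<longleftrightarrow>
        (\<forall>\<^sub>F r in at_right 0. winding_number (g \<circ> circlepath z r) (g z) = d)" for d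
    by (rule eventually_subst[OF eventually_mono]) simp
  then show ?thesis unfolding local_degree_def by simp
qed

lemma local_degree_cong:
  assumes "open A" "z \<in> A" and eq: "\<And>w. w \<in> A \<Longrightarrow> h w = g w"
  shows "local_degree h z = local_degree g z"
proof (rule local_degree_winding_cong[OF assms(1,2)])
  fix r :: real assume r: "0 < r" "cball z r \<subseteq> A"
  have "\<forall>t\<in>{0..1}. (h \<circ> circlepath z r) t = (g \<circ> circlepath z r) t"
  proof
    fix t :: real assume "t \<in> {0..1}"
    then have "circlepath z r t \<in> path_image (circlepath z r)"
      by (auto simp: path_image_def)
    then have "circlepath z r t \<in> A" using r path_image_circle_subset by blast
    then show "(h \<circ> circlepath z r) t = (g \<circ> circlepath z r) t" by (simp add: eq)
  qed
  then show "winding_number (h \<circ> circlepath z r) (h z) = winding_number (g \<circ> circlepath z r) (g z)"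
    using eq[OF assms(2)] by (auto intro!: winding_number_cong)
qed

lemma image_circle_loop:
  assumes "continuous_on A h" "inj_on h A" "0 < r" "cball z r \<subseteq> A" "w \<in> ball z r"
  shows "path (h \<circ> circlepath z r)" "h w \<notin> path_image (h \<circ> circlepath z r)"
    "pathfinish (h \<circ> circlepath z r) = pathstart (h \<circ> circlepath z r)"
    "simple_path (h \<circ> circlepath z r)"
proof -
  have sub: "path_image (circlepath z r) \<subseteq> A"
    using path_image_circle_subset[OF assms(3)] assms(4) by blast
  show "path (h \<circ> circlepath z r)"
    using assms sub by (intro path_continuous_image) (auto intro: continuous_on_subset)
  show "pathfinish (h \<circ> circlepath z r) = pathstart (h \<circ> circlepath z r)"
    by (simp add: pathfinish_compose pathstart_compose)
  have "w \<in> A" using assms by auto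
  show "h w \<notin> path_image (h \<circ> circlepath z r)"
  proof
    assume "h w \<in> path_image (h \<circ> circlepath z r)"
    then obtain u where "u \<in> path_image (circlepath z r)" "h u = h w"
      by (auto simp: path_image_compose)
    then have "u = w" using assms(2) sub \<open>w \<in> A\<close> by (auto dest: inj_onD)
    then show False using \<open>u \<in> _\<close> assms by (auto simp: path_image_circlepath dist_commute)
  qed
  show "simple_path (h \<circ> circlepath z r)"
    using assms sub
    by (intro simple_path_continuous_image) (auto intro: continuous_on_subset inj_on_subset simp: simple_path_circlepath)
qed

text \<open>The straight homotopy between the equally parametrized circles avoids \<open>w\<close>,
  and injectivity of \<open>h\<close> carries this over to the images.\<close>

lemma winding_image_circle_shift:
  assumes "continuous_on A h" "inj_on h A" "0 < r" "cball z r \<subseteq> A"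
    and "0 < \<rho>" "cball w \<rho> \<subseteq> cball z r" "w \<in> ball z r"
  shows "winding_number (h \<circ> circlepath z r) (h w) = winding_number (h \<circ> circlepath w \<rho>) (h w)"
proof -
  have "homotopic_loops (cball z r - {w}) (circlepath z r) (circlepath w \<rho>)"
  proof (rule homotopic_loops_linear)
    fix t :: real assume "t \<in> {0..1}"
    define e where "e = exp (2 * of_real pi * \<i> * t)"
    have ne: "norm e = 1" by (simp add: e_def norm_exp_eq_Re)
    have c1: "circlepath z r t = z + r * e" and c2: "circlepath w \<rho> t = w + \<rho> * e"
      by (simp_all add: circlepath e_def)
    have m1: "z + r * e \<in> cball z r" using ne assms by (auto simp: dist_norm norm_mult)
    have "w + \<rho> * e \<in> cball w \<rho>" using ne assms by (auto simp: dist_norm norm_mult)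
    then have m2: "w + \<rho> * e \<in> cball z r" using assms by blast
    have seg: "closed_segment (z + r * e) (w + \<rho> * e) \<subseteq> cball z r"
      using m1 m2 by (simp add: closed_segment_subset)
    have "w \<notin> closed_segment (z + r * e) (w + \<rho> * e)"
    proof
      assume "w \<in> closed_segment (z + r * e) (w + \<rho> * e)"
      then obtain s where s: "0 \<le> s" "s \<le> 1" "w = (1 - s) *\<^sub>R (z + r * e) + s *\<^sub>R (w + \<rho> * e)"
        by (auto simp: in_segment)
      \<comment> \<open>Solving for \<open>w\<close> makes \<open>(1 - s) * (w - z)\<close> a vector
        of length \<open>(1 - s) * r + s * \<rho>\<close>, which is too long because
        \<open>norm (w - z) < r\<close>.\<close>
      then have "(1 - s) *\<^sub>R (w - z) = ((1 - s) * r + s * \<rho>) *\<^sub>R e"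
        by (auto simp: algebra_simps scaleR_conv_of_real)
      then have "norm ((1 - s) *\<^sub>R (w - z)) = norm (((1 - s) * r + s * \<rho>) *\<^sub>R e)" by simp
      then have "(1 - s) * norm (w - z) = (1 - s) * r + s * \<rho>"
        using s assms ne by simp
      moreover have "norm (w - z) < r" using assms by (simp add: dist_norm norm_minus_commute)
      then have "(1 - s) * norm (w - z) < (1 - s) * r + s * \<rho>"
      proof (cases "s = 1")
        case False
        then have "(1 - s) * norm (w - z) < (1 - s) * r"
          using s \<open>norm (w - z) < r\<close> by (intro mult_strict_left_mono) auto
        moreover have "0 \<le> s * \<rho>" using s assms by simp
        ultimately show ?thesis by linarith
      qed (use assms in simp)
      ultimately show False by simp
    qed
    then show "closed_segment (circlepath z r t) (circlepath w \<rho> t) \<subseteq> cball z r - {w}"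
      using seg c1 c2 by auto
  qed auto
  then have "homotopic_loops (- {h w}) (h \<circ> circlepath z r) (h \<circ> circlepath w \<rho>)"
  proof (rule homotopic_loops_continuous_image)
    show "continuous_on (cball z r - {w}) h"
      using assms by (blast intro: continuous_on_subset)
    have "w \<in> A" using assms by auto
    then show "h \<in> cball z r - {w} \<rightarrow> - {h w}" using assms by (auto dest: inj_onD)
  qed
  then show ?thesis by (rule winding_number_homotopic_loops)
qed

text \<open>Every smaller concentric circle is a shift of the given one. This links the limit in
  \<open>local_degree\<close> to the circles in \<open>orientation_preserving_on\<close>.\<close>

lemma local_degree_eq_winding:
  assumes "continuous_on A h" "inj_on h A" "0 < r" "cball z r \<subseteq> A"
  shows "local_degree h z = winding_number (h \<circ> circlepath z r) (h z)"
  using assms by (intro local_degree_eqI[of "ball z r"])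
    (auto intro!: winding_image_circle_shift[symmetric, OF assms])

text \<open>A small circle about \<open>w\<close> is exchanged for the large circle about
  \<open>z\<close>; then the point is moved from \<open>h w\<close> to \<open>h z\<close> inside the
  connected image of the open ball, which misses the image of the circle. This local constancy
  propagates signs over connected sets.\<close>

lemma local_degree_eq_nearby:
  assumes "continuous_on A h" "inj_on h A" "0 < r" "cball z r \<subseteq> A" "w \<in> ball z r"
  shows "local_degree h w = local_degree h z"
proof -
  obtain \<rho> where \<rho>: "0 < \<rho>" "cball w \<rho> \<subseteq> ball z r"
    using assms(5) by (meson open_ball open_contains_cball)
  have "local_degree h w = winding_number (h \<circ> circlepath w \<rho>) (h w)"
    using assms \<rho> by (intro local_degree_eq_winding[of A]) (auto dest!: subsetD[OF \<rho>(2)])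
  also have "\<dots> = winding_number (h \<circ> circlepath z r) (h w)"
    using assms \<rho> by (intro winding_image_circle_shift[symmetric, of A]) auto
  also have "\<dots> = winding_number (h \<circ> circlepath z r) (h z)"
  proof -
    have "connected (h ` ball z r)"
      using assms by (intro connected_continuous_image connected_ball)
        (meson ball_subset_cball continuous_on_subset subset_trans)
    moreover have "h ` ball z r \<inter> path_image (h \<circ> circlepath z r) = {}"
      using image_circle_loop(2)[OF assms(1-4)] by blast
    ultimately have "winding_number (h \<circ> circlepath z r) constant_on h ` ball z r"
      using image_circle_loop[OF assms(1-5)] by (intro winding_number_constant) auto
    then show ?thesis using assms unfolding constant_on_def
      by (metis centre_in_ball imageI)
  qed
  also have "\<dots> = local_degree h z"
    using assms by (intro local_degree_eq_winding[symmetric, of A]) auto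
  finally show ?thesis .
qed

text \<open>The two loops wind about different points \<open>h z\<close> and \<open>g z\<close>, so
  both are translated to wind about 0 before the linear homotopy is applied. The explicit degrees
  below are obtained by comparing with a model map in this way.\<close>

lemma local_degree_homotopic:
  assumes "open A" "z \<in> A" "continuous_on A h" "continuous_on A g"
    and seg: "\<And>w. w \<in> A \<Longrightarrow> w \<noteq> z \<Longrightarrow> 0 \<notin> closed_segment (h w - h z) (g w - g z)"
  shows "local_degree h z = local_degree g z"
proof (rule local_degree_winding_cong[OF assms(1,2)])
  fix r :: real assume r: "0 < r" "cball z r \<subseteq> A"
  have sub: "path_image (circlepath z r) \<subseteq> A - {z}"
    using r path_image_circle_subset by blast
  have paths: "path (f \<circ> circlepath z r)" if "continuous_on A f" for f
    using that sub by (intro path_continuous_image) (auto intro: continuous_on_subset)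
  have "winding_number (\<lambda>t. (h \<circ> circlepath z r) t - h z) 0 = winding_number (\<lambda>t. (g \<circ> circlepath z r) t - g z) 0"
  proof (rule winding_number_loops_linear_eq[symmetric])
    show "path (\<lambda>t. (h \<circ> circlepath z r) t - h z)" "path (\<lambda>t. (g \<circ> circlepath z r) t - g z)"
      using paths[OF assms(3)] paths[OF assms(4)] unfolding path_def by (auto intro!: continuous_intros)
    fix t :: real assume "t \<in> {0..1}"
    then have "circlepath z r t \<in> path_image (circlepath z r)" by (auto simp: path_image_def)
    then have "circlepath z r t \<in> A - {z}" using sub by blast
    then show "0 \<notin> closed_segment ((h \<circ> circlepath z r) t - h z) ((g \<circ> circlepath z r) t - g z)"
      using seg by auto
  qed (auto simp: pathstart_def pathfinish_def circlepath)
  then show "winding_number (h \<circ> circlepath z r) (h z) = winding_number (g \<circ> circlepath z r) (g z)"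
    by (simp add: winding_number_offset[of _ "h z"] winding_number_offset[of _ "g z"])
qed

lemma local_degree_id: "local_degree (\<lambda>w. w) z = 1"
  by (rule local_degree_eqI[of UNIV]) (auto simp: o_def winding_number_circlepath_centre)

lemma local_degree_id_on:
  assumes "open A" "z \<in> A" "\<And>w. w \<in> A \<Longrightarrow> h w = w"
  shows "local_degree h z = 1"
  using local_degree_cong[of A z h "\<lambda>w. w"] assms by (simp add: local_degree_id)

lemma local_degree_cnj: "local_degree cnj z = -1"
proof (rule local_degree_eqI[of UNIV])
  fix r :: real assume "0 < r"
  then have "winding_number (cnj \<circ> circlepath z r) (cnj z) = - cnj (winding_number (circlepath z r) z)"
    by (intro winding_number_cnj) (auto simp: path_image_circlepath)
  then show "winding_number (cnj \<circ> circlepath z r) (cnj z) = -1"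
    using \<open>0 < r\<close> by (simp add: winding_number_circlepath_centre)
qed auto

text \<open>A loop in the complement of a point is homotopic there to a loop at a small distance of
the point; the homotopy classes of loops with winding number 0 and \<open>\<plusminus>1\<close> are
represented by a constant and by circles.\<close>

lemma winding_number_image_simple_loop:
  assumes g: "continuous_on (cball c \<delta>) g" "inj_on g (cball c \<delta>)" and "0 < \<delta>"
    and p: "simple_path p" "pathfinish p = pathstart p" "path_image p \<subseteq> cball c \<delta> - {c}"
  shows "winding_number (g \<circ> p) (g c) = winding_number (g \<circ> circlepath c \<delta>) (g c) * winding_number p c"
proof -
  \<comment> \<open>Radial retraction of the punctured plane onto the punctured disk. It pushes a
    homotopy in \<open>- {c}\<close> into the domain of \<open>g\<close> and fixes both
    loops.\<close>
  define sq where "sq u = c + of_real (min 1 (\<delta> / norm (u - c))) * (u - c)" for u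
  have sq_cont: "continuous_on (- {c}) sq"
    unfolding sq_def by (intro continuous_intros) auto
  have sq_norm: "norm (of_real (min 1 (\<delta> / norm (u - c))) * (u - c)) = min (norm (u - c)) \<delta>" if "u \<noteq> c" for u
    using that \<open>0 < \<delta>\<close> by (auto simp: norm_mult min_def divide_simps abs_if)
  have sq_im: "sq u \<in> cball c \<delta> - {c}" if "u \<noteq> c" for u
  proof -
    have "dist c (sq u) = min (norm (u - c)) \<delta>"
      unfolding sq_def dist_norm using sq_norm[OF that] by (simp add: norm_minus_commute)
    then show ?thesis using that \<open>0 < \<delta>\<close> by (auto simp: min_def split: if_splits)
  qed
  have sq_id: "sq u = u" if "u \<in> cball c \<delta> - {c}" for u
    using that unfolding sq_def
    by (auto simp: dist_norm norm_minus_commute min_def divide_simps split: if_splits)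
  have key: "winding_number (g \<circ> p) (g c) = winding_number (g \<circ> q) (g c)"
    if q: "path q" "pathfinish q = pathstart q" "path_image q \<subseteq> cball c \<delta> - {c}"
      and eq: "winding_number p c = winding_number q c" for q
  proof -
    have "homotopic_loops (- {c}) p q"
      using p q eq by (subst winding_number_homotopic_loops_eq[symmetric]) (auto simp: simple_path_imp_path)
    then have "homotopic_loops (cball c \<delta> - {c}) (sq \<circ> p) (sq \<circ> q)"
      by (rule homotopic_loops_continuous_image[OF _ sq_cont]) (use sq_im in auto)
    then have hl: "homotopic_loops (cball c \<delta> - {c}) p q"
    proof -
      assume *: "homotopic_loops (cball c \<delta> - {c}) (sq \<circ> p) (sq \<circ> q)"
      have "homotopic_loops (cball c \<delta> - {c}) p (sq \<circ> p)"
        using p sq_id by (intro homotopic_loops_eq) (auto simp: simple_path_imp_path path_image_def image_subset_iff)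
      moreover have "homotopic_loops (cball c \<delta> - {c}) (sq \<circ> q) q"
        using q sq_id by (intro homotopic_loops_sym[OF homotopic_loops_eq]) (auto simp: path_image_def image_subset_iff)
      ultimately show ?thesis using * by (meson homotopic_loops_trans)
    qed
    have "homotopic_loops (- {g c}) (g \<circ> p) (g \<circ> q)"
    proof (rule homotopic_loops_continuous_image[OF hl])
      show "continuous_on (cball c \<delta> - {c}) g" using g by (blast intro: continuous_on_subset)
      show "g \<in> cball c \<delta> - {c} \<rightarrow> - {g c}"
        using g(2) \<open>0 < \<delta>\<close> by (auto dest!: inj_onD)
    qed
    then show ?thesis by (rule winding_number_homotopic_loops)
  qed
  have circ: "path_image (circlepath c \<delta>) \<subseteq> cball c \<delta> - {c}" using path_image_circle_subset[OF \<open>0<\<delta>\<close>] .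
  have gc: "path (g \<circ> circlepath c \<delta>)" "g c \<notin> path_image (g \<circ> circlepath c \<delta>)"
    using image_circle_loop[OF g \<open>0<\<delta>\<close>, of c c] \<open>0 < \<delta>\<close> by auto
  have "winding_number p c \<in> {-1, 0, 1}"
    using p by (intro simple_closed_path_winding_number_cases) auto
  then consider "winding_number p c = -1" | "winding_number p c = 0" | "winding_number p c = 1" by blast
  then show ?thesis
  proof cases
    case 1
    have "winding_number (g \<circ> p) (g c) = winding_number (g \<circ> reversepath (circlepath c \<delta>)) (g c)"
      using circ 1 \<open>0 < \<delta>\<close> by (intro key)
        (auto simp: winding_number_reversepath winding_number_circlepath_centre)
    also have "g \<circ> reversepath (circlepath c \<delta>) = reversepath (g \<circ> circlepath c \<delta>)"
      by (auto simp: reversepath_def)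
    finally show ?thesis using 1 gc by (simp add: winding_number_reversepath del: o_apply)
  next
    case 2
    let ?q = "linepath (c + \<delta>) (c + \<delta>)"
    have "winding_number (g \<circ> p) (g c) = winding_number (g \<circ> ?q) (g c)"
      using 2 \<open>0 < \<delta>\<close> by (intro key) (auto simp: dist_norm)
    also have "g \<circ> ?q = linepath (g (c + \<delta>)) (g (c + \<delta>))"
      by (auto simp: linepath_refl)
    also have "winding_number \<dots> (g c) = 0"
    proof (rule winding_number_trivial)
      show "g c \<noteq> g (c + \<delta>)"
        using inj_onD[OF g(2), of "c + \<delta>" c] \<open>0 < \<delta>\<close> by (auto simp: dist_norm)
    qed
    finally show ?thesis using 2 by (simp add: o_def)
  next
    case 3
    then show ?thesis
      using circ \<open>0 < \<delta>\<close> by (subst key[of "circlepath c \<delta>"]) (auto simp: winding_number_circlepath_centre)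
  qed
qed

text \<open>The map \<open>h\<close> sends a small circle to a simple loop near \<open>h z\<close>;
  \<open>g\<close> multiplies its winding number by the winding number of the image of a
  circle.\<close>

lemma local_degree_compose:
  assumes h: "open A" "continuous_on A h" "inj_on h A" "z \<in> A"
    and g: "open B" "continuous_on B g" "inj_on g B" "h z \<in> B"
  shows "local_degree (g \<circ> h) z = local_degree g (h z) * local_degree h z"
proof -
  obtain \<delta> where \<delta>: "0 < \<delta>" "cball (h z) \<delta> \<subseteq> B" using g by (meson open_contains_cball)
  \<comment> \<open>Shrinking the domain keeps the image of the circle inside a disk on which the
    degree of \<open>g\<close> can be read off.\<close>
  define A' where "A' = A \<inter> h -` ball (h z) \<delta>"
  have "open A'" unfolding A'_def using h by (metis continuous_on_open_vimage open_ball Int_commute)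
  moreover have "z \<in> A'" using h \<delta> by (simp add: A'_def)
  ultimately obtain r where r: "0 < r" "cball z r \<subseteq> A'" by (meson open_contains_cball)
  have hA': "continuous_on A' h" "inj_on h A'"
    using h by (auto simp: A'_def intro: continuous_on_subset inj_on_subset)
  have im: "h ` A' \<subseteq> cball (h z) \<delta>" by (auto simp: A'_def)
  have gd: "continuous_on (cball (h z) \<delta>) g" "inj_on g (cball (h z) \<delta>)"
    using g \<delta> by (auto intro: continuous_on_subset inj_on_subset)
  have gh: "continuous_on A' (g \<circ> h)" "inj_on (g \<circ> h) A'"
    using hA' gd im by (auto intro!: continuous_on_compose comp_inj_on intro: continuous_on_subset inj_on_subset simp del: comp_apply)
  note L = image_circle_loop[OF hA' r, of z]
  have "local_degree (g \<circ> h) z = winding_number ((g \<circ> h) \<circ> circlepath z r) ((g \<circ> h) z)"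
    using gh r by (rule local_degree_eq_winding)
  also have "\<dots> = winding_number (g \<circ> (h \<circ> circlepath z r)) (g (h z))" by (simp add: o_assoc)
  also have "\<dots> = winding_number (g \<circ> circlepath (h z) \<delta>) (g (h z)) * winding_number (h \<circ> circlepath z r) (h z)"
  proof (rule winding_number_image_simple_loop[OF gd \<delta>(1)])
    have "path_image (h \<circ> circlepath z r) \<subseteq> h ` A'"
      unfolding path_image_compose using r path_image_circle_subset[of r z] by blast
    then show "path_image (h \<circ> circlepath z r) \<subseteq> cball (h z) \<delta> - {h z}"
      using L(2) im r by auto
  qed (use L r in auto)
  also have "winding_number (g \<circ> circlepath (h z) \<delta>) (g (h z)) = local_degree g (h z)"
    using gd \<delta>(1) by (intro local_degree_eq_winding[symmetric]) auto
  also have "winding_number (h \<circ> circlepath z r) (h z) = local_degree h z"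
    using hA' r by (intro local_degree_eq_winding[symmetric]) auto
  finally show ?thesis .
qed

text \<open>A simple loop has winding number -1, 0 or 1. The value 0 is excluded because the degrees
  of \<open>h\<close> and its inverse multiply to the degree of the identity.\<close>

lemma local_degree_cases:
  assumes "open A" "continuous_on A h" "inj_on h A" "z \<in> A"
  shows "local_degree h z = 1 \<or> local_degree h z = -1"
proof -
  obtain r where r: "0 < r" "cball z r \<subseteq> A" using assms by (meson open_contains_cball)
  note L = image_circle_loop[OF assms(2,3) r, of z]
  have "local_degree h z = winding_number (h \<circ> circlepath z r) (h z)"
    using assms r by (intro local_degree_eq_winding) auto
  also have "\<dots> \<in> {-1, 0, 1}"
    using L r by (intro simple_closed_path_winding_number_cases) auto
  finally have *: "local_degree h z \<in> {-1, 0, 1}" .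
  obtain k where k: "\<And>x. x \<in> A \<Longrightarrow> k (h x) = x" "continuous_on (h ` A) k"
  proof -
    obtain k where "homeomorphism A (h ` A) h k"
      using invariance_of_domain_homeomorphism[OF assms(1,2) _ assms(3)] by auto
    then show thesis using that by (auto simp: homeomorphism_def)
  qed
  have oh: "open (h ` A)" using assms by (simp add: invariance_of_domain)
  have "local_degree (k \<circ> h) z = local_degree k (h z) * local_degree h z"
    using assms oh k by (intro local_degree_compose[of A _ _ "h ` A"]) (auto intro!: inj_onI)
  moreover have "local_degree (k \<circ> h) z = 1"
    using k assms by (intro local_degree_id_on[of A]) auto
  ultimately show ?thesis using * by auto
qed

lemma orientation_preserving_on_iff:
  assumes "open A" "continuous_on A h" "inj_on h A"
  shows "orientation_preserving_on A h \<longleftrightarrow> (\<forall>z\<in>A. local_degree h z = 1)"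
  unfolding orientation_preserving_on_def
proof (intro ball_cong refl iffI allI impI)
  fix z assume z: "z \<in> A"
  then obtain r where r: "0 < r" "cball z r \<subseteq> A" using assms by (meson open_contains_cball)
  assume "\<forall>r>0. cball z r \<subseteq> A \<longrightarrow> winding_number (h \<circ> circlepath z r) (h z) = 1"
  then show "local_degree h z = 1" using local_degree_eq_winding[OF assms(2,3) r] r by simp
next
  fix z r assume "z \<in> A" "local_degree h z = 1" "0 < r" "cball z r \<subseteq> A"
  then show "winding_number (h \<circ> circlepath z r) (h z) = 1"
    using local_degree_eq_winding[OF assms(2,3)] by simp
qed

text \<open>If \<open>c\<close> is off the closed negative real axis, the segment from
  \<open>c\<close> to 1 avoids 0 and gives a homotopy to the identity. A negative real
  \<open>d\<close> is the square of such a \<open>c\<close>, and degrees multiply.\<close>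

lemma local_degree_mult:
  assumes "d \<noteq> 0" shows "local_degree (\<lambda>w. d * w) z = 1"
proof -
  have *: "local_degree (\<lambda>w. c * w) z = 1" if c: "c \<notin> \<real>\<^sub>\<le>\<^sub>0" for c z
  proof -
    have "local_degree (\<lambda>w. c * w) z = local_degree (\<lambda>w. w) z"
    proof (rule local_degree_homotopic[of UNIV])
      fix w assume "w \<noteq> z"
      show "0 \<notin> closed_segment (c * w - c * z) (w - z)"
      proof
        assume "0 \<in> closed_segment (c * w - c * z) (w - z)"
        then obtain s where s: "0 \<le> s" "s \<le> 1" "0 = (1 - s) *\<^sub>R (c * w - c * z) + s *\<^sub>R (w - z)"
          by (auto simp: in_segment)
        then have "((1 - s) * c + s) * (w - z) = 0"
          by (simp add: algebra_simps scaleR_conv_of_real)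
        then have e: "(1 - s) * c + s = 0" using \<open>w \<noteq> z\<close> by simp
        then have "s \<noteq> 1" by auto
        then have "1 - of_real s \<noteq> (0::complex)" by (metis of_real_1 of_real_eq_iff right_minus_eq)
        then have "c = - of_real s / (1 - of_real s)"
          using e by (simp add: field_simps add_eq_0_iff)
        then have "c = of_real (- (s / (1 - s)))" by simp
        moreover have "- (s / (1 - s)) \<le> 0" using s by simp
        ultimately show False using c by (metis nonpos_Reals_of_real_iff)
      qed
    qed (auto intro!: continuous_intros)
    then show ?thesis by (simp add: local_degree_id)
  qed
  show ?thesis
  proof (cases "d \<in> \<real>\<^sub>\<le>\<^sub>0")
    case True
    obtain c where "c ^ 2 = d" "0 < Re c \<or> Re c = 0 \<and> 0 \<le> Im c"
      using power2_csqrt csqrt_principal by blast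
    then have c: "c \<notin> \<real>\<^sub>\<le>\<^sub>0" "c \<noteq> 0"
      using assms by (auto simp: complex_nonpos_Reals_iff complex_eq_iff)
    have "local_degree ((\<lambda>w. c * w) \<circ> (\<lambda>w. c * w)) z = local_degree (\<lambda>w. c * w) (c * z) * local_degree (\<lambda>w. c * w) z"
      using c by (intro local_degree_compose[of UNIV _ _ UNIV]) (auto intro!: continuous_intros inj_onI)
    moreover have "(\<lambda>w. c * w) \<circ> (\<lambda>w. c * w) = (\<lambda>w. d * w)"
      using \<open>c ^ 2 = d\<close> by (auto simp: power2_eq_square mult.assoc[symmetric])
    ultimately show ?thesis using *[OF c(1)] by simp
  qed (use * in auto)
qed

text \<open>Near \<open>z\<close> the increment of \<open>h\<close> differs from its linear part by
  at most half the length of that part, so the straight homotopy to multiplication by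
  \<open>d\<close> avoids 0.\<close>

lemma local_degree_derivative:
  assumes "open A" "z \<in> A" "continuous_on A h" "(h has_field_derivative d) (at z)" "d \<noteq> 0"
  shows "local_degree h z = 1"
proof -
  have "(h has_derivative (\<lambda>x. d * x)) (at z)"
    using assms by (simp add: has_field_derivative_def)
  then obtain \<delta> where \<delta>: "0 < \<delta>"
    "\<And>y. norm (y - z) < \<delta> \<Longrightarrow> norm (h y - h z - d * (y - z)) \<le> norm d / 2 * norm (y - z)"
    using assms unfolding has_derivative_at_alt by (metis half_gt_zero zero_less_norm_iff)
  have "local_degree h z = local_degree (\<lambda>w. d * w) z"
  proof (rule local_degree_homotopic[of "A \<inter> ball z \<delta>"])
    fix w assume w: "w \<in> A \<inter> ball z \<delta>" "w \<noteq> z"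
    show "0 \<notin> closed_segment (h w - h z) (d * w - d * z)"
    proof
      assume "0 \<in> closed_segment (h w - h z) (d * w - d * z)"
      then obtain s where s: "0 \<le> s" "s \<le> 1" "0 = (1 - s) *\<^sub>R (h w - h z) + s *\<^sub>R (d * w - d * z)"
        by (auto simp: in_segment)
      then have "(1 - s) *\<^sub>R (h w - h z - d * (w - z)) = - (d * (w - z))"
        by (simp add: algebra_simps scaleR_conv_of_real)
      then have "norm ((1 - s) *\<^sub>R (h w - h z - d * (w - z))) = norm (d * (w - z))" by simp
      then have "norm d * norm (w - z) = (1 - s) * norm (h w - h z - d * (w - z))"
        using s by (simp add: norm_mult)
      also have "\<dots> \<le> 1 * (norm d / 2 * norm (w - z))"
        using \<delta>(2)[of w] w s by (intro mult_mono) (auto simp: dist_norm norm_minus_commute)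
      finally show False using w assms by simp
    qed
  qed (use assms \<delta> in \<open>auto intro!: continuous_intros intro: continuous_on_subset\<close>)
  then show ?thesis using local_degree_mult[OF assms(5)] by simp
qed

text \<open>This is the shape of the passage across an edge. With no derivative of \<open>h\<close>
  available, monotonicity does the work: if the imaginary parts agree, the real parts differ, and
  the increments of \<open>h\<close> and of the identity have the same sign, so the homotopy to
  \<open>cnj\<close> avoids 0.\<close>

lemma local_degree_reflect_increasing:
  assumes h: "strict_mono_on {0<..<1::real} h" "continuous_on {0<..<1} h" and z: "Re z \<in> {0<..<1}"
  shows "local_degree (\<lambda>w. Complex (h (Re w)) (- Im w)) z = -1"
proof -
  have "local_degree (\<lambda>w. Complex (h (Re w)) (- Im w)) z = local_degree cnj z"
  proof (rule local_degree_homotopic[of "Re -` {0<..<1}"])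
    show "open (Re -` {0<..<1})" by (intro open_vimage) (auto intro!: continuous_intros)
    show "continuous_on (Re -` {0<..<1}) (\<lambda>w. Complex (h (Re w)) (- Im w))"
      unfolding Complex_eq by (intro continuous_intros continuous_on_compose2[OF h(2)]) auto
    fix w assume w: "w \<in> Re -` {0<..<1}" "w \<noteq> z"
    show "0 \<notin> closed_segment (Complex (h (Re w)) (- Im w) - Complex (h (Re z)) (- Im z)) (cnj w - cnj z)"
    proof
      assume "0 \<in> closed_segment (Complex (h (Re w)) (- Im w) - Complex (h (Re z)) (- Im z)) (cnj w - cnj z)"
      then obtain s where s: "0 \<le> s" "s \<le> 1"
        "0 = (1 - s) *\<^sub>R (Complex (h (Re w)) (- Im w) - Complex (h (Re z)) (- Im z)) + s *\<^sub>R (cnj w - cnj z)"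
        by (auto simp: in_segment)
      have re: "(1 - s) * (h (Re w) - h (Re z)) + s * (Re w - Re z) = 0"
        using arg_cong[OF s(3), of Re] by simp
      have im: "Im w = Im z"
        using arg_cong[OF s(3), of Im] by (simp add: algebra_simps)
      consider "Re w < Re z" | "Re w > Re z" using w im by (metis complex_eq_iff linorder_less_linear)
      then show False
      proof cases
        case 1
        then have "h (Re w) < h (Re z)" using h w z by (auto simp: strict_mono_on_def)
        then have "(1 - s) * (h (Re w) - h (Re z)) + s * (Re w - Re z) < 0"
          using 1 s by (cases "s = 0") (auto intro!: add_nonpos_neg mult_nonneg_nonpos mult_pos_neg)
        then show False using re by simp
      next
        case 2
        then have "h (Re w) > h (Re z)" using h w z by (auto simp: strict_mono_on_def)
        then have "(1 - s) * (h (Re w) - h (Re z)) + s * (Re w - Re z) > 0"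
          using 2 s by (cases "s = 0") (auto intro!: add_nonneg_pos)
        then show False using re by simp
      qed
    qed
  qed (use z in \<open>auto intro!: continuous_intros\<close>)
  then show ?thesis using local_degree_cnj by simp
qed

text \<open>Both coordinates are reversed, so the model map is the half turn, which preserves
  orientation.\<close>

lemma local_degree_reflect_decreasing:
  assumes h: "strict_antimono_on {0<..<1::real} h" "continuous_on {0<..<1} h" and z: "Re z \<in> {0<..<1}"
  shows "local_degree (\<lambda>w. Complex (h (Re w)) (- Im w)) z = 1"
proof -
  have "local_degree (\<lambda>w. Complex (h (Re w)) (- Im w)) z = local_degree (\<lambda>w. -1 * w) z"
  proof (rule local_degree_homotopic[of "Re -` {0<..<1}"])
    show "open (Re -` {0<..<1})" by (intro open_vimage) (auto intro!: continuous_intros)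
    show "continuous_on (Re -` {0<..<1}) (\<lambda>w. Complex (h (Re w)) (- Im w))"
      unfolding Complex_eq by (intro continuous_intros continuous_on_compose2[OF h(2)]) auto
    fix w assume w: "w \<in> Re -` {0<..<1}" "w \<noteq> z"
    show "0 \<notin> closed_segment (Complex (h (Re w)) (- Im w) - Complex (h (Re z)) (- Im z)) (-1 * w - -1 * z)"
    proof
      assume "0 \<in> closed_segment (Complex (h (Re w)) (- Im w) - Complex (h (Re z)) (- Im z)) (-1 * w - -1 * z)"
      then obtain s where s: "0 \<le> s" "s \<le> 1"
        "0 = (1 - s) *\<^sub>R (Complex (h (Re w)) (- Im w) - Complex (h (Re z)) (- Im z)) + s *\<^sub>R (-1 * w - -1 * z)"
        unfolding in_segment by blast
      have re: "(1 - s) * (h (Re w) - h (Re z)) + s * (Re z - Re w) = 0"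
        using arg_cong[OF s(3), of Re] by simp
      have im: "Im w = Im z"
        using arg_cong[OF s(3), of Im] by (simp add: algebra_simps)
      consider "Re w < Re z" | "Re w > Re z" using w im by (metis complex_eq_iff linorder_less_linear)
      then show False
      proof cases
        case 1
        then have "h (Re w) > h (Re z)" using h w z by (auto simp: monotone_on_def)
        then have "(1 - s) * (h (Re w) - h (Re z)) + s * (Re z - Re w) > 0"
          using 1 s by (cases "s = 0") (auto intro!: add_nonneg_pos)
        then show False using re by simp
      next
        case 2
        then have "h (Re w) < h (Re z)" using h w z by (auto simp: monotone_on_def)
        then have "(1 - s) * (h (Re w) - h (Re z)) + s * (Re z - Re w) < 0"
          using 2 s by (cases "s = 0") (auto intro!: add_nonpos_neg mult_nonneg_nonpos mult_pos_neg)
        then show False using re by simp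
      qed
    qed
  qed (use z in \<open>auto intro!: continuous_intros\<close>)
  then show ?thesis using local_degree_mult[of "-1"] by simp
qed

section \<open>Charts and parametrizations of surfaces\<close>

lemma continuous_on_inverse_saturated:
  fixes f :: "'a::t2_space \<Rightarrow> 'b::t2_space"
  assumes "continuous_on K f" "compact K" "Z \<subseteq> K" "inj_on f Z" "f ` Z \<inter> f ` (K - Z) = {}"
  shows "continuous_on (f ` Z) (inv_into Z f)"
  unfolding continuous_on_closed
proof (intro allI impI)
  fix T assume "closedin (top_of_set (inv_into Z f ` f ` Z)) T"
  then have "closedin (top_of_set Z) T" using assms(4) by simp
  then obtain C where C: "closed C" "T = Z \<inter> C" by (auto simp: closedin_closed)
  have "compact (f ` (K \<inter> C))"
    using assms C by (intro compact_continuous_image compact_Int_closed) (auto intro: continuous_on_subset)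
  then have "closedin (top_of_set (f ` Z)) (f ` Z \<inter> f ` (K \<inter> C))"
    by (auto simp: closedin_closed intro: compact_imp_closed)
  moreover have "f ` Z \<inter> inv_into Z f -` T = f ` Z \<inter> f ` (K \<inter> C)"
  proof (rule set_eqI)
    fix y
    show "y \<in> f ` Z \<inter> inv_into Z f -` T \<longleftrightarrow> y \<in> f ` Z \<inter> f ` (K \<inter> C)"
    proof
      assume "y \<in> f ` Z \<inter> inv_into Z f -` T"
      then show "y \<in> f ` Z \<inter> f ` (K \<inter> C)" using assms(3,4) C by auto
    next
      assume y: "y \<in> f ` Z \<inter> f ` (K \<inter> C)"
      then obtain x where x: "x \<in> K" "x \<in> C" "y = f x" by auto
      then have "x \<in> Z" using y assms(5) by blast
      then show "y \<in> f ` Z \<inter> inv_into Z f -` T" using x C assms(4) by auto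
    qed
  qed
  ultimately show "closedin (top_of_set (f ` Z)) (f ` Z \<inter> inv_into Z f -` T)" by simp
qed

text \<open>A parametrization is meant to be the inverse of a chart; openness of its image and
  continuity of the inverse follow from invariance of domain.\<close>

definition surface_param :: "'a::t2_space set \<Rightarrow> complex set \<Rightarrow> (complex \<Rightarrow> 'a) \<Rightarrow> bool" where
  "surface_param S A \<gamma> \<longleftrightarrow> open A \<and> continuous_on A \<gamma> \<and> inj_on \<gamma> A \<and> \<gamma> ` A \<subseteq> S"

lemma surface_paramD:
  assumes "surface_param S A \<gamma>"
  shows "open A" "continuous_on A \<gamma>" "inj_on \<gamma> A" "\<gamma> ` A \<subseteq> S"
  using assms by (auto simp: surface_param_def)

lemma surface_param_subset:
  "surface_param S A \<gamma> \<Longrightarrow> open B \<Longrightarrow> B \<subseteq> A \<Longrightarrow> surface_param S B \<gamma>"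
  by (auto simp: surface_param_def intro: continuous_on_subset inj_on_subset)

lemma chartD:
  assumes "chart S U f"
  shows "openin (top_of_set S) U" "U \<subseteq> S" "open (f ` U)" "continuous_on U f" "inj_on f U"
    "surface_param S (f ` U) (inv_into U f)"
proof -
  obtain g where g: "homeomorphism U (f ` U) f g" and U: "openin (top_of_set S) U" "open (f ` U)"
    using assms by (auto simp: chart_def)
  show "openin (top_of_set S) U" "open (f ` U)" using U by auto
  show "U \<subseteq> S" using U openin_imp_subset by blast
  show c: "continuous_on U f" "inj_on f U"
    using g by (auto simp: homeomorphism_def intro: inj_on_inverseI)
  have "g y = inv_into U f y" if "y \<in> f ` U" for y
    using g c that by (auto simp: homeomorphism_def)
  then have "continuous_on (f ` U) (inv_into U f)"
    using g by (auto simp: homeomorphism_def cong: continuous_on_cong)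
  then show "surface_param S (f ` U) (inv_into U f)"
    using U \<open>U \<subseteq> S\<close> c by (auto simp: surface_param_def inj_on_inv_into inv_into_into)
qed

lemma open_param_vimage:
  assumes "surface_param S A \<gamma>" "openin (top_of_set S) U"
  shows "open (A \<inter> \<gamma> -` U)"
proof -
  have "openin (top_of_set A) (A \<inter> \<gamma> -` U)"
    using surface_paramD[OF assms(1)] assms(2)
    by (intro continuous_openin_preimage[of A \<gamma> S]) auto
  then show ?thesis using surface_paramD(1)[OF assms(1)] by (simp add: openin_open_eq)
qed

lemma chart_param:
  assumes "surface_param S A \<gamma>" "chart S U f"
  shows "open (A \<inter> \<gamma> -` U)" "continuous_on (A \<inter> \<gamma> -` U) (f \<circ> \<gamma>)" "inj_on (f \<circ> \<gamma>) (A \<inter> \<gamma> -` U)"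
proof -
  note g = surface_paramD[OF assms(1)] and f = chartD[OF assms(2)]
  show "open (A \<inter> \<gamma> -` U)" using open_param_vimage assms f by blast
  show "continuous_on (A \<inter> \<gamma> -` U) (f \<circ> \<gamma>)"
    by (rule continuous_on_compose) (auto intro: continuous_on_subset[OF g(2)] continuous_on_subset[OF f(4)])
  show "inj_on (f \<circ> \<gamma>) (A \<inter> \<gamma> -` U)"
    by (rule comp_inj_on) (auto intro: inj_on_subset[OF g(3)] inj_on_subset[OF f(5)])
qed

text \<open>Invariance of domain, applied to \<open>f \<circ> \<gamma>\<close> for a chart
  \<open>f\<close> around each image point.\<close>

lemma openin_param_image:
  assumes "closed_surface S" "surface_param S A \<gamma>"
  shows "openin (top_of_set S) (\<gamma> ` A)"
proof (subst openin_subopen, intro ballI)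
  note g = surface_paramD[OF assms(2)]
  fix x assume "x \<in> \<gamma> ` A"
  then obtain a where a: "a \<in> A" "x = \<gamma> a" by auto
  then have "x \<in> S" using g by auto
  then obtain U f where U: "x \<in> U" "chart S U f"
    using assms(1) unfolding closed_surface_def by blast
  note f = chartD[OF U(2)] and c = chart_param[OF assms(2) U(2)]
  let ?A = "A \<inter> \<gamma> -` U"
  have "open ((f \<circ> \<gamma>) ` ?A)" using c by (intro invariance_of_domain)
  then have "openin (top_of_set U) (U \<inter> f -` ((f \<circ> \<gamma>) ` ?A))"
    using f by (intro continuous_openin_preimage_gen) auto
  moreover have "U \<inter> f -` ((f \<circ> \<gamma>) ` ?A) = \<gamma> ` ?A"
    using f(5) by (auto dest: inj_onD)
  ultimately have "openin (top_of_set S) (\<gamma> ` ?A)" using openin_trans f(1) by metis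
  then show "\<exists>T. openin (top_of_set S) T \<and> x \<in> T \<and> T \<subseteq> \<gamma> ` A"
    using a U by (intro exI[of _ "\<gamma> ` ?A"]) auto
qed

text \<open>Restrictions of a parametrization to open subsets also have open images, which is
  continuity of the inverse.\<close>

lemma chart_inv_param:
  assumes "closed_surface S" "surface_param S A \<gamma>"
  shows "chart S (\<gamma> ` A) (inv_into A \<gamma>)"
proof -
  note g = surface_paramD[OF assms(2)]
  have im: "inv_into A \<gamma> ` \<gamma> ` A = A" using g by simp
  have "continuous_on (\<gamma> ` A) (inv_into A \<gamma>)"
    unfolding continuous_on_open im
  proof (intro allI impI)
    fix T assume "openin (top_of_set A) T"
    then have T: "open T" "T \<subseteq> A" using g by (auto simp: openin_open_eq)
    have "\<gamma> ` A \<inter> inv_into A \<gamma> -` T = \<gamma> ` T" using T g by auto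
    moreover have "openin (top_of_set S) (\<gamma> ` T)"
      using surface_param_subset[OF assms(2) T] openin_param_image assms(1) by blast
    ultimately show "openin (top_of_set (\<gamma> ` A)) (\<gamma> ` A \<inter> inv_into A \<gamma> -` T)"
      using T g by (metis image_mono openin_subset_trans)
  qed
  then have "homeomorphism (\<gamma> ` A) A (inv_into A \<gamma>) \<gamma>"
    using g by (auto simp: homeomorphism_def)
  then show ?thesis
    unfolding chart_def im using g openin_param_image[OF assms] by blast
qed

lemma chart_subset:
  assumes "chart S U f" "openin (top_of_set S) U'" "U' \<subseteq> U"
  shows "chart S U' f"
proof -
  note f = chartD[OF assms(1)]
  have eq: "f ` U \<inter> inv_into U f -` U' = f ` U'" using f assms(3) by auto
  have "open (f ` U')" using open_param_vimage[OF f(6) assms(2)] eq by simp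
  moreover obtain g where "homeomorphism U (f ` U) f g" using assms by (auto simp: chart_def)
  then have "homeomorphism U' (f ` U') f g" using assms(3) by (auto intro: homeomorphism_of_subsets)
  ultimately show ?thesis using assms by (auto simp: chart_def)
qed

lemma chart_cnj:
  assumes "chart S U f" shows "chart S U (cnj \<circ> f)"
proof -
  obtain g where g: "homeomorphism U (f ` U) f g" using assms by (auto simp: chart_def)
  have "homeomorphism (f ` U) (cnj ` f ` U) cnj cnj"
    by (auto simp: homeomorphism_def image_image intro!: continuous_intros)
  then have "homeomorphism U ((cnj \<circ> f) ` U) (cnj \<circ> f) (g \<circ> cnj)"
    using homeomorphism_compose[OF g] by (simp add: image_comp)
  moreover have "open (cnj ` (f ` U))"
    using assms by (intro invariance_of_domain) (auto simp: chart_def inj_on_def intro!: continuous_intros)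
  ultimately show ?thesis using assms unfolding chart_def by (auto simp: image_comp)
qed

lemma local_degree_chart_cnj:
  assumes "surface_param S A \<gamma>" "chart S U f" "a \<in> A" "\<gamma> a \<in> U"
  shows "local_degree ((cnj \<circ> f) \<circ> \<gamma>) a = - local_degree (f \<circ> \<gamma>) a"
proof -
  have "local_degree (cnj \<circ> (f \<circ> \<gamma>)) a = local_degree cnj ((f \<circ> \<gamma>) a) * local_degree (f \<circ> \<gamma>) a"
    by (rule local_degree_compose[OF chart_param[OF assms(1,2)], of _ UNIV])
      (use assms in \<open>auto simp: inj_on_def intro!: continuous_intros\<close>)
  then show ?thesis by (simp add: local_degree_cnj o_assoc)
qed

lemma local_degree_reparam:
  assumes "surface_param S A \<gamma>" "chart S U f"
    and "open B" "continuous_on B h" "inj_on h B" "h ` B \<subseteq> A" "b \<in> B" "\<gamma> (h b) \<in> U"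
  shows "local_degree (f \<circ> (\<gamma> \<circ> h)) b = local_degree (f \<circ> \<gamma>) (h b) * local_degree h b"
proof -
  have "local_degree ((f \<circ> \<gamma>) \<circ> h) b = local_degree (f \<circ> \<gamma>) (h b) * local_degree h b"
    using assms chart_param[OF assms(1,2)] by (intro local_degree_compose) auto
  then show ?thesis by (simp add: o_assoc)
qed

lemma chart_transition:
  assumes "chart S U f" "chart S W g"
  shows "open (f ` (U \<inter> W))" "continuous_on (f ` (U \<inter> W)) (g \<circ> inv_into U f)"
    "inj_on (g \<circ> inv_into U f) (f ` (U \<inter> W))"
proof -
  note f = chartD[OF assms(1)]
  have eq: "f ` U \<inter> inv_into U f -` W = f ` (U \<inter> W)" using f by auto
  show "open (f ` (U \<inter> W))" "continuous_on (f ` (U \<inter> W)) (g \<circ> inv_into U f)"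
    "inj_on (g \<circ> inv_into U f) (f ` (U \<inter> W))"
    using chart_param[OF f(6) assms(2)] unfolding eq by auto
qed

lemma local_degree_change_chart:
  assumes "chart S U f" "chart S W g" "surface_param S A \<gamma>" "a \<in> A" "\<gamma> a \<in> U" "\<gamma> a \<in> W"
  shows "local_degree (g \<circ> \<gamma>) a = local_degree (g \<circ> inv_into U f) (f (\<gamma> a)) * local_degree (f \<circ> \<gamma>) a"
proof -
  note c = chart_param[OF assms(3,1)] and t = chart_transition[OF assms(1,2)]
  let ?A = "A \<inter> \<gamma> -` U \<inter> \<gamma> -` W"
  have oA: "open ?A"
    using chart_param(1)[OF assms(3,1)] chart_param(1)[OF assms(3,2)]
    by (metis Int_assoc Int_left_commute inf.idem open_Int)
  have "local_degree ((g \<circ> inv_into U f) \<circ> (f \<circ> \<gamma>)) a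
        = local_degree (g \<circ> inv_into U f) ((f \<circ> \<gamma>) a) * local_degree (f \<circ> \<gamma>) a"
    by (rule local_degree_compose[OF c _ t]) (use assms in auto)
  moreover have "local_degree ((g \<circ> inv_into U f) \<circ> (f \<circ> \<gamma>)) a = local_degree (g \<circ> \<gamma>) a"
    using assms oA chartD(5)[OF assms(1)] by (intro local_degree_cong[of ?A]) auto
  ultimately show ?thesis by simp
qed

lemma local_degree_param_cases:
  assumes "surface_param S A \<gamma>" "chart S U f" "a \<in> A" "\<gamma> a \<in> U"
  shows "local_degree (f \<circ> \<gamma>) a = 1 \<or> local_degree (f \<circ> \<gamma>) a = -1"
  by (rule local_degree_cases[OF chart_param[OF assms(1,2)]]) (use assms in auto)

section \<open>Oriented families of charts and the sign of a parametrization\<close>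

lemma local_degree_compatible:
  assumes "chart S U f" "chart S W g" "surface_param S A \<gamma>" "a \<in> A" "\<gamma> a \<in> U" "\<gamma> a \<in> W"
    and "orientation_preserving_on (f ` (U \<inter> W)) (g \<circ> inv_into U f)"
  shows "local_degree (g \<circ> \<gamma>) a = local_degree (f \<circ> \<gamma>) a"
  using local_degree_change_chart[OF assms(1-6)] assms(5-7)
    orientation_preserving_on_iff[OF chart_transition[OF assms(1,2)]] by auto

text \<open>Covering is left out of \<open>orientable\<close> here: the family built from a coherent
  choice must be usable before the vertices are known to be covered.\<close>

definition oriented_charts :: "'a::t2_space set \<Rightarrow> ('a set \<times> ('a \<Rightarrow> complex)) set \<Rightarrow> bool" where
  "oriented_charts S \<A> \<longleftrightarrow> (\<forall>(U, f)\<in>\<A>. chart S U f) \<and>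
     (\<forall>(U, f)\<in>\<A>. \<forall>(W, g)\<in>\<A>. orientation_preserving_on (f ` (U \<inter> W)) (g \<circ> inv_into U f))"

lemma oriented_chartsD:
  assumes "oriented_charts S \<A>" "(U, f) \<in> \<A>"
  shows "chart S U f"
    "(W, g) \<in> \<A> \<Longrightarrow> orientation_preserving_on (f ` (U \<inter> W)) (g \<circ> inv_into U f)"
  using assms by (auto simp: oriented_charts_def)

text \<open>Compatibility makes the degree independent of the chart, and within one chart it is
  locally constant. The lemma is applied to tiles, to strips around edges and to punctured disks
  around vertices.\<close>

lemma oriented_charts_sign:
  assumes \<A>: "oriented_charts S \<A>" and g: "surface_param S A \<gamma>" and "connected A"
    and cov: "\<And>a. a \<in> A \<Longrightarrow> \<exists>(U, f)\<in>\<A>. \<gamma> a \<in> U"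
  obtains d where "d = 1 \<or> d = -1"
    "\<And>U f a. (U, f) \<in> \<A> \<Longrightarrow> a \<in> A \<Longrightarrow> \<gamma> a \<in> U \<Longrightarrow> local_degree (f \<circ> \<gamma>) a = d"
proof -
  define F where "F a = (THE d. \<forall>(U, f)\<in>\<A>. \<gamma> a \<in> U \<longrightarrow> local_degree (f \<circ> \<gamma>) a = d)" for a
  have F: "F a = local_degree (f \<circ> \<gamma>) a" if "a \<in> A" "(U, f) \<in> \<A>" "\<gamma> a \<in> U" for a U f
    unfolding F_def
  proof (rule the_equality)
    show "\<forall>(W, g)\<in>\<A>. \<gamma> a \<in> W \<longrightarrow> local_degree (g \<circ> \<gamma>) a = local_degree (f \<circ> \<gamma>) a"
      using local_degree_compatible[OF _ _ g] oriented_chartsD[OF \<A>] that by blast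
  qed (use that in auto)
  have "F constant_on A"
  proof (rule locally_constant_imp_constant[OF assms(3)])
    fix a assume a: "a \<in> A"
    then obtain U f where U: "(U, f) \<in> \<A>" "\<gamma> a \<in> U" using cov by blast
    have ch: "chart S U f" using oriented_chartsD[OF \<A>] U by blast
    note c = chart_param[OF g ch]
    obtain r where r: "0 < r" "cball a r \<subseteq> A \<inter> \<gamma> -` U"
      using c(1) a U open_contains_cball by blast
    have "F w = F a" if "w \<in> ball a r" for w
    proof -
      have "w \<in> A \<inter> \<gamma> -` U" using that r ball_subset_cball by blast
      then show ?thesis
        using local_degree_eq_nearby[OF c(2,3) r that] F[of w U f] F[OF a U] U by auto
    qed
    moreover have "ball a r \<subseteq> A" using r ball_subset_cball by blast
    moreover from this have "openin (top_of_set A) (ball a r)" "a \<in> ball a r"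
      using r surface_paramD(1)[OF g] by (auto simp: openin_open_eq)
    ultimately show "\<exists>T. openin (top_of_set A) T \<and> a \<in> T \<and> (\<forall>x\<in>T. F x = F a)" by blast
  qed
  then obtain d where d: "\<And>a. a \<in> A \<Longrightarrow> F a = d" by (auto simp: constant_on_def)
  show thesis
  \<comment> \<open>On an empty domain every sign is vacuously right; 1 is a default.\<close>
  proof (cases "A = {}")
    case True
    then show ?thesis using that[of 1] by auto
  next
    case False
    then obtain a where a: "a \<in> A" by auto
    then obtain U f where U: "(U, f) \<in> \<A>" "\<gamma> a \<in> U" using cov by blast
    then have "d = 1 \<or> d = -1"
      using local_degree_param_cases[OF g] oriented_chartsD[OF \<A>] a d F by metis
    then show ?thesis using that d F by metis
  qed
qed

lemma orientableI:
  assumes "oriented_charts S \<A>" "\<And>x. x \<in> S \<Longrightarrow> \<exists>(U, f)\<in>\<A>. x \<in> U"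
  shows "orientable S"
  unfolding orientable_def
proof (intro exI[of _ \<A>] conjI)
  show "(\<Union>(U, f)\<in>\<A>. U) = S"
    using assms(2) oriented_chartsD(1)[OF assms(1)] chartD(2) by fast
qed (use assms(1) in \<open>auto simp: oriented_charts_def\<close>)

lemma orientableE:
  assumes "orientable S"
  obtains \<A> where "oriented_charts S \<A>" "\<And>x. x \<in> S \<Longrightarrow> \<exists>(U, f)\<in>\<A>. x \<in> U"
  using assms unfolding orientable_def oriented_charts_def by blast

section \<open>Collars of the sides of tiles\<close>

text \<open>The exponential map rolls the strip up: the real interval becomes side \<open>k\<close>,
  and \<open>Im w > 0\<close> goes inside the disk. Being holomorphic, it contributes no sign, and
  it is also defined beyond the side.\<close>

definition side_coord :: "nat \<Rightarrow> nat \<Rightarrow> complex \<Rightarrow> complex" where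
  "side_coord n k w = exp (2 * of_real pi * \<i> * (of_nat k + w) / of_nat n)"

definition strip :: "complex set" where
  "strip = Re -` {0<..<1}"

lemma strip_iff: "w \<in> strip \<longleftrightarrow> 0 < Re w \<and> Re w < 1"
  by (simp add: strip_def)

lemma open_strip: "open strip"
  unfolding strip_def by (intro open_vimage) (auto intro!: continuous_intros)

lemma convex_strip: "convex strip"
  unfolding strip_def by (intro convex_linear_vimage) (auto intro: bounded_linear.linear bounded_linear_Re)

lemma circle_point_exp: "circle_point n t = exp (2 * of_real pi * \<i> * of_real t / of_nat n)"
  by (simp add: circle_point_def cis_conv_exp mult_ac)

lemma side_coord_of_real: "side_coord n k (of_real t) = circle_point n (real k + t)"
  by (simp add: circle_point_exp side_coord_def)

lemma norm_circle_point [simp]: "norm (circle_point n t) = 1"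
  by (simp add: circle_point_def)

lemma circle_point_eqD:
  assumes "circle_point n t = circle_point n t'" "0 < n"
  obtains N :: int where "t = t' + of_int N * real n"
proof -
  have "sin (2 * pi * t / n) = sin (2 * pi * t' / n)" "cos (2 * pi * t / n) = cos (2 * pi * t' / n)"
    using assms by (auto simp: circle_point_def complex_eq_iff)
  then obtain N :: int where "2 * pi * t / n = 2 * pi * t' / n + 2 * pi * N"
    using sin_cos_eq_iff by (metis mult.assoc)
  then have "2 * pi * t = 2 * pi * (t' + N * real n)" using assms by (simp add: field_simps)
  then have "t = t' + N * real n" using pi_gt_zero by (metis less_irrefl mult_cancel_left mult_eq_0_iff zero_neq_numeral)
  then show thesis using that by blast
qed

lemma norm_side_coord: "norm (side_coord n k w) = exp (- 2 * pi * Im w / n)"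
proof -
  have "Re (2 * of_real pi * \<i> * (of_nat k + w) / of_nat n) = - 2 * pi * Im w / n"
    by (simp add: Re_divide_of_nat)
  then show ?thesis by (simp add: side_coord_def norm_exp_eq_Re)
qed

lemma norm_side_coord_le_iff: "0 < n \<Longrightarrow> norm (side_coord n k w) \<le> 1 \<longleftrightarrow> 0 \<le> Im w"
  and norm_side_coord_less_iff: "0 < n \<Longrightarrow> norm (side_coord n k w) < 1 \<longleftrightarrow> 0 < Im w"
  using iffD2[OF not_le pi_gt_zero]
  by (auto simp: norm_side_coord zero_less_divide_iff zero_le_divide_iff zero_less_mult_iff zero_le_mult_iff)

lemma side_coord_eq_iff:
  assumes "0 < n" "k < n" "k' < n" "w \<in> strip" "w' \<in> strip"
  shows "side_coord n k w = side_coord n k' w' \<longleftrightarrow> k = k' \<and> w = w'"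
proof
  assume "side_coord n k w = side_coord n k' w'"
  then obtain N :: int where "2 * of_real pi * \<i> * (of_nat k + w) / of_nat n
      = 2 * of_real pi * \<i> * (of_nat k' + w') / of_nat n + of_real (of_int (2 * N) * pi) * \<i>"
    unfolding side_coord_def exp_eq by blast
  then have "(2 * of_real pi * \<i>) * (of_nat k + w) = (2 * of_real pi * \<i>) * (of_nat k' + w' + of_int N * of_nat n)"
    using assms by (simp add: field_simps)
  then have eq: "of_nat k + w = of_nat k' + w' + of_int N * of_nat n"
    by (subst (asm) mult_left_cancel) auto
  have re: "real k + Re w = real k' + Re w' + of_int N * real n" and im: "Im w = Im w'"
    using arg_cong[OF eq, of Re] arg_cong[OF eq, of Im] by auto
  have k: "real k \<le> real n - 1" "real k' \<le> real n - 1" using assms by linarith+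
  have w: "0 < Re w" "Re w < 1" "0 < Re w'" "Re w' < 1" using assms by (auto simp: strip_iff)
  \<comment> \<open>Both \<open>real k + Re w\<close> and \<open>real k' + Re w'\<close> lie
    strictly between 0 and \<open>n\<close>, so they cannot differ by a nonzero multiple of
    \<open>n\<close>.\<close>
  have "real_of_int N * real n < 1 * real n" "(-1) * real n < real_of_int N * real n"
    using k w re by linarith+
  then have "real_of_int N < 1" "-1 < real_of_int N" using assms(1) by (simp_all only: mult_less_cancel_right_pos of_nat_0_less_iff)
  then have "N = 0" by linarith
  then have r: "real k + Re w = real k' + Re w'" using re by simp
  then have "real k < real k' + 1" "real k' < real k + 1" using w by linarith+
  then have "k = k'" by linarith
  then show "k = k' \<and> w = w'" using r im by (simp add: complex_eq_iff)
qed simp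

lemma continuous_on_side_coord: "continuous_on A (side_coord n k)"
  unfolding side_coord_def by (cases "n = 0") (auto intro!: continuous_intros)

lemma inj_on_side_coord: "0 < n \<Longrightarrow> k < n \<Longrightarrow> inj_on (side_coord n k) strip"
  by (rule inj_onI) (simp add: side_coord_eq_iff)

lemma local_degree_side_coord:
  assumes "0 < n" shows "local_degree (side_coord n k) z = 1"
proof (rule local_degree_derivative[of UNIV])
  show "(side_coord n k has_field_derivative
      (2 * of_real pi * \<i> / of_nat n * side_coord n k z)) (at z)"
    unfolding side_coord_def using assms by (auto intro!: derivative_eq_intros)
  show "2 * of_real pi * \<i> / of_nat n * side_coord n k z \<noteq> 0"
    using assms by (simp add: side_coord_def)
qed (use continuous_on_side_coord in auto)

lemma polygon_side_eq: "polygon_side n k = (\<lambda>t. side_coord n k (of_real t)) ` {0<..<1}"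
proof -
  have "{real k<..<real k + 1} = (\<lambda>t. real k + t) ` {0<..<1}"
  proof (intro set_eqI iffI)
    fix x assume "x \<in> {real k<..<real k + 1}"
    then show "x \<in> (\<lambda>t. real k + t) ` {0<..<1}" by (intro image_eqI[of _ _ "x - real k"]) auto
  qed auto
  then show ?thesis by (simp add: polygon_side_def side_coord_of_real image_image)
qed

definition half_strip :: "complex set" where
  "half_strip = {w \<in> strip. 0 \<le> Im w}"

lemma side_coord_half_strip:
  assumes "0 < n" shows "side_coord n k ` half_strip = cball 0 1 \<inter> side_coord n k ` strip"
  using assms by (auto simp: half_strip_def norm_side_coord_le_iff)

text \<open>The collar extends across the circle to an open subset of the plane, so removing it from
  the closed disk leaves a compact set.\<close>

lemma compact_minus_side_coord:
  assumes "0 < n" "k < n"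
  shows "compact (cball 0 1 - side_coord n k ` half_strip)"
proof -
  have "open (side_coord n k ` strip)"
    using assms by (intro invariance_of_domain continuous_on_side_coord open_strip inj_on_side_coord)
  then have "compact (cball 0 1 - side_coord n k ` strip)"
    by (intro compact_diff) auto
  moreover have "cball 0 1 - side_coord n k ` half_strip = cball 0 1 - side_coord n k ` strip"
    using assms side_coord_half_strip by auto
  ultimately show ?thesis by simp
qed

section \<open>Tiles, their sides and the collars of the sides\<close>

lemma tiles_facts:
  assumes "R \<in> tiles S V E"
  shows "R \<subseteq> S" "R \<inter> V = {}" "R \<inter> \<Union>E = {}" "connected R" "R \<noteq> {}"
    "R' \<in> tiles S V E \<Longrightarrow> R \<inter> R' \<noteq> {} \<Longrightarrow> R = R'"
proof -
  show "connected R" "R \<noteq> {}" using assms unfolding tiles_def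
    by (auto simp: in_components_connected in_components_nonempty)
  have "R \<subseteq> S - (V \<union> \<Union>E)" using assms in_components_subset unfolding tiles_def by blast
  then show "R \<subseteq> S" "R \<inter> V = {}" "R \<inter> \<Union>E = {}" by auto
  show "R' \<in> tiles S V E \<Longrightarrow> R \<inter> R' \<noteq> {} \<Longrightarrow> R = R'"
    using assms unfolding tiles_def by (auto simp: components_nonoverlap)
qed

lemma tiles_cover: "x \<in> S \<Longrightarrow> x \<in> V \<or> x \<in> \<Union>E \<or> (\<exists>R\<in>tiles S V E. x \<in> R)"
  using Union_components[of "S - (V \<union> \<Union>E)"] unfolding tiles_def by blast

lemma polygon_mapD:
  assumes "polygon_map V E n \<phi> R"
  shows "3 \<le> n" "0 < n" "continuous_on (cball 0 1) \<phi>" "inj_on \<phi> (ball 0 1)" "\<phi> ` ball 0 1 = R"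
    "k < n \<Longrightarrow> \<phi> (circle_point n (real k)) \<in> V"
    "k < n \<Longrightarrow> \<phi> ` polygon_side n k \<in> E" "k < n \<Longrightarrow> inj_on \<phi> (polygon_side n k)"
  using assms unfolding polygon_map_def homeomorphism_def
  by (auto intro: inj_on_inverseI)

text \<open>The case \<open>k = n\<close> is included because it is the far end of side
  \<open>n - 1\<close>.\<close>

lemma polygon_map_vertex:
  assumes "polygon_map V E n \<phi> R" "k \<le> n"
  shows "\<phi> (circle_point n (real k)) \<in> V"
proof (cases "k = n")
  case True
  have "circle_point n (real n) = circle_point n (real 0)"
    using polygon_mapD(2)[OF assms(1)] by (simp add: circle_point_def)
  then show ?thesis using polygon_mapD(2,6)[OF assms(1)] True by metis
qed (use polygon_mapD(6)[OF assms(1)] assms(2) in auto)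

locale polygonal_tiling =
  fixes S :: "'a::t2_space set" and V E and n :: "'a set \<Rightarrow> nat" and \<Phi> :: "'a set \<Rightarrow> complex \<Rightarrow> 'a"
  assumes surface: "closed_surface S"
    and graph: "embedded_graph S V E"
    and polygons: "\<And>R. R \<in> tiles S V E \<Longrightarrow> polygon_map V E (n R) (\<Phi> R) R"
begin

text \<open>Pairs of a tile and an index, not edges of a tile: an edge met twice along one boundary
  has two sides in that tile.\<close>

definition sides :: "('a set \<times> nat) set" where
  "sides = {(R, k). R \<in> tiles S V E \<and> k < n R}"

definition collar :: "'a set \<times> nat \<Rightarrow> complex \<Rightarrow> 'a" where
  "collar s w = \<Phi> (fst s) (side_coord (n (fst s)) (snd s) w)"

definition side_edge :: "'a set \<times> nat \<Rightarrow> 'a set" where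
  "side_edge s = \<Phi> (fst s) ` polygon_side (n (fst s)) (snd s)"

lemma graphD: "finite V" "V \<subseteq> S" "finite E" "e \<in> E \<Longrightarrow> e \<subseteq> S" "e \<in> E \<Longrightarrow> open_edge V e"
    "e \<in> E \<Longrightarrow> e' \<in> E \<Longrightarrow> e \<inter> e' \<noteq> {} \<Longrightarrow> e = e'" "e \<in> E \<Longrightarrow> e \<inter> V = {}"
  using graph unfolding embedded_graph_def open_edge_def pairwise_def disjnt_def by (blast | meson)+

lemma sidesD:
  assumes "s \<in> sides"
  shows "fst s \<in> tiles S V E" "snd s < n (fst s)" "polygon_map V E (n (fst s)) (\<Phi> (fst s)) (fst s)"
    "0 < n (fst s)"
proof -
  show "fst s \<in> tiles S V E" "snd s < n (fst s)" using assms by (auto simp: sides_def)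
  then show "polygon_map V E (n (fst s)) (\<Phi> (fst s)) (fst s)" using polygons by blast
  then show "0 < n (fst s)" using polygon_mapD by blast
qed

lemma side_edge_in: "s \<in> sides \<Longrightarrow> side_edge s \<in> E"
  unfolding side_edge_def using polygon_mapD(7) sidesD by blast

lemma side_edge_collar: "side_edge s = (\<lambda>t. collar s (of_real t)) ` {0<..<1}"
  unfolding side_edge_def polygon_side_eq collar_def by (simp add: image_image)

lemma collar_real: "s \<in> sides \<Longrightarrow> w \<in> strip \<Longrightarrow> Im w = 0 \<Longrightarrow> collar s w \<in> side_edge s"
  unfolding side_edge_collar by (rule image_eqI[of _ _ "Re w"]) (auto simp: strip_iff complex_is_Real_iff)

lemma collar_tile: "s \<in> sides \<Longrightarrow> 0 < Im w \<Longrightarrow> collar s w \<in> fst s"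
  unfolding collar_def using polygon_mapD(5)[OF sidesD(3)] norm_side_coord_less_iff[OF sidesD(4)]
  by (metis imageI mem_ball_0)

lemma tile_edge_disjoint: "R \<in> tiles S V E \<Longrightarrow> e \<in> E \<Longrightarrow> x \<in> R \<Longrightarrow> x \<in> e \<Longrightarrow> False"
  using tiles_facts(3) by blast

lemma collar_tile_iff:
  assumes "s \<in> sides" "w \<in> half_strip"
  shows "collar s w \<in> fst s \<longleftrightarrow> 0 < Im w"
proof
  assume c: "collar s w \<in> fst s"
  show "0 < Im w"
  proof (rule ccontr)
    assume "\<not> 0 < Im w"
    then have "collar s w \<in> side_edge s" using assms collar_real by (auto simp: half_strip_def)
    then show False using c tile_edge_disjoint[OF sidesD(1) side_edge_in] assms by blast
  qed
qed (use assms collar_tile in auto)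

text \<open>Points with positive imaginary part lie in tiles and real points on edges, so the two
  kinds never coincide; in a tile, injectivity on the open disk decides.\<close>

lemma collar_inj:
  assumes "s \<in> sides" "s' \<in> sides" "w \<in> half_strip" "w' \<in> half_strip" "collar s w = collar s' w'"
  shows "(Im w = 0 \<and> Im w' = 0) \<or> (s = s' \<and> w = w')"
    and "s = s' \<Longrightarrow> w = w'"
proof -
  have tile: "s = s' \<and> w = w'" if im: "0 < Im w" "0 < Im w'"
  proof -
    have "fst s \<inter> fst s' \<noteq> {}" using collar_tile[OF assms(1)] collar_tile[OF assms(2)] im assms(5) by fastforce
    then have R: "fst s = fst s'" using tiles_facts(6) sidesD(1) assms by blast
    have "side_coord (n (fst s)) (snd s) w = side_coord (n (fst s)) (snd s') w'"
      using assms(5) im R norm_side_coord_less_iff[OF sidesD(4)[OF assms(1)]]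
      unfolding collar_def by (intro inj_onD[OF polygon_mapD(4)[OF sidesD(3)[OF assms(1)]]]) auto
    then show ?thesis
      using side_coord_eq_iff[OF sidesD(4)[OF assms(1)], of "snd s" "snd s'" w w']
        sidesD(2)[OF assms(1)] sidesD(2)[OF assms(2)] assms(3,4) R
      by (simp add: half_strip_def prod_eq_iff)
  qed
  have mixed: "0 < Im w \<longleftrightarrow> 0 < Im w'"
  proof -
    have "False" if s: "s \<in> sides" "s' \<in> sides" "w \<in> half_strip" "w' \<in> half_strip" "collar s w = collar s' w'"
      "0 < Im w" "\<not> 0 < Im w'" for s s' w w'
    proof -
      have "collar s w \<in> fst s" using collar_tile s by blast
      moreover have "collar s' w' \<in> side_edge s'" using s collar_real by (auto simp: half_strip_def)
      ultimately show False using s tile_edge_disjoint[OF sidesD(1) side_edge_in] by metis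
    qed
    then show ?thesis using assms by metis
  qed
  show *: "(Im w = 0 \<and> Im w' = 0) \<or> (s = s' \<and> w = w')"
    using tile mixed assms by (auto simp: half_strip_def)
  assume eq: "s = s'"
  show "w = w'"
  proof (cases "w = w'")
    case False
    then have im: "Im w = 0" "Im w' = 0" using * by auto
    have mem: "side_coord (n (fst s)) (snd s) v \<in> polygon_side (n (fst s)) (snd s)" if "v \<in> half_strip" "Im v = 0" for v
      unfolding polygon_side_eq using that
      by (intro image_eqI[of _ _ "Re v"]) (auto simp: half_strip_def strip_iff complex_is_Real_iff)
    have "side_coord (n (fst s)) (snd s) w = side_coord (n (fst s)) (snd s) w'"
      using assms(3-5) eq mem im unfolding collar_def
      by (intro inj_onD[OF polygon_mapD(8)[OF sidesD(3)[OF assms(1)] sidesD(2)[OF assms(1)]]]) auto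
    then show ?thesis
      using side_coord_eq_iff[OF sidesD(4)[OF assms(1)], of "snd s" "snd s" w w']
        sidesD(2)[OF assms(1)] assms(3,4)
      by (simp add: half_strip_def)
  qed
qed

lemma continuous_on_collar:
  assumes "s \<in> sides" shows "continuous_on half_strip (collar s)"
  unfolding collar_def
  by (rule continuous_on_compose2[OF polygon_mapD(3)[OF sidesD(3)[OF assms]] continuous_on_side_coord])
    (use assms in \<open>auto simp: norm_side_coord_le_iff[OF sidesD(4)] half_strip_def\<close>)

lemma of_real_half_strip: "0 < t \<Longrightarrow> t < 1 \<Longrightarrow> of_real t \<in> half_strip"
  by (simp add: half_strip_def strip_iff)

lemma param_tile: "R \<in> tiles S V E \<Longrightarrow> surface_param S (ball 0 1) (\<Phi> R)"
  using polygon_mapD[OF polygons] tiles_facts(1)[of R]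
  by (auto simp: surface_param_def intro: continuous_on_subset[OF _ ball_subset_cball])

section \<open>Parameters along an edge and gluing of two collars\<close>

definition side_parameter :: "'a set \<times> nat \<Rightarrow> 'a \<Rightarrow> real" where
  "side_parameter s = inv_into {0<..<1} (\<lambda>t. collar s (of_real t))"

lemma inj_on_collar_real:
  assumes "s \<in> sides" shows "inj_on (\<lambda>t. collar s (of_real t)) {0<..<1}"
proof (rule inj_onI)
  fix t t' :: real assume "t \<in> {0<..<1}" "t' \<in> {0<..<1}" "collar s (of_real t) = collar s (of_real t')"
  then show "t = t'" using collar_inj(2)[OF assms assms of_real_half_strip of_real_half_strip, of t t'] by simp
qed

text \<open>The closed interval is compact, and its two end points go to vertices, which are off the
  edge; so the open interval is saturated.\<close>

lemma continuous_on_side_parameter: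
  assumes "s \<in> sides" shows "continuous_on (side_edge s) (side_parameter s)"
  unfolding side_parameter_def side_edge_collar
proof (rule continuous_on_inverse_saturated[of "{0..1}"])
  let ?f = "\<lambda>t. collar s (of_real t)"
  have c: "collar s (of_real t) = \<Phi> (fst s) (circle_point (n (fst s)) (real (snd s) + t))" for t
    by (simp add: collar_def side_coord_of_real)
  show "continuous_on {0..1} ?f"
    unfolding c
    by (rule continuous_on_compose2[OF polygon_mapD(3)[OF sidesD(3)[OF assms]]])
       (use sidesD(4)[OF assms] in \<open>auto simp: circle_point_def intro!: continuous_intros\<close>)
  have "?f 0 \<in> V" "?f 1 \<in> V"
    using polygon_map_vertex[OF sidesD(3)[OF assms], of "snd s"]
      polygon_map_vertex[OF sidesD(3)[OF assms], of "Suc (snd s)"] sidesD(2)[OF assms]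
    unfolding c by (auto simp: add.commute)
  moreover have "{0..1::real} - {0<..<1} = {0, 1}" by auto
  moreover have "?f ` {0<..<1} \<inter> V = {}"
    using graphD(7)[OF side_edge_in[OF assms]] by (simp add: side_edge_collar)
  ultimately show "?f ` {0<..<1} \<inter> ?f ` ({0..1} - {0<..<1}) = {}" by auto
qed (use inj_on_collar_real[OF assms] in auto)

lemma side_parameter_collar:
  assumes "s \<in> sides" "x \<in> side_edge s"
  shows "side_parameter s x \<in> {0<..<1}" "collar s (of_real (side_parameter s x)) = x"
proof -
  have "x \<in> (\<lambda>t. collar s (of_real t)) ` {0<..<1}" using assms by (simp add: side_edge_collar)
  then show "side_parameter s x \<in> {0<..<1}" "collar s (of_real (side_parameter s x)) = x"
    unfolding side_parameter_def
    by (fact inv_into_into, fact f_inv_into_f[where f = "\<lambda>t. collar s (of_real t)"])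
qed

text \<open>The change of parameter on a common edge. As a continuous injection of an interval it is
  strictly monotone, and it decreases exactly when the two sides traverse the edge in opposite
  directions.\<close>

definition side_change :: "'a set \<times> nat \<Rightarrow> 'a set \<times> nat \<Rightarrow> real \<Rightarrow> real" where
  "side_change s s' t = side_parameter s' (collar s (of_real t))"

lemma side_change:
  assumes "s \<in> sides" "s' \<in> sides" "side_edge s = side_edge s'"
  shows "t \<in> {0<..<1} \<Longrightarrow> side_change s s' t \<in> {0<..<1}"
    "t \<in> {0<..<1} \<Longrightarrow> collar s' (of_real (side_change s s' t)) = collar s (of_real t)"
    "continuous_on {0<..<1} (side_change s s')"
    "inj_on (side_change s s') {0<..<1}"
    "strict_mono_on {0<..<1} (side_change s s') \<or> strict_antimono_on {0<..<1} (side_change s s')"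
proof -
  have m: "collar s (of_real t) \<in> side_edge s'" if "t \<in> {0<..<1}" for t
    using that assms(3) unfolding side_edge_collar[of s] by blast
  show 1: "side_change s s' t \<in> {0<..<1}" "collar s' (of_real (side_change s s' t)) = collar s (of_real t)"
    if "t \<in> {0<..<1}" for t
    using side_parameter_collar[OF assms(2) m[OF that]] by (auto simp: side_change_def)
  show c: "continuous_on {0<..<1} (side_change s s')"
    unfolding side_change_def
    by (rule continuous_on_compose2[OF continuous_on_side_parameter[OF assms(2)]
          continuous_on_compose2[OF continuous_on_collar[OF assms(1)], of _ of_real]])
      (use m of_real_half_strip in \<open>auto intro!: continuous_intros\<close>)
  show i: "inj_on (side_change s s') {0<..<1}"
    using 1(2) inj_onD[OF inj_on_collar_real[OF assms(1)]] by (metis inj_onI)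
  show "strict_mono_on {0<..<1} (side_change s s') \<or> strict_antimono_on {0<..<1} (side_change s s')"
    using injective_eq_monotone_map[OF _ c] i by (auto simp: is_interval_oo)
qed

text \<open>Reflection puts the second collar below the real axis, and \<open>side_change\<close>
  makes both formulas agree on the axis. The axis belongs to the first branch, but
  \<open>glue_nonneg\<close> allows it to be read in the collar of \<open>s\<close>.\<close>

definition glue :: "'a set \<times> nat \<Rightarrow> 'a set \<times> nat \<Rightarrow> complex \<Rightarrow> 'a" where
  "glue s s' w =
     (if Im w \<le> 0 then collar s' (Complex (side_change s s' (Re w)) (- Im w)) else collar s w)"

lemma glue_nonneg:
  assumes "s \<in> sides" "s' \<in> sides" "side_edge s = side_edge s'" "w \<in> half_strip"
  shows "glue s s' w = collar s w"
proof (cases "Im w = 0")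
  case True
  then have "w = of_real (Re w)" by (simp add: complex_eq_iff)
  moreover have "Re w \<in> {0<..<1}" using assms by (auto simp: half_strip_def strip_iff)
  ultimately show ?thesis
    using side_change(2)[OF assms(1-3), of "Re w"] True by (simp add: glue_def complex_of_real_def)
qed (use assms in \<open>auto simp: glue_def half_strip_def\<close>)

lemma reflect_half_strip:
  assumes "s \<in> sides" "s' \<in> sides" "side_edge s = side_edge s'" "w \<in> strip" "Im w \<le> 0"
  shows "Complex (side_change s s' (Re w)) (- Im w) \<in> half_strip"
  using side_change(1)[OF assms(1-3), of "Re w"] assms(4,5) by (auto simp: half_strip_def strip_iff)

text \<open>Distinctness of the two sides separates the upper from the lower half, even if both
  sides belong to the same tile.\<close>

lemma param_glue:
  assumes "s \<in> sides" "s' \<in> sides" "side_edge s = side_edge s'" "s \<noteq> s'"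
  shows "surface_param S strip (glue s s')"
  unfolding surface_param_def
proof (intro conjI)
  let ?r = "\<lambda>w. Complex (side_change s s' (Re w)) (- Im w)"
  show "continuous_on strip (glue s s')"
    unfolding glue_def
  proof (rule continuous_on_cases_le)
    show "continuous_on {t \<in> strip. Im t \<le> 0} (\<lambda>w. collar s' (?r w))"
    proof (rule continuous_on_compose2[OF continuous_on_collar[OF assms(2)]])
      show "continuous_on {t \<in> strip. Im t \<le> 0} ?r"
        unfolding Complex_eq
        by (intro continuous_intros continuous_on_compose2[OF side_change(3)[OF assms(1-3)]])
          (auto simp: strip_iff)
    qed (use reflect_half_strip[OF assms(1-3)] in auto)
    show "continuous_on {t \<in> strip. 0 \<le> Im t} (collar s)"
      using continuous_on_collar[OF assms(1)] by (simp add: half_strip_def)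
    fix t assume "t \<in> strip" "Im t = 0"
    then show "collar s' (?r t) = collar s t"
      using glue_nonneg[OF assms(1-3), of t] by (simp add: glue_def half_strip_def)
  qed (auto intro!: continuous_intros)
  have mixed: False if "w \<in> strip" "w' \<in> strip" "Im w > 0" "Im w' \<le> 0" "glue s s' w = glue s s' w'" for w w'
    using collar_inj(1)[OF assms(1,2), of w "?r w'"] reflect_half_strip[OF assms(1-3), of w'] that assms(4)
    by (auto simp: half_strip_def glue_def)
  show "inj_on (glue s s') strip"
  proof (rule inj_onI)
    fix w w' assume w: "w \<in> strip" "w' \<in> strip" "glue s s' w = glue s s' w'"
    consider "Im w > 0" "Im w' > 0" | "Im w \<le> 0" "Im w' \<le> 0"
      using mixed[of w w'] mixed[of w' w] w by fastforce
    then show "w = w'"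
    proof cases
      case 1
      then show ?thesis using collar_inj(2)[OF assms(1,1), of w w'] w
        by (auto simp: half_strip_def glue_def)
    next
      case 2
      then have "?r w = ?r w'"
        using collar_inj(2)[OF assms(2,2) reflect_half_strip[OF assms(1-3)] reflect_half_strip[OF assms(1-3)], of w w'] w
        by (auto simp: glue_def)
      then show ?thesis
        using inj_onD[OF side_change(4)[OF assms(1-3)], of "Re w" "Re w'"] w
        by (auto simp: strip_iff complex_eq_iff)
    qed
  qed
  have cS: "collar s w \<in> S" if "s \<in> sides" "w \<in> half_strip" for s w
  proof (cases "Im w = 0")
    case True
    then show ?thesis
      using collar_real[OF that(1)] that graphD(4)[OF side_edge_in[OF that(1)]] by (auto simp: half_strip_def)
  next
    case False
    then show ?thesis
      using collar_tile[OF that(1), of w] that(2) tiles_facts(1)[OF sidesD(1)[OF that(1)]]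
      by (auto simp: half_strip_def)
  qed
  show "glue s s' ` strip \<subseteq> S"
    using cS[OF assms(1)] cS[OF assms(2)] reflect_half_strip[OF assms(1-3)]
    by (auto simp: glue_def half_strip_def)
qed (rule open_strip)

lemma edge_in_glue:
  assumes "s \<in> sides" "s' \<in> sides" "side_edge s = side_edge s'"
  shows "side_edge s \<subseteq> glue s s' ` strip"
proof
  fix x assume "x \<in> side_edge s"
  then obtain t where t: "t \<in> {0<..<1}" "x = collar s (of_real t)" by (auto simp: side_edge_collar)
  then have "x = glue s s' (of_real t)" using glue_nonneg[OF assms of_real_half_strip] by simp
  then show "x \<in> glue s s' ` strip" using t of_real_half_strip[of t] by (auto simp: half_strip_def)
qed

text \<open>The edge point is approached along a vertical segment of the collar, by continuity up to
  the edge.\<close>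

lemma collar_meets_open:
  assumes "s \<in> sides" "x \<in> side_edge s" "openin (top_of_set S) A" "x \<in> A"
  obtains w where "w \<in> half_strip" "0 < Im w" "collar s w \<in> A"
proof -
  obtain O' where O': "open O'" "A = S \<inter> O'" using assms(3) by (auto simp: openin_open)
  obtain t where t: "0 < t" "t < 1" "x = collar s (of_real t)"
    using assms(2) by (auto simp: side_edge_collar)
  have c: "continuous_on {0..} (\<lambda>y. collar s (Complex t y))"
    by (rule continuous_on_compose2[OF continuous_on_collar[OF assms(1)]])
      (use t in \<open>auto simp: Complex_eq half_strip_def strip_iff intro!: continuous_intros\<close>)
  have "collar s (Complex t 0) \<in> O'" using t assms(4) O' by (simp add: complex_of_real_def)
  moreover have "((\<lambda>y. collar s (Complex t y)) \<longlongrightarrow> collar s (Complex t 0)) (at 0 within {0..})"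
    using c by (simp add: continuous_on_def)
  ultimately have "\<forall>\<^sub>F y in at 0 within {0..}. collar s (Complex t y) \<in> O'"
    using O' by (auto dest: topological_tendstoD)
  then obtain d where d: "0 < d" "\<And>y. 0 < y \<Longrightarrow> y < d \<Longrightarrow> collar s (Complex t y) \<in> O'"
    by (auto simp: eventually_at dist_real_def)
  define w where "w = Complex t (d/2)"
  have w: "w \<in> half_strip" "0 < Im w" using d t by (auto simp: w_def half_strip_def strip_iff)
  have "collar s w \<in> O'" using d by (simp add: w_def)
  moreover have "collar s w \<in> S"
    using collar_tile[OF assms(1) w(2)] tiles_facts(1)[OF sidesD(1)[OF assms(1)]] by blast
  ultimately show thesis using that w O' by blast
qed

text \<open>The union of the collars of two sides is open, so that it meets the collar of any other
side at the same edge, although collars of distinct sides only share points of edges.\<close>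

lemma at_most_two_sides:
  assumes "s \<in> sides" "s' \<in> sides" "s'' \<in> sides" "side_edge s = side_edge s'" "side_edge s'' = side_edge s"
    "s \<noteq> s'"
  shows "s'' = s \<or> s'' = s'"
proof (rule ccontr)
  assume ne: "\<not> ?thesis"
  have op: "openin (top_of_set S) (glue s s' ` strip)"
    using openin_param_image[OF surface param_glue] assms by blast
  have "Complex (1/2) 0 \<in> strip" by (simp add: strip_iff)
  then have "collar s'' (Complex (1/2) 0) \<in> side_edge s''" using collar_real[OF assms(3)] by simp
  then obtain w where w: "w \<in> half_strip" "0 < Im w" "collar s'' w \<in> glue s s' ` strip"
    using collar_meets_open[OF assms(3) _ op] edge_in_glue[OF assms(1,2,4)] assms(5) by blast
  then obtain v where v: "v \<in> strip" "collar s'' w = glue s s' v" by blast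
  show False
  proof (cases "Im v \<le> 0")
    case True
    then show False
      using collar_inj(1)[OF assms(3,2) w(1) reflect_half_strip[OF assms(1,2,4) v(1)]] v ne w
      by (auto simp: glue_def)
  next
    case False
    then show False
      using collar_inj(1)[OF assms(3,1) w(1), of v] v ne w by (auto simp: glue_def half_strip_def)
  qed
qed

end

section \<open>Every edge has two sides\<close>

lemma circle_point_or_side:
  assumes "norm z = 1" "0 < n"
  shows "(\<exists>k<n. z = circle_point n (real k)) \<or> (\<exists>k<n. z \<in> polygon_side n k)"
proof -
  define t where "t = Arg2pi z * real n / (2 * pi)"
  have z: "z = circle_point n t"
    using Arg2pi[of z] assms by (simp add: t_def circle_point_def cis_conv_exp mult.commute is_Arg_def)
  have t: "0 \<le> t" "t < real n"
    using Arg2pi[of z] assms by (auto simp: t_def divide_simps)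
  define k where "k = nat \<lfloor>t\<rfloor>"
  have k: "real k \<le> t" "t < real k + 1" using t by (auto simp: k_def)
  have "k < n" using k t by linarith
  show ?thesis
  proof (cases "t = real k")
    case True
    then show ?thesis using \<open>k < n\<close> z by blast
  next
    case False
    then have "z \<in> polygon_side n k" using z k by (auto simp: polygon_side_def)
    then show ?thesis using \<open>k < n\<close> by blast
  qed
qed

lemma polygon_side_norm: "z \<in> polygon_side n k \<Longrightarrow> norm z = 1"
  by (auto simp: polygon_side_def)

lemma polygon_map_closure:
  assumes "polygon_map V E n \<phi> R" "x \<in> \<phi> ` cball 0 1"
  shows "x \<in> R \<or> x \<in> V \<or> (\<exists>k<n. x \<in> \<phi> ` polygon_side n k)"
proof -
  obtain z where z: "norm z \<le> 1" "x = \<phi> z" using assms by auto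
  show ?thesis
  proof (cases "norm z < 1")
    case True
    then show ?thesis using z polygon_mapD(5)[OF assms(1)] by auto
  next
    case False
    then have "norm z = 1" using z by simp
    then show ?thesis
      using circle_point_or_side[OF _ polygon_mapD(2)[OF assms(1)]] polygon_mapD(6)[OF assms(1)] z(2) by blast
  qed
qed

text \<open>Invariance of domain from the surface to the plane, after reading \<open>j\<close> in a
  chart.\<close>

lemma open_image_surface:
  assumes "closed_surface S" "openin (top_of_set S) A" "continuous_on A j" "inj_on j A"
  shows "open (j ` A :: complex set)"
proof (subst open_subopen, intro ballI)
  fix y assume "y \<in> j ` A"
  then obtain x where x: "x \<in> A" "y = j x" by auto
  then have "x \<in> S" using assms(2) openin_imp_subset by blast
  then obtain U f where U: "x \<in> U" "chart S U f"
    using assms(1) unfolding closed_surface_def by blast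
  have "chart S (U \<inter> A) f"
    using chartD(1)[OF U(2)] assms(2) by (intro chart_subset[OF U(2)]) auto
  note f = chartD[OF this]
  let ?B = "f ` (U \<inter> A)"
  have "open ((j \<circ> inv_into (U \<inter> A) f) ` ?B)"
  proof (rule invariance_of_domain)
    show "continuous_on ?B (j \<circ> inv_into (U \<inter> A) f)"
      using surface_paramD(2)[OF f(6)] f(5)
      by (intro continuous_on_compose) (auto intro: continuous_on_subset[OF assms(3)])
    show "inj_on (j \<circ> inv_into (U \<inter> A) f) ?B"
      using surface_paramD(3)[OF f(6)] f(5)
      by (intro comp_inj_on) (auto intro: inj_on_subset[OF assms(4)])
  qed (rule f(3))
  moreover have "(j \<circ> inv_into (U \<inter> A) f) ` ?B = j ` (U \<inter> A)"
    using f(5) by (simp only: image_comp[symmetric] inv_into_image_cancel[OF f(5) subset_refl] image_inv_into_cancel)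
  ultimately show "\<exists>T. open T \<and> y \<in> T \<and> T \<subseteq> j ` A" using x U by (intro exI[of _ "j ` (U \<inter> A)"]) auto
qed

context polygonal_tiling
begin

text \<open>There are finitely many edges, and each carries at most two sides; finiteness of the set
  of tiles follows from this.\<close>

lemma finite_sides: "finite sides"
proof -
  have "finite {s \<in> sides. side_edge s = e}" for e
  proof (cases "\<exists>s s'. s \<in> sides \<and> s' \<in> sides \<and> side_edge s = e \<and> side_edge s' = e \<and> s \<noteq> s'")
    case True
    then obtain s s' where "s \<in> sides" "s' \<in> sides" "side_edge s = e" "side_edge s' = e" "s \<noteq> s'" by blast
    then have "{s \<in> sides. side_edge s = e} \<subseteq> {s, s'}" using at_most_two_sides[of s s'] by auto
    then show ?thesis using finite_subset by blast
  next
    case False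
    show ?thesis
    proof (cases "{s \<in> sides. side_edge s = e} = {}")
      case False
      then obtain s where "s \<in> sides" "side_edge s = e" by auto
      then have "{s \<in> sides. side_edge s = e} \<subseteq> {s}" using \<open>\<nexists>s s'. _ s s'\<close> by blast
      then show ?thesis using finite_subset by blast
    qed (metis finite.emptyI)
  qed
  moreover have "sides = (\<Union>e\<in>E. {s \<in> sides. side_edge s = e})" using side_edge_in by auto
  ultimately show ?thesis using graphD(3) by (metis (no_types, lifting) finite_UN_I)
qed

lemma finite_tiles: "finite (tiles S V E)"
proof -
  have "tiles S V E \<subseteq> fst ` sides"
    using polygon_mapD(2)[OF polygons] by (force simp: sides_def)
  then show ?thesis using finite_sides finite_surj by blast
qed

lemma compact_tile_closure: "R \<in> tiles S V E \<Longrightarrow> compact (\<Phi> R ` cball 0 1)"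
  using polygon_mapD(3)[OF polygons] by (intro compact_continuous_image) auto

lemma tile_closure_disjoint_edge:
  assumes "R \<in> tiles S V E" "e \<in> E" "x \<in> e" "x \<in> \<Phi> R ` cball 0 1"
  shows "\<exists>k<n R. (R, k) \<in> sides \<and> side_edge (R, k) = e"
proof -
  consider "x \<in> R" | "x \<in> V" | k where "k < n R" "x \<in> \<Phi> R ` polygon_side (n R) k"
    using polygon_map_closure[OF polygons[OF assms(1)] assms(4)] by blast
  then show ?thesis
  proof cases
    case 1 then show ?thesis using tile_edge_disjoint assms by blast
  next
    case 2 then show ?thesis using graphD(7) assms by blast
  next
    case 3
    then have s: "(R, k) \<in> sides" using assms by (auto simp: sides_def)
    have "x \<in> side_edge (R, k)" using 3 by (simp add: side_edge_def)
    then have "side_edge (R, k) = e" using graphD(6)[OF side_edge_in[OF s]] assms by blast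
    then show ?thesis using 3 s by blast
  qed
qed

text \<open>An edge with no side is open in the surface and at the same time an open arc; the
points near an edge with one side form a half disk.  Both contradict invariance of domain.\<close>

lemma edge_two_sides:
  assumes e: "e \<in> E"
  obtains (two_sides) s s' where "s \<in> sides" "s' \<in> sides" "s \<noteq> s'" "side_edge s = e" "side_edge s' = e"
proof (rule ccontr)
  assume neg: "\<not> thesis"
  have uniq: "s = s'" if "s \<in> sides" "s' \<in> sides" "side_edge s = e" "side_edge s' = e" for s s'
    using neg two_sides[of s s'] that by blast
  have arc: "\<exists>\<gamma>. simple_path \<gamma> \<and> pathstart \<gamma> \<in> V \<and> pathfinish \<gamma> \<in> V \<and>
          e' = path_image \<gamma> - {pathstart \<gamma>, pathfinish \<gamma>} \<and> e' \<inter> V = {}" if "e' \<in> E" for e'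
    using graphD(5)[OF that] by (simp add: open_edge_def)
  have clV: "closed V" using graphD(1) by (rule finite_imp_closed)
  have clE: "closed (e' \<union> V)" if e': "e' \<in> E" for e'
  proof -
    obtain \<gamma> where g: "simple_path \<gamma>" "pathstart \<gamma> \<in> V" "pathfinish \<gamma> \<in> V"
      "e' = path_image \<gamma> - {pathstart \<gamma>, pathfinish \<gamma>}" using arc[OF e'] by blast
    then have "e' \<union> V = path_image \<gamma> \<union> V" by auto
    moreover have "closed (path_image \<gamma>)"
      using g by (intro compact_imp_closed compact_path_image simple_path_imp_path)
    ultimately show ?thesis using clV closed_Un by metis
  qed
  \<comment> \<open>The tiles away from \<open>e\<close>. Their closures, the vertices and the other
    edges form the closed set \<open>D\<close>, closed because the union is finite; its complement
    is a neighbourhood of \<open>e\<close> made of \<open>e\<close> and the adjacent tiles.\<close>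
  define Ts where "Ts = {R \<in> tiles S V E. \<forall>k<n R. side_edge (R, k) \<noteq> e}"
  define D where "D = (\<Union>R\<in>Ts. \<Phi> R ` cball 0 1) \<union> (V \<union> (\<Union>e'\<in>E - {e}. e' \<union> V))"
  have "closed D"
  proof -
    have "closed (\<Union>e'\<in>E - {e}. e' \<union> V)" using clE graphD(3) by (intro closed_UN) auto
    moreover have "closed (\<Union>R\<in>Ts. \<Phi> R ` cball 0 1)"
      using finite_tiles compact_tile_closure by (intro closed_UN) (auto simp: Ts_def compact_imp_closed)
    ultimately show ?thesis unfolding D_def using clV by (intro closed_Un)
  qed
  have "e \<inter> D = {}"
  proof -
    have "x \<notin> \<Phi> R ` cball 0 1" if "x \<in> e" "R \<in> Ts" for x R
      using tile_closure_disjoint_edge[OF _ e, of R x] that by (auto simp: Ts_def)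
    then show ?thesis using graphD(6)[OF e] graphD(7)[OF e] unfolding D_def by fast
  qed
  then have eN: "e \<subseteq> S - D" using graphD(4)[OF e] by blast
  have ND: "x \<in> e \<or> (\<exists>R\<in>tiles S V E. \<exists>k<n R. side_edge (R, k) = e \<and> x \<in> R)" if x: "x \<in> S - D" for x
  proof -
    consider "x \<in> V" | e' where "e' \<in> E" "x \<in> e'" | R where "R \<in> tiles S V E" "x \<in> R"
      using tiles_cover[of x S V E] x by blast
    then show ?thesis
    proof cases
      case 3
      then have "x \<in> \<Phi> R ` cball 0 1" using polygon_mapD(5)[OF polygons[OF 3(1)]] by force
      then have "R \<notin> Ts" using x by (auto simp: D_def)
      then show ?thesis using 3 by (auto simp: Ts_def)
    qed (use x in \<open>unfold D_def, blast+\<close>)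
  qed
  have oN: "openin (top_of_set S) (S - D)" using \<open>closed D\<close> by (simp add: Diff_eq openin_open_Int open_Compl)
  obtain \<gamma> where g: "simple_path \<gamma>" "pathstart \<gamma> \<in> V" "pathfinish \<gamma> \<in> V"
      "e = path_image \<gamma> - {pathstart \<gamma>, pathfinish \<gamma>}" "e \<inter> V = {}" using arc[OF e] by blast
  have e_im: "e = \<gamma> ` {0<..<1}" using simple_path_endless[OF g(1)] g(4) by simp
  have "e \<noteq> {}" unfolding e_im by simp
  show False
  proof (cases "\<exists>s\<in>sides. side_edge s = e")
    case False
    \<comment> \<open>Without adjacent tiles the edge itself is open in the surface, and its
      parameter would embed it as a nonempty plane open set inside the real line.\<close>
    then have "S - D \<subseteq> e" using ND by (fastforce simp: sides_def)
    then have oe: "openin (top_of_set S) e" using oN eN by (metis subset_antisym)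
    have inj: "inj_on \<gamma> {0<..<1}"
    proof (rule inj_onI)
      fix x y :: real assume "x \<in> {0<..<1}" "y \<in> {0<..<1}" "\<gamma> x = \<gamma> y"
      moreover from this have "x \<in> {0..1}" "y \<in> {0..1}" by auto
      ultimately have "x = y \<or> x = 0 \<and> y = 1 \<or> x = 1 \<and> y = 0"
        using g(1) unfolding simple_path_def loop_free_def by blast
      then show "x = y" using \<open>x \<in> {0<..<1}\<close> \<open>y \<in> {0<..<1}\<close> by auto
    qed
    have cont: "continuous_on e (inv_into {0<..<1} \<gamma>)"
      unfolding e_im
    proof (rule continuous_on_inverse_saturated[of "{0..1}"])
      show "continuous_on {0..1} \<gamma>" using g(1) by (simp add: simple_path_def path_def)
      have "{0..1::real} - {0<..<1} = {0, 1}" by auto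
      then show "\<gamma> ` {0<..<1} \<inter> \<gamma> ` ({0..1} - {0<..<1}) = {}"
        using g(2,3,5) e_im by (auto simp: pathstart_def pathfinish_def)
    qed (use inj in auto)
    have "open ((\<lambda>x. complex_of_real (inv_into {0<..<1} \<gamma> x)) ` e)"
      by (rule open_image_surface[OF surface oe])
        (use cont inj in \<open>auto simp: e_im intro!: continuous_intros inj_onI\<close>)
    moreover have "interior (\<real> :: complex set) = {}"
    proof -
      have "\<real> = {z. \<i> \<bullet> z = 0}" by (auto simp: complex_is_Real_iff inner_complex_def)
      then show ?thesis by (metis interior_hyperplane complex_i_not_zero)
    qed
    moreover have "(\<lambda>x. complex_of_real (inv_into {0<..<1} \<gamma> x)) ` e \<subseteq> \<real>" by auto
    ultimately show False using \<open>e \<noteq> {}\<close> interior_maximal by blast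
  next
    case True
    then obtain s where s: "s \<in> sides" "side_edge s = e" by blast
    let ?R = "fst s" and ?Z = "side_coord (n (fst s)) (snd s) ` half_strip"
    note pm = polygon_mapD[OF sidesD(3)[OF s(1)]]
    have Zsub: "?Z \<subseteq> cball 0 1" by (auto simp: half_strip_def norm_side_coord_le_iff[OF sidesD(4)[OF s(1)]])
    have Zim: "x \<in> ?R \<or> x \<in> e" if x: "x \<in> \<Phi> ?R ` ?Z" for x
    proof -
      obtain w where "w \<in> half_strip" "x = collar s w" using x by (auto simp: collar_def)
      then show ?thesis using collar_tile[OF s(1), of w] collar_real[OF s(1), of w] s(2)
        by (cases "Im w = 0") (auto simp: half_strip_def)
    qed
    have injZ: "inj_on (\<Phi> ?R) ?Z"
      using collar_inj(2)[OF s(1) s(1)] by (intro inj_onI) (auto simp: collar_def)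
    have eZ: "e \<subseteq> \<Phi> ?R ` ?Z"
    proof
      fix x assume "x \<in> e"
      then obtain t where "0 < t" "t < 1" "x = collar s (of_real t)" using s(2) by (auto simp: side_edge_collar)
      then show "x \<in> \<Phi> ?R ` ?Z" unfolding collar_def by (auto intro!: imageI of_real_half_strip)
    qed
    \<comment> \<open>Saturation of the collar is where uniqueness of the side enters: another
      boundary point of the tile mapped into \<open>e\<close> would lie on a second side.\<close>
    have sat: "\<Phi> ?R ` ?Z \<inter> \<Phi> ?R ` (cball 0 1 - ?Z) = {}"
    proof (rule ccontr)
      assume "\<not> ?thesis"
      then obtain z z' where z: "z \<in> ?Z" "z' \<in> cball 0 1" "z' \<notin> ?Z" "\<Phi> ?R z = \<Phi> ?R z'" by fastforce
      have zR: "\<Phi> ?R z \<in> ?R \<or> \<Phi> ?R z \<in> e" using Zim z(1) by blast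
      show False
      proof (cases "norm z' < 1")
        case True
        then have R: "\<Phi> ?R z' \<in> ?R" using pm(5) by auto
        have "norm z < 1"
        proof (rule ccontr)
          assume "\<not> norm z < 1"
          then obtain w where w: "w \<in> half_strip" "z = side_coord (n ?R) (snd s) w" "\<not> 0 < Im w"
            using z(1) norm_side_coord_less_iff[OF sidesD(4)[OF s(1)]] by auto
          then show False using collar_tile_iff[OF s(1) w(1)] R z(4) by (simp add: collar_def)
        qed
        then have "z = z'" using True z(4) by (intro inj_onD[OF pm(4)]) auto
        then show False using z by simp
      next
        case False
        then have "norm z' = 1" using z(2) by simp
        then consider (vertex) k where "k < n ?R" "z' = circle_point (n ?R) (real k)"
          | (side) k where "k < n ?R" "z' \<in> polygon_side (n ?R) k"
          using circle_point_or_side[OF _ pm(2)] by blast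
        then show False
        proof cases
          case (vertex k)
          then have "\<Phi> ?R z' \<in> V" using pm(6) by blast
          then show False using zR z(4) graphD(7)[OF e] tiles_facts(2)[OF sidesD(1)[OF s(1)]] by auto
        next
          case (side k)
          have k: "(?R, k) \<in> sides" using side sidesD(1)[OF s(1)] by (simp add: sides_def)
          have "\<Phi> ?R z' \<in> side_edge (?R, k)" using side by (simp add: side_edge_def)
          then have "side_edge (?R, k) = e"
            using zR z(4) graphD(6)[OF side_edge_in[OF k] e] tile_edge_disjoint[OF sidesD(1)[OF s(1)] side_edge_in[OF k]]
            by force
          then have "(?R, k) = s" using uniq[OF k s(1)] s(2) by blast
          then have "k = snd s" by (metis snd_conv)
          then have "z' \<in> ?Z"
            using side of_real_half_strip unfolding polygon_side_eq by fastforce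
          then show False using z by simp
        qed
      qed
    qed
    \<comment> \<open>Removing the rest of the closed tile leaves an open set covered by a single
      half-open collar.\<close>
    let ?N = "(S - D) - \<Phi> ?R ` (cball 0 1 - ?Z)"
    have "compact (\<Phi> ?R ` (cball 0 1 - ?Z))"
      using compact_minus_side_coord[OF sidesD(4)[OF s(1)] sidesD(2)[OF s(1)]]
      by (intro compact_continuous_image) (auto intro: continuous_on_subset[OF pm(3)])
    then have oN': "openin (top_of_set S) ?N"
      using oN by (simp add: Diff_eq[of "S - D"] openin_Int_open compact_imp_closed open_Compl)
    have NZ: "?N \<subseteq> \<Phi> ?R ` ?Z"
    proof
      fix x assume x: "x \<in> ?N"
      then consider "x \<in> e" | R k where "R \<in> tiles S V E" "k < n R" "side_edge (R, k) = e" "x \<in> R"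
        using ND[of x] by blast
      then show "x \<in> \<Phi> ?R ` ?Z"
      proof cases
        case 2
        then have "(R, k) \<in> sides" by (simp add: sides_def)
        then have "R = ?R" using uniq[OF _ s(1), of "(R, k)"] 2 s(2) by auto
        then have "x \<in> \<Phi> ?R ` ball 0 1" using 2 pm(5) by simp
        then obtain z where "z \<in> ball 0 1" "x = \<Phi> ?R z" by blast
        then show ?thesis using x by auto
      qed (use eZ in blast)
    qed
    have "open (inv_into ?Z (\<Phi> ?R) ` ?N)"
    proof (rule open_image_surface[OF surface oN'])
      show "continuous_on ?N (inv_into ?Z (\<Phi> ?R))"
        using continuous_on_inverse_saturated[OF pm(3) compact_cball Zsub injZ sat] NZ
        by (rule continuous_on_subset)
      show "inj_on (inv_into ?Z (\<Phi> ?R)) ?N" using NZ by (rule inj_on_inv_into)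
    qed
    moreover have "inv_into ?Z (\<Phi> ?R) ` ?N \<subseteq> cball 0 1"
      using NZ Zsub inv_into_into[of _ "\<Phi> ?R" ?Z] by blast
    \<comment> \<open>An open set inside the closed disk lies in the open disk, whereas points of
      \<open>e\<close> come from the circle.\<close>
    ultimately have sub: "inv_into ?Z (\<Phi> ?R) ` ?N \<subseteq> ball 0 1"
      using interior_maximal interior_cball by metis
    obtain x where "x \<in> e" using \<open>e \<noteq> {}\<close> by blast
    then have "x \<in> ?N" using eN eZ sat by blast
    moreover have "inv_into ?Z (\<Phi> ?R) x \<notin> ball 0 1"
    proof
      assume "inv_into ?Z (\<Phi> ?R) x \<in> ball 0 1"
      then have "\<Phi> ?R (inv_into ?Z (\<Phi> ?R) x) \<in> ?R" using pm(5) by blast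
      moreover have "\<Phi> ?R (inv_into ?Z (\<Phi> ?R) x) = x" using eZ \<open>x \<in> e\<close> by (meson f_inv_into_f subsetD)
      ultimately show False using tile_edge_disjoint[OF sidesD(1)[OF s(1)] e] \<open>x \<in> e\<close> by simp
    qed
    ultimately show False using sub by blast
  qed
qed

text \<open>Edge points are limits of tile points along collars, and the finite vertex set cannot
  contain a nonempty open set of a surface. Thus two charts can always be compared on a
  tile.\<close>

lemma open_meets_tile:
  assumes "openin (top_of_set S) A" "A \<noteq> {}"
  obtains (tile) R where "R \<in> tiles S V E" "R \<inter> A \<noteq> {}"
proof -
  have edge: thesis if x: "x \<in> A" "x \<notin> V" for x
  proof -
    have "x \<in> S" using x assms(1) openin_imp_subset by blast
    then consider e where "e \<in> E" "x \<in> e" | R where "R \<in> tiles S V E" "x \<in> R"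
      using tiles_cover[of x S V E] x by blast
    then show thesis
    proof cases
      case 1
      then obtain s where s: "s \<in> sides" "side_edge s = e" using edge_two_sides by metis
      then obtain w where "0 < Im w" "collar s w \<in> A"
        using collar_meets_open[OF s(1) _ assms(1) x(1)] 1 by blast
      then show thesis using collar_tile[OF s(1)] sidesD(1)[OF s(1)] tile by blast
    next
      case 2
      then show thesis using x(1) tile by blast
    qed
  qed
  obtain x where x: "x \<in> A" using assms by blast
  then have "x \<in> S" using assms(1) openin_imp_subset by blast
  then obtain U f where U: "x \<in> U" "chart S U f"
    using surface unfolding closed_surface_def by blast
  have ch: "chart S (U \<inter> A) f"
    using chartD(1)[OF U(2)] assms by (intro chart_subset[OF U(2)]) auto
  have "infinite (f ` (U \<inter> A))"
  proof -
    have "f ` (U \<inter> A) \<noteq> {}" using x U by blast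
    then show ?thesis using chartD(3)[OF ch] finite_imp_not_open by blast
  qed
  then have "\<not> U \<inter> A \<subseteq> V" using graphD(1) finite_subset by blast
  then show thesis using edge by blast
qed

end

section \<open>Orientability and coherent orientations of the tiles\<close>

context polygonal_tiling
begin

text \<open>\<open>\<sigma> R\<close> tells whether the direction of rotation given by the
  coordinates \<open>\<Phi> R\<close> is kept or reversed.\<close>

definition coherent :: "('a set \<Rightarrow> bool) \<Rightarrow> bool" where
  "coherent \<sigma> \<longleftrightarrow> (\<forall>s\<in>sides. \<forall>s'\<in>sides. s \<noteq> s' \<longrightarrow> side_edge s = side_edge s' \<longrightarrow>
     (\<sigma> (fst s) = \<sigma> (fst s') \<longleftrightarrow> strict_antimono_on {0<..<1} (side_change s s')))"

text \<open>Above the axis the glued strip differs from the tile coordinates only by the holomorphic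
  \<open>side_coord\<close>, of degree 1.\<close>

lemma local_degree_glue_upper:
  assumes s: "s \<in> sides" "s' \<in> sides" "side_edge s = side_edge s'" "s \<noteq> s'"
    and f: "chart S U f" and w: "w \<in> strip" "0 < Im w" "glue s s' w \<in> U"
  shows "local_degree (f \<circ> glue s s') w = local_degree (f \<circ> \<Phi> (fst s)) (side_coord (n (fst s)) (snd s) w)"
proof -
  let ?B = "{w \<in> strip. 0 < Im w}" and ?h = "side_coord (n (fst s)) (snd s)"
  note p = param_tile[OF sidesD(1)[OF s(1)]] and sd = sidesD[OF s(1)]
  have B: "open ?B"
    using open_Int[OF open_strip open_halfspace_Im_gt[of 0]] by (simp add: Int_def)
  have "local_degree (f \<circ> glue s s') w = local_degree (f \<circ> (\<Phi> (fst s) \<circ> ?h)) w"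
    by (rule local_degree_cong[OF B]) (use w in \<open>auto simp: glue_def collar_def\<close>)
  also have "\<dots> = local_degree (f \<circ> \<Phi> (fst s)) (?h w) * local_degree ?h w"
  proof (rule local_degree_reparam[OF p f B])
    show "inj_on ?h ?B" using inj_on_side_coord[OF sd(4,2)] by (rule inj_on_subset) auto
  qed (use w in \<open>auto simp: continuous_on_side_coord norm_side_coord_less_iff[OF sd(4)] glue_def collar_def\<close>)
  finally show ?thesis by (simp add: local_degree_side_coord[OF sd(4)])
qed

text \<open>Below the axis the reflection enters as a further factor, and its degree records whether
  the two sides run in opposite directions.\<close>

lemma local_degree_glue_lower:
  assumes s: "s \<in> sides" "s' \<in> sides" "side_edge s = side_edge s'" "s \<noteq> s'"
    and f: "chart S U f" and w: "w \<in> strip" "Im w < 0" "glue s s' w \<in> U"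
  shows "local_degree (f \<circ> glue s s') w =
    local_degree (f \<circ> \<Phi> (fst s')) (side_coord (n (fst s')) (snd s') (Complex (side_change s s' (Re w)) (- Im w))) *
    (if strict_antimono_on {0<..<1} (side_change s s') then 1 else -1)"
proof -
  let ?B = "{w \<in> strip. Im w < 0}" and ?h = "side_coord (n (fst s')) (snd s')"
    and ?r = "\<lambda>w. Complex (side_change s s' (Re w)) (- Im w)"
  note p = param_tile[OF sidesD(1)[OF s(2)]] and sd = sidesD[OF s(2)] and ch = side_change[OF s(1-3)]
  have B: "open ?B"
    using open_Int[OF open_strip open_halfspace_Im_lt[of 0]] by (simp add: Int_def)
  have r_cont: "continuous_on ?B ?r"
    unfolding Complex_eq
    by (intro continuous_intros continuous_on_compose2[OF ch(3)]) (auto simp: strip_iff)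
  have r_inj: "inj_on ?r ?B"
    using inj_onD[OF ch(4)] by (intro inj_onI) (auto simp: strip_iff complex_eq_iff)
  have r_im: "?r ` ?B \<subseteq> strip"
  proof (rule image_subsetI)
    fix v assume "v \<in> ?B"
    then have "side_change s s' (Re v) \<in> {0<..<1}" by (intro ch(1)) (simp add: strip_iff)
    then show "?r v \<in> strip" by (simp add: strip_iff)
  qed
  have "local_degree (f \<circ> glue s s') w = local_degree (f \<circ> (\<Phi> (fst s') \<circ> (?h \<circ> ?r))) w"
    by (rule local_degree_cong[OF B]) (use w in \<open>auto simp: glue_def collar_def\<close>)
  also have "\<dots> = local_degree (f \<circ> \<Phi> (fst s')) ((?h \<circ> ?r) w) * local_degree (?h \<circ> ?r) w"
  proof (rule local_degree_reparam[OF p f B])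
    show "inj_on (?h \<circ> ?r) ?B"
      by (rule comp_inj_on[OF r_inj]) (use inj_on_subset[OF inj_on_side_coord[OF sd(4,2)] r_im] in simp)
    show "continuous_on ?B (?h \<circ> ?r)"
      using r_cont continuous_on_side_coord by (rule continuous_on_compose)
  qed (use w in \<open>auto simp: norm_side_coord_less_iff[OF sd(4)] glue_def collar_def\<close>)
  also have "local_degree (?h \<circ> ?r) w = local_degree ?h (?r w) * local_degree ?r w"
    by (rule local_degree_compose[OF B r_cont r_inj _ open_strip continuous_on_side_coord inj_on_side_coord[OF sd(4,2)]])
      (use w r_im in auto)
  also have "local_degree ?r w = (if strict_antimono_on {0<..<1} (side_change s s') then 1 else -1)"
    using local_degree_reflect_increasing[OF _ ch(3), of w] local_degree_reflect_decreasing[OF _ ch(3), of w] ch(5) w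
    by (auto simp: strip_iff)
  finally show ?thesis
    by (simp only: comp_apply[of ?h ?r w] local_degree_side_coord[OF sd(4)] mult_1_left)
qed

text \<open>In an oriented atlas every tile has a sign and so has every glued strip. Evaluating the
  sign of the strip above and below the axis compares the signs of the two tiles.\<close>

lemma orientable_imp_coherent:
  assumes "orientable S" shows "\<exists>\<sigma>. coherent \<sigma>"
proof -
  obtain \<A> where \<A>: "oriented_charts S \<A>" and cov: "\<And>x. x \<in> S \<Longrightarrow> \<exists>(U, f)\<in>\<A>. x \<in> U"
    using orientableE[OF assms] by metis
  have "\<forall>R\<in>tiles S V E. \<exists>d. (d = 1 \<or> d = -1) \<and>
     (\<forall>U f z. (U, f) \<in> \<A> \<longrightarrow> z \<in> ball 0 1 \<longrightarrow> \<Phi> R z \<in> U \<longrightarrow> local_degree (f \<circ> \<Phi> R) z = d)"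
  proof
    fix R assume R: "R \<in> tiles S V E"
    show "\<exists>d. (d = 1 \<or> d = -1) \<and>
     (\<forall>U f z. (U, f) \<in> \<A> \<longrightarrow> z \<in> ball 0 1 \<longrightarrow> \<Phi> R z \<in> U \<longrightarrow> local_degree (f \<circ> \<Phi> R) z = d)"
    proof (rule oriented_charts_sign[OF \<A> param_tile[OF R] connected_ball])
      show "\<exists>(U, f)\<in>\<A>. \<Phi> R z \<in> U" if "z \<in> ball 0 1" for z
        using cov surface_paramD(4)[OF param_tile[OF R]] that by blast
      fix d assume "d = 1 \<or> d = (-1::complex)"
        "\<And>U f z. (U, f) \<in> \<A> \<Longrightarrow> z \<in> ball 0 1 \<Longrightarrow> \<Phi> R z \<in> U \<Longrightarrow> local_degree (f \<circ> \<Phi> R) z = d"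
      then show ?thesis by (intro exI[of _ d]) simp
    qed
  qed
  from bchoice[OF this] obtain d where d0: "\<forall>R\<in>tiles S V E. (d R = 1 \<or> d R = (-1::complex)) \<and>
     (\<forall>U f z. (U, f) \<in> \<A> \<longrightarrow> z \<in> ball 0 1 \<longrightarrow> \<Phi> R z \<in> U \<longrightarrow> local_degree (f \<circ> \<Phi> R) z = d R)" ..
  have d: "R \<in> tiles S V E \<Longrightarrow> d R = 1 \<or> d R = (-1::complex)"
    "R \<in> tiles S V E \<Longrightarrow> (U, f) \<in> \<A> \<Longrightarrow> z \<in> ball 0 1 \<Longrightarrow> \<Phi> R z \<in> U \<Longrightarrow> local_degree (f \<circ> \<Phi> R) z = d R" for R U f z
    using d0 by (blast, simp)
  have "coherent (\<lambda>R. d R = 1)"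
    unfolding coherent_def
  proof (intro ballI impI)
    fix s s' assume s: "s \<in> sides" "s' \<in> sides" "s \<noteq> s'" "side_edge s = side_edge s'"
    let ?a = "strict_antimono_on {0<..<1} (side_change s s')"
    note pg = param_glue[OF s(1,2,4,3)]
    have gS: "glue s s' w \<in> S" if "w \<in> strip" for w using surface_paramD(4)[OF pg] that by blast
    obtain c where "c = 1 \<or> c = (-1::complex)" and c: "\<And>U f a. (U, f) \<in> \<A> \<Longrightarrow> a \<in> strip \<Longrightarrow> glue s s' a \<in> U \<Longrightarrow> local_degree (f \<circ> glue s s') a = c"
    proof (rule oriented_charts_sign[OF \<A> pg convex_connected[OF convex_strip] cov[OF gS]])
      fix c assume "c = 1 \<or> c = (-1::complex)"
        "\<And>U f a. (U, f) \<in> \<A> \<Longrightarrow> a \<in> strip \<Longrightarrow> glue s s' a \<in> U \<Longrightarrow> local_degree (f \<circ> glue s s') a = c"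
      then show thesis by (rule that)
    qed
    have 1: "c = d (fst s)"
    proof -
      \<comment> \<open>An arbitrary point above the axis; its mirror image is used below the
        axis.\<close>
      let ?w = "Complex (1/2) 1"
      have w: "?w \<in> strip" "0 < Im ?w" by (auto simp: strip_iff)
      obtain U f where U: "(U, f) \<in> \<A>" "glue s s' ?w \<in> U" using cov[OF gS[OF w(1)]] by blast
      have "c = local_degree (f \<circ> \<Phi> (fst s)) (side_coord (n (fst s)) (snd s) ?w)"
        using c[OF U(1) w(1) U(2)] local_degree_glue_upper[OF s(1,2,4,3) oriented_chartsD(1)[OF \<A> U(1)] w U(2)] by simp
      also have "\<dots> = d (fst s)"
        using U w by (intro d(2)[OF sidesD(1)[OF s(1)] U(1)])
          (auto simp: norm_side_coord_less_iff[OF sidesD(4)[OF s(1)]] glue_def collar_def)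
      finally show ?thesis .
    qed
    have 2: "c = d (fst s') * (if ?a then 1 else -1)"
    proof -
      let ?w = "Complex (1/2) (-1)"
      have w: "?w \<in> strip" "Im ?w < 0" by (auto simp: strip_iff)
      obtain U f where U: "(U, f) \<in> \<A>" "glue s s' ?w \<in> U" using cov[OF gS[OF w(1)]] by blast
      have "local_degree (f \<circ> \<Phi> (fst s')) (side_coord (n (fst s')) (snd s') (Complex (side_change s s' (Re ?w)) (- Im ?w))) = d (fst s')"
        using U w by (intro d(2)[OF sidesD(1)[OF s(2)] U(1)])
          (auto simp: norm_side_coord_less_iff[OF sidesD(4)[OF s(2)]] glue_def collar_def)
      then show ?thesis
        using c[OF U(1) w(1) U(2)] local_degree_glue_lower[OF s(1,2,4,3) oriented_chartsD(1)[OF \<A> U(1)] w U(2)] by simp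
    qed
    show "((d (fst s) = 1) = (d (fst s') = 1)) = ?a"
      using 1 2 d(1)[OF sidesD(1)[OF s(1)]] d(1)[OF sidesD(1)[OF s(2)]] by (auto split: if_splits)
  qed
  then show ?thesis by blast
qed

section \<open>An oriented atlas from a coherent choice\<close>

definition tile_charts :: "('a set \<Rightarrow> bool) \<Rightarrow> ('a set \<times> ('a \<Rightarrow> complex)) set" where
  "tile_charts \<sigma> = {(U, f). chart S U f \<and> (\<forall>R\<in>tiles S V E. \<forall>z\<in>ball 0 1. \<Phi> R z \<in> U \<longrightarrow>
     local_degree (f \<circ> \<Phi> R) z = (if \<sigma> R then 1 else -1))}"

text \<open>A chart that is wrong by one global sign is repaired by complex conjugation.\<close>

lemma tile_chartsI:
  assumes f: "chart S U f" and c: "c = 1 \<or> c = (-1::complex)"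
    and deg: "\<And>R z. R \<in> tiles S V E \<Longrightarrow> z \<in> ball 0 1 \<Longrightarrow> \<Phi> R z \<in> U \<Longrightarrow>
      local_degree (f \<circ> \<Phi> R) z = c * (if \<sigma> R then 1 else -1)"
  shows "\<exists>g. (U, g) \<in> tile_charts \<sigma>"
proof (cases "c = 1")
  case True
  then show ?thesis using f deg by (intro exI[of _ f]) (auto simp: tile_charts_def)
next
  case False
  then have "c = -1" using c by blast
  have "local_degree ((cnj \<circ> f) \<circ> \<Phi> R) z = (if \<sigma> R then 1 else -1)"
    if "R \<in> tiles S V E" "z \<in> ball 0 1" "\<Phi> R z \<in> U" for R z
    using local_degree_chart_cnj[OF param_tile[OF that(1)] f that(2,3)] deg[OF that] \<open>c = -1\<close> by auto
  then show ?thesis using chart_cnj[OF f] unfolding tile_charts_def by blast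
qed

text \<open>Prescribing signs on tiles forces compatibility everywhere: the degree of a transition
  map is locally constant, every small disk of the overlap meets a tile, and there both charts have
  the same sign. Coherence is needed only for covering the surface.\<close>

lemma oriented_tile_charts: "oriented_charts S (tile_charts \<sigma>)"
proof -
  have "orientation_preserving_on (f ` (U \<inter> W)) (g \<circ> inv_into U f)"
    if UW: "(U, f) \<in> tile_charts \<sigma>" "(W, g) \<in> tile_charts \<sigma>" for U f W g
  proof -
    have f: "chart S U f" and g: "chart S W g" using UW by (auto simp: tile_charts_def)
    note t = chart_transition[OF f g]
    have "local_degree (g \<circ> inv_into U f) z = 1" if z: "z \<in> f ` (U \<inter> W)" for z
    proof -
      obtain r where r: "0 < r" "cball z r \<subseteq> f ` (U \<inter> W)" using t(1) z open_contains_cball by blast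
      have sp: "surface_param S (ball z r) (inv_into U f)"
      proof (rule surface_param_subset[OF chartD(6)[OF f]])
        show "ball z r \<subseteq> f ` U" using r(2) ball_subset_cball by blast
      qed simp
      have "openin (top_of_set S) (inv_into U f ` ball z r)" by (rule openin_param_image[OF surface sp])
      moreover have "inv_into U f ` ball z r \<noteq> {}" using r by auto
      ultimately obtain R where R: "R \<in> tiles S V E" "R \<inter> inv_into U f ` ball z r \<noteq> {}"
        using open_meets_tile by metis
      then obtain y where y: "y \<in> R" "y \<in> inv_into U f ` ball z r" by blast
      then obtain u where u: "u \<in> ball z r" "y = inv_into U f u" by blast
      have "u \<in> f ` (U \<inter> W)" using u(1) r ball_subset_cball by blast
      then have yU: "y \<in> U" "y \<in> W" "f y = u" using u(2) chartD(5)[OF f] by auto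
      have "y \<in> \<Phi> R ` ball 0 1" using y polygon_mapD(5)[OF polygons[OF R(1)]] by simp
      then obtain v where v: "v \<in> ball 0 1" "y = \<Phi> R v" by blast
      have "local_degree (g \<circ> \<Phi> R) v = local_degree (g \<circ> inv_into U f) (f (\<Phi> R v)) * local_degree (f \<circ> \<Phi> R) v"
        using yU v by (intro local_degree_change_chart[OF f g param_tile[OF R(1)]]) auto
      moreover have "local_degree (g \<circ> \<Phi> R) v = (if \<sigma> R then 1 else -1)"
        "local_degree (f \<circ> \<Phi> R) v = (if \<sigma> R then 1 else -1)"
        using UW R(1) v yU by (auto simp: tile_charts_def)
      ultimately have "local_degree (g \<circ> inv_into U f) u = 1" using yU v by (auto split: if_splits)
      then show ?thesis using local_degree_eq_nearby[OF t(2,3) r u(1)] by simp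
    qed
    then show ?thesis using orientation_preserving_on_iff[OF t] by simp
  qed
  then show ?thesis unfolding oriented_charts_def by (auto simp: tile_charts_def)
qed

text \<open>The inverse of \<open>\<Phi> R\<close> meets no other tile and has degree 1 against
  \<open>\<Phi> R\<close>, so only the global sign \<open>\<sigma> R\<close> has to be
  adjusted.\<close>

lemma tile_charts_tile:
  assumes "R \<in> tiles S V E" shows "\<exists>f. (R, f) \<in> tile_charts \<sigma>"
proof -
  note p = param_tile[OF assms] and im = polygon_mapD(5)[OF polygons[OF assms]]
  let ?f = "inv_into (ball 0 1) (\<Phi> R)"
  have ch: "chart S R ?f" using chart_inv_param[OF surface p] im by simp
  show ?thesis
  proof (rule tile_chartsI[OF ch, of "if \<sigma> R then 1 else -1"])
    fix R' z assume R': "R' \<in> tiles S V E" "z \<in> ball 0 1" "\<Phi> R' z \<in> R"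
    have "\<Phi> R' z \<in> R'" using R' polygon_mapD(5)[OF polygons[OF R'(1)]] by blast
    then have "R' = R" using tiles_facts(6)[OF R'(1) assms] R'(3) by blast
    then show "local_degree (?f \<circ> \<Phi> R') z = (if \<sigma> R then 1 else -1) * (if \<sigma> R' then 1 else -1)"
      using R'(2) surface_paramD(3)[OF p] by (subst local_degree_id_on[of "ball 0 1"]) auto
  qed auto
qed

text \<open>The inverse of the glued strip has one global sign with respect to both adjacent tiles
  exactly because of coherence; points on the real axis lie in no tile.\<close>

lemma tile_charts_edge:
  assumes "coherent \<sigma>" "x \<in> e" "e \<in> E" shows "\<exists>(U, f)\<in>tile_charts \<sigma>. x \<in> U"
proof -
  obtain s s' where s: "s \<in> sides" "s' \<in> sides" "s \<noteq> s'" "side_edge s = e" "side_edge s' = e"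
    using edge_two_sides[OF assms(3)] by metis
  then have se: "side_edge s = side_edge s'" by simp
  let ?G = "glue s s'" and ?a = "strict_antimono_on {0<..<1} (side_change s s')"
  let ?f = "inv_into strip ?G"
  note p = param_glue[OF s(1,2) se s(3)] and ch = chart_inv_param[OF surface param_glue[OF s(1,2) se s(3)]]
  have co: "\<sigma> (fst s) = \<sigma> (fst s') \<longleftrightarrow> ?a" using assms(1) s se by (auto simp: coherent_def)
  have one: "local_degree (?f \<circ> ?G) w = 1" if "w \<in> strip" for w
    using surface_paramD(3)[OF p] that by (intro local_degree_id_on[OF open_strip]) auto
  have "\<exists>f. (?G ` strip, f) \<in> tile_charts \<sigma>"
  proof (rule tile_chartsI[OF ch, of "if \<sigma> (fst s) then 1 else -1"])
    fix R z assume R: "R \<in> tiles S V E" "z \<in> ball 0 1" "\<Phi> R z \<in> ?G ` strip"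
    then obtain w where w: "w \<in> strip" "\<Phi> R z = ?G w" by blast
    have zR: "\<Phi> R z \<in> R" using R polygon_mapD(5)[OF polygons[OF R(1)]] by blast
    have eqI: "R = fst t \<and> z = side_coord (n (fst t)) (snd t) v"
      if t: "t \<in> sides" "0 < Im v" "\<Phi> R z = collar t v" for t v
    proof -
      have "\<Phi> R z \<in> fst t" using collar_tile[OF t(1,2)] t(3) by simp
      then have Rt: "R = fst t" using tiles_facts(6)[OF R(1) sidesD(1)[OF t(1)]] zR by blast
      moreover have "z = side_coord (n (fst t)) (snd t) v"
        using t(2,3) R(2) Rt norm_side_coord_less_iff[OF sidesD(4)[OF t(1)]] unfolding collar_def
        by (intro inj_onD[OF polygon_mapD(4)[OF polygons[OF R(1)]]]) auto
      ultimately show ?thesis by blast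
    qed
    consider "Im w = 0" | "0 < Im w" | "Im w < 0" by linarith
    then show "local_degree (?f \<circ> \<Phi> R) z = (if \<sigma> (fst s) then 1 else -1) * (if \<sigma> R then 1 else -1)"
    proof cases
      case 1
      then have "?G w = collar s w" using w glue_nonneg[OF s(1,2) se, of w] by (simp add: half_strip_def)
      then have "\<Phi> R z \<in> e" using collar_real[OF s(1) w(1) 1] w(2) s(4) by simp
      then show ?thesis using tile_edge_disjoint[OF R(1) assms(3) zR] by blast
    next
      case 2
      then have "R = fst s \<and> z = side_coord (n (fst s)) (snd s) w"
        using w by (intro eqI[OF s(1)]) (auto simp: glue_def)
      then show ?thesis
        using local_degree_glue_upper[OF s(1,2) se s(3) ch w(1) 2] one[OF w(1)] w(1) by auto
    next
      case 3
      then have R': "R = fst s' \<and> z = side_coord (n (fst s')) (snd s') (Complex (side_change s s' (Re w)) (- Im w))"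
        using w by (intro eqI[OF s(2)]) (auto simp: glue_def)
      then have "local_degree (?f \<circ> \<Phi> R) z * (if ?a then 1 else -1) = 1"
        using local_degree_glue_lower[OF s(1,2) se s(3) ch w(1) 3] one[OF w(1)] w(1) by auto
      then have "local_degree (?f \<circ> \<Phi> R) z = (if ?a then 1 else -1)"
        by (auto split: if_splits simp: minus_equation_iff)
      \<comment> \<open>By \<open>co\<close> the sign of the reflection is the product of the signs
        of the two tiles.\<close>
      then show ?thesis using co R' by auto
    qed
  qed auto
  moreover have "x \<in> ?G ` strip" using edge_in_glue[OF s(1,2) se] s(4) assms(2) by blast
  ultimately show ?thesis by blast
qed

text \<open>Any chart disk around the vertex works up to a global sign: the punctured disk is
  covered by charts of tiles and edges, so its parametrization has a constant sign against them, and
  the center lies in no tile.\<close>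

lemma tile_charts_vertex:
  assumes co: "coherent \<sigma>" and x: "x \<in> V" shows "\<exists>(U, f)\<in>tile_charts \<sigma>. x \<in> U"
proof -
  have "x \<in> S" using x graphD(2) by blast
  then obtain U0 f where U0: "x \<in> U0" "chart S U0 f"
    using surface unfolding closed_surface_def by blast
  \<comment> \<open>The other vertices are removed, so that the punctured disk meets only edges and
    tiles.\<close>
  have "openin (top_of_set S) (S - (V - {x}))"
    using graphD(1,2) by (intro openin_diff closed_subset) (auto intro: finite_imp_closed)
  then have "openin (top_of_set S) (U0 \<inter> (S - (V - {x})))" using chartD(1)[OF U0(2)] by (rule openin_Int[rotated])
  moreover have "U0 \<inter> (S - (V - {x})) = U0 - (V - {x})" using chartD(2)[OF U0(2)] by blast
  ultimately have ch1: "chart S (U0 - (V - {x})) f" by (intro chart_subset[OF U0(2)]) auto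
  let ?U1 = "U0 - (V - {x})"
  note f1 = chartD[OF ch1]
  have "f x \<in> f ` ?U1" using U0 by blast
  then obtain r where r: "0 < r" "ball (f x) r \<subseteq> f ` ?U1" using f1(3) open_contains_ball by blast
  let ?i = "inv_into ?U1 f"
  have sp: "surface_param S (ball (f x) r) ?i" using surface_param_subset[OF f1(6) _ r(2)] by simp
  let ?U = "?i ` ball (f x) r"
  have UU1: "?U \<subseteq> ?U1"
  proof (rule image_subsetI)
    fix a assume "a \<in> ball (f x) r"
    then have "a \<in> f ` ?U1" using r(2) by (rule subsetD[rotated])
    then show "?i a \<in> ?U1" by (rule inv_into_into)
  qed
  have ch: "chart S ?U f" using chart_subset[OF ch1 openin_param_image[OF surface sp] UU1] .
  have ix: "?i (f x) = x" using U0 f1(5) by simp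
  have xU: "x \<in> ?U" by (rule image_eqI[of _ _ "f x"]) (use ix r in auto)
  let ?A = "ball (f x) r - {f x}"
  have spA: "surface_param S ?A ?i" using surface_param_subset[OF sp, of ?A] by (auto simp: open_delete)
  have "connected ?A" by (intro connected_open_delete) auto
  have iA: "?i a \<in> ?U - {x} \<and> f (?i a) = a" if a: "a \<in> ?A" for a
  proof -
    have "a \<in> ball (f x) r" using a by blast
    then have "a \<in> f ` ?U1" using r(2) by (rule subsetD[rotated])
    then have "f (?i a) = a" by (rule f_inv_into_f)
    moreover from this have "?i a \<noteq> x" using a by auto
    ultimately show ?thesis using a by blast
  qed
  have covA: "\<exists>(W, g)\<in>tile_charts \<sigma>. ?i a \<in> W" if a: "a \<in> ?A" for a
  proof -
    have "?i a \<in> S" using surface_paramD(4)[OF spA] a by blast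
    moreover have "?i a \<notin> V" using iA[OF a] UU1 by blast
    ultimately consider e where "e \<in> E" "?i a \<in> e" | R where "R \<in> tiles S V E" "?i a \<in> R"
      using tiles_cover[of "?i a" S V E] by blast
    then show ?thesis
    proof cases
      case 1 then show ?thesis using tile_charts_edge[OF co] by blast
    next
      case 2 then show ?thesis using tile_charts_tile by blast
    qed
  qed
  obtain d where d: "d = 1 \<or> d = -1"
    "\<And>W g a. (W, g) \<in> tile_charts \<sigma> \<Longrightarrow> a \<in> ?A \<Longrightarrow> ?i a \<in> W \<Longrightarrow> local_degree (g \<circ> ?i) a = d"
  proof (rule oriented_charts_sign[OF oriented_tile_charts spA \<open>connected ?A\<close> covA])
    fix d assume "d = 1 \<or> d = (-1::complex)"
      "\<And>W g a. (W, g) \<in> tile_charts \<sigma> \<Longrightarrow> a \<in> ?A \<Longrightarrow> ?i a \<in> W \<Longrightarrow> local_degree (g \<circ> ?i) a = d"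
    then show thesis by (rule that)
  qed
  have "\<exists>g. (?U, g) \<in> tile_charts \<sigma>"
  proof (rule tile_chartsI[OF ch d(1)])
    fix R z assume R: "R \<in> tiles S V E" "z \<in> ball 0 1" "\<Phi> R z \<in> ?U"
    have zR: "\<Phi> R z \<in> R" using R polygon_mapD(5)[OF polygons[OF R(1)]] by blast
    obtain a where a: "a \<in> ball (f x) r" "\<Phi> R z = ?i a" using R(3) by blast
    have "\<Phi> R z \<noteq> x" using zR tiles_facts(2)[OF R(1)] x by blast
    then have aA: "a \<in> ?A" using a ix by auto
    have fz: "f (\<Phi> R z) = a" using iA[OF aA] a(2) by simp
    obtain W g where W: "(W, g) \<in> tile_charts \<sigma>" "?i a \<in> W" using covA[OF aA] by blast
    have g: "chart S W g" using W(1) by (auto simp: tile_charts_def)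
    have "local_degree (g \<circ> \<Phi> R) z = local_degree (g \<circ> inv_into ?U1 f) (f (\<Phi> R z)) * local_degree (f \<circ> \<Phi> R) z"
    proof (rule local_degree_change_chart[OF ch1 g param_tile[OF R(1)] R(2)])
      show "\<Phi> R z \<in> ?U1" using R(3) UU1 by (rule subsetD[rotated])
      show "\<Phi> R z \<in> W" using W(2) a(2) by simp
    qed
    moreover have "local_degree (g \<circ> \<Phi> R) z = (if \<sigma> R then 1 else -1)"
      using W R a by (auto simp: tile_charts_def)
    ultimately have "(if \<sigma> R then 1 else -1) = d * local_degree (f \<circ> \<Phi> R) z"
      using d(2)[OF W(1) aA W(2)] fz by simp
    then show "local_degree (f \<circ> \<Phi> R) z = d * (if \<sigma> R then 1 else -1)" using d(1) by (auto split: if_splits)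
  qed
  then show ?thesis using xU by blast
qed

theorem orientable_iff_coherent: "orientable S \<longleftrightarrow> (\<exists>\<sigma>. coherent \<sigma>)"
proof
  assume "\<exists>\<sigma>. coherent \<sigma>"
  then obtain \<sigma> where co: "coherent \<sigma>" by blast
  show "orientable S"
  proof (rule orientableI[OF oriented_tile_charts])
    fix x assume "x \<in> S"
    then consider "x \<in> V" | e where "e \<in> E" "x \<in> e" | R where "R \<in> tiles S V E" "x \<in> R"
      using tiles_cover[of x S V E] by blast
    then show "\<exists>(U, f)\<in>tile_charts \<sigma>. x \<in> U"
    proof cases
      case 1 then show ?thesis by (rule tile_charts_vertex[OF co])
    next
      case 2 then show ?thesis using tile_charts_edge[OF co] by blast
    next
      case 3 then show ?thesis using tile_charts_tile by blast
    qed
  qed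
qed (rule orientable_imp_coherent)

end

section \<open>Uniqueness of polygon maps\<close>

text \<open>The cluster set of \<open>h\<close> at \<open>p\<close> is a nested intersection of
  compact connected sets. Continuity and the Hausdorff property put it into the fibre of
  \<open>\<phi>\<close> over \<open>\<psi> p\<close>; being finite, connected and nonempty, it is a
  single point.\<close>

lemma disc_transition_limit:
  fixes \<phi> \<psi> :: "complex \<Rightarrow> 'a::t2_space"
  assumes cont: "continuous_on (cball 0 1) \<phi>" "continuous_on (cball 0 1) \<psi>"
    and h: "continuous_on (ball 0 1) h" "h ` ball 0 1 \<subseteq> ball 0 1" "\<And>z. z \<in> ball 0 1 \<Longrightarrow> \<phi> (h z) = \<psi> z"
    and p: "norm p = 1" and fin: "finite {z \<in> cball 0 1. \<phi> z = \<psi> p}"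
  obtains l where "l \<in> cball 0 1" "(h \<longlongrightarrow> l) (at p within ball 0 1)" "\<phi> l = \<psi> p"
proof -
  \<comment> \<open>Intersections of two convex sets are connected, hence so are the closures of
    their images.\<close>
  define N where "N k = ball 0 1 \<inter> ball p (1 / real (Suc k))" for k
  define C where "C k = closure (h ` N k)" for k
  have hN: "h ` N k \<subseteq> cball 0 1" for k using h(2) by (auto simp: N_def image_subset_iff)
  have Cc: "C k \<subseteq> cball 0 1" for k unfolding C_def using hN by (rule closure_minimal) simp
  have comp: "compact (C k)" for k
    unfolding compact_eq_bounded_closed using bounded_subset[OF bounded_cball Cc] by (auto simp: C_def)
  have conn: "connected (C k)" for k
    unfolding C_def N_def using h(1)
    by (intro connected_imp_connected_closure connected_continuous_image convex_connected convex_Int)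
      (auto intro: continuous_on_subset)
  have pts: "\<exists>z\<in>ball 0 1. dist p z < d" if d: "0 < d" for d
  proof -
    have "p \<in> closure (ball 0 1)" using p by simp
    then show ?thesis using d unfolding closure_approachable by (metis dist_commute)
  qed
  have ne: "C k \<noteq> {}" for k
    using pts[of "1 / real (Suc k)"] closure_subset unfolding C_def N_def by fastforce
  have nest: "C k' \<subseteq> C k" if "k \<le> k'" for k k'
    unfolding C_def N_def using that by (intro closure_mono image_mono Int_mono subset_ball) (auto simp: frac_le)
  let ?L = "\<Inter> (range C)"
  have Lc: "connected ?L" using connected_nest[OF comp conn nest] .
  have Lne: "?L \<noteq> {}" using compact_nest[OF comp ne nest] by simp
  have val: "\<phi> l = \<psi> p" if l: "l \<in> ?L" for l
  proof (rule ccontr)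
    assume "\<phi> l \<noteq> \<psi> p"
    then obtain A B where AB: "open A" "open B" "\<phi> l \<in> A" "\<psi> p \<in> B" "A \<inter> B = {}"
      by (metis hausdorff)
    have lc: "l \<in> cball 0 1" using l Cc by blast
    have "(\<phi> \<longlongrightarrow> \<phi> l) (at l within cball 0 1)" using cont(1) lc by (simp add: continuous_on_def)
    then have "\<forall>\<^sub>F z in at l within cball 0 1. \<phi> z \<in> A" using AB by (auto dest: topological_tendstoD)
    then obtain d1 where d1: "0 < d1" "\<And>z. z \<in> cball 0 1 \<Longrightarrow> dist z l < d1 \<Longrightarrow> \<phi> z \<in> A"
      using AB(3) unfolding eventually_at by metis
    have "(\<psi> \<longlongrightarrow> \<psi> p) (at p within cball 0 1)" using cont(2) p by (simp add: continuous_on_def)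
    then have "\<forall>\<^sub>F z in at p within cball 0 1. \<psi> z \<in> B" using AB by (auto dest: topological_tendstoD)
    then obtain d2 where d2: "0 < d2" "\<And>z. z \<in> cball 0 1 \<Longrightarrow> dist z p < d2 \<Longrightarrow> \<psi> z \<in> B"
      using AB(4) unfolding eventually_at by metis
    obtain k where k: "1 / real (Suc k) < d2" using d2(1) nat_approx_posE by blast
    have "l \<in> closure (h ` N k)" using l by (auto simp: C_def)
    then obtain z where z: "z \<in> N k" "dist (h z) l < d1"
      using d1(1) unfolding closure_approachable by blast
    have "h z \<in> cball 0 1" using z(1) hN by blast
    then have "\<phi> (h z) \<in> A" using z(2) by (rule d1(2))
    moreover have "\<psi> z \<in> B" using z k by (intro d2(2)) (auto simp: N_def dist_commute)
    moreover have "\<phi> (h z) = \<psi> z" using z by (intro h(3)) (auto simp: N_def)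
    ultimately show False using AB(5) by auto
  qed
  have "?L \<subseteq> {z \<in> cball 0 1. \<phi> z = \<psi> p}" using val Cc by blast
  then have "finite ?L" using fin by (rule finite_subset)
  then obtain l where L: "?L = {l}" using connected_finite_iff_sing[OF Lc] Lne by auto
  have "(h \<longlongrightarrow> l) (at p within ball 0 1)"
  proof (rule tendstoI)
    fix e :: real assume "0 < e"
    \<comment> \<open>Otherwise the nested compact sets \<open>C k - ball l e\<close> would share a
      point of the cluster set other than \<open>l\<close>.\<close>
    have "\<exists>k. C k - ball l e = {}"
    proof (rule ccontr)
      assume "\<not> ?thesis"
      then have "\<Inter> (range (\<lambda>k. C k - ball l e)) \<noteq> {}"
        using nest by (intro compact_nest compact_diff comp) auto
      then show False using L \<open>0 < e\<close> by auto
    qed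
    then obtain k where k: "C k \<subseteq> ball l e" by blast
    have near: "dist (h z) l < e" if z: "z \<in> ball 0 1" "dist z p < 1 / real (Suc k)" for z
    proof -
      have "z \<in> N k" using z by (simp add: N_def dist_commute)
      then have "h z \<in> C k" unfolding C_def by (intro subsetD[OF closure_subset] imageI)
      then show ?thesis using k by (auto simp: dist_commute)
    qed
    show "\<forall>\<^sub>F z in at p within ball 0 1. dist (h z) l < e"
      unfolding eventually_at by (intro exI[of _ "1 / real (Suc k)"] conjI ballI impI near; simp)
  qed
  moreover have "l \<in> ?L" using L by simp
  then have "\<phi> l = \<psi> p" "l \<in> cball 0 1" using val Cc[of 0] by auto
  ultimately show thesis by (intro that)
qed

text \<open>Limits taken from the open disk suffice for continuity on the closed disk, because every
  boundary point is approximated by interior points.\<close>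

lemma disc_transition_extension:
  fixes \<phi> \<psi> :: "complex \<Rightarrow> 'a::t2_space"
  assumes cont: "continuous_on (cball 0 1) \<phi>" "continuous_on (cball 0 1) \<psi>"
    and h: "continuous_on (ball 0 1) h" "h ` ball 0 1 \<subseteq> ball 0 1" "\<And>z. z \<in> ball 0 1 \<Longrightarrow> \<phi> (h z) = \<psi> z"
    and fin: "\<And>p. norm p = 1 \<Longrightarrow> finite {z \<in> cball 0 1. \<phi> z = \<psi> p}"
  obtains H where "continuous_on (cball 0 1) H" "H ` cball 0 1 \<subseteq> cball 0 1"
    "\<And>z. z \<in> cball 0 1 \<Longrightarrow> \<phi> (H z) = \<psi> z" "\<And>z. z \<in> ball 0 1 \<Longrightarrow> H z = h z"
proof -
  have "\<exists>l. l \<in> cball 0 1 \<and> (h \<longlongrightarrow> l) (at p within ball 0 1) \<and> \<phi> l = \<psi> p" if p: "norm p = 1" for p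
    using disc_transition_limit[OF cont h p fin[OF p]] by metis
  then obtain l where l: "\<And>p. norm p = 1 \<Longrightarrow> l p \<in> cball 0 1"
    "\<And>p. norm p = 1 \<Longrightarrow> (h \<longlongrightarrow> l p) (at p within ball 0 1)" "\<And>p. norm p = 1 \<Longrightarrow> \<phi> (l p) = \<psi> p"
    by metis
  define H where "H z = (if z \<in> ball 0 1 then h z else l z)" for z
  have tends: "(h \<longlongrightarrow> H z) (at z within ball 0 1)" if z: "z \<in> cball 0 1" for z
  proof (cases "z \<in> ball 0 1")
    case True
    then show ?thesis using h(1) by (simp add: H_def continuous_on_def)
  next
    case False
    then have "norm z = 1" using z by simp
    then show ?thesis using l(2) False by (simp add: H_def)
  qed
  have near: "\<exists>d>0. \<forall>w\<in>ball 0 1. dist w z < d \<longrightarrow> dist (h w) (H z) < e" if z: "z \<in> cball 0 1" and "0 < e" for z e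
  proof -
    have "\<forall>\<^sub>F w in at z within ball 0 1. dist (h w) (H z) < e" using tends[OF z] \<open>0 < e\<close> by (rule tendstoD)
    then obtain d where d: "d > 0" "\<And>w. w \<in> ball 0 1 \<Longrightarrow> w \<noteq> z \<Longrightarrow> dist w z < d \<Longrightarrow> dist (h w) (H z) < e"
      unfolding eventually_at by blast
    have "dist (h w) (H z) < e" if "w \<in> ball 0 1" "dist w z < d" for w
      using d(2)[OF that(1) _ that(2)] that \<open>0 < e\<close> by (cases "w = z") (auto simp: H_def)
    then show ?thesis using d(1) by blast
  qed
  have "continuous_on (cball 0 1) H"
    unfolding continuous_on_iff
  proof (intro ballI allI impI)
    fix z :: complex and e :: real assume z: "z \<in> cball 0 1" and e: "0 < e"
    obtain d where d: "d > 0" "\<And>w. w \<in> ball 0 1 \<Longrightarrow> dist w z < d \<Longrightarrow> dist (h w) (H z) < e / 2"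
      using near[OF z, of "e / 2"] e by auto
    have "dist (H w) (H z) < e" if w: "w \<in> cball 0 1" "dist w z < d" for w
    proof -
      obtain d' where d': "d' > 0" "\<And>v. v \<in> ball 0 1 \<Longrightarrow> dist v w < d' \<Longrightarrow> dist (h v) (H w) < e / 2"
        using near[OF w(1), of "e / 2"] e by auto
      have "w \<in> closure (ball 0 1)" using w by simp
      moreover have "0 < min d' (d - dist w z)" using d' w by simp
      \<comment> \<open>An interior point near \<open>w\<close> and still within \<open>d\<close> of
        \<open>z\<close> links the two estimates of size \<open>e / 2\<close>.\<close>
      ultimately obtain v where v: "v \<in> ball 0 1" "dist v w < min d' (d - dist w z)"
        unfolding closure_approachable by blast
      have "dist v z < d" using v(2) dist_triangle[of v z w] by simp
      then have "dist (h v) (H z) < e / 2" "dist (h v) (H w) < e / 2" using d(2) d'(2) v by auto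
      then show ?thesis using dist_triangle_half_r[of "h v" "H w" e "H z"] by (simp add: dist_commute)
    qed
    then show "\<exists>d>0. \<forall>w\<in>cball 0 1. dist w z < d \<longrightarrow> dist (H w) (H z) < e" using d(1) by blast
  qed
  moreover have "H z \<in> cball 0 1 \<and> \<phi> (H z) = \<psi> z" if z: "z \<in> cball 0 1" for z
  proof (cases "z \<in> ball 0 1")
    case True
    then have "h z \<in> ball 0 1" using h(2) by blast
    then show ?thesis using True h(3) by (simp add: H_def)
  next
    case False
    then have "norm z = 1" using z by simp
    then show ?thesis using l(1,3) by (simp add: H_def)
  qed
  moreover have "H z = h z" if "z \<in> ball 0 1" for z using that by (simp add: H_def)
  ultimately show thesis by (intro that[of H]) blast+
qed

text \<open>The boundary values of the transition map are single points because the cluster set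
at a boundary point is connected and lies in a finite fibre of a polygon map.\<close>

lemma polygon_map_unique:
  fixes \<phi> \<psi> :: "complex \<Rightarrow> 'a::t2_space"
  assumes \<phi>: "polygon_map V E n \<phi> R" and \<psi>: "polygon_map V E n \<psi> R"
    and RV: "R \<inter> V = {}" "R \<inter> \<Union>E = {}" and EV: "\<Union>E \<inter> V = {}"
  obtains h h' where "homeomorphism (cball 0 1) (cball 0 1) h h'"
    "\<And>z. z \<in> cball 0 1 \<Longrightarrow> \<phi> (h z) = \<psi> z" "h ` sphere 0 1 = sphere 0 1"
proof -
  have bd: "\<phi> z \<notin> R" if \<phi>: "polygon_map V E n \<phi> R" and z: "norm z = 1" for \<phi> :: "complex \<Rightarrow> 'a" and z
    using circle_point_or_side[OF z polygon_mapD(2)[OF \<phi>]] polygon_mapD(6,7)[OF \<phi>] RV by blast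
  \<comment> \<open>A fibre over a boundary value contains at most the vertices of the n-gon and one
    point on each side, by injectivity on sides.\<close>
  have fin: "finite {z \<in> cball 0 1. \<phi> z = \<psi> p}"
    if \<phi>: "polygon_map V E n \<phi> R" and \<psi>: "polygon_map V E n \<psi> R" and p: "norm p = 1" for \<phi> \<psi> :: "complex \<Rightarrow> 'a" and p
  proof -
    have "finite {z \<in> polygon_side n k. \<phi> z = \<psi> p}" if "k < n" for k
    proof -
      have "{z \<in> polygon_side n k. \<phi> z = \<psi> p} = \<phi> -` {\<psi> p} \<inter> polygon_side n k" by blast
      then show ?thesis using finite_vimage_IntI[OF _ polygon_mapD(8)[OF \<phi> that]] by simp
    qed
    then have "finite ((\<lambda>k. circle_point n (real k)) ` {..<n} \<union> (\<Union>k<n. {z \<in> polygon_side n k. \<phi> z = \<psi> p}))"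
      by auto
    moreover have "{z \<in> cball 0 1. \<phi> z = \<psi> p}
        \<subseteq> (\<lambda>k. circle_point n (real k)) ` {..<n} \<union> (\<Union>k<n. {z \<in> polygon_side n k. \<phi> z = \<psi> p})"
    proof
      fix z assume z: "z \<in> {z \<in> cball 0 1. \<phi> z = \<psi> p}"
      then have "\<phi> z \<notin> R" using bd[OF \<psi> p] by auto
      then have "z \<notin> ball 0 1" using polygon_mapD(5)[OF \<phi>] by blast
      then have "norm z = 1" using z by simp
      then show "z \<in> (\<lambda>k. circle_point n (real k)) ` {..<n} \<union> (\<Union>k<n. {z \<in> polygon_side n k. \<phi> z = \<psi> p})"
        using circle_point_or_side[OF _ polygon_mapD(2)[OF \<phi>]] z by blast
    qed
    ultimately show ?thesis by (rule finite_subset[rotated])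
  qed
  have ext: "\<exists>H. continuous_on (cball 0 1) H \<and> H ` cball 0 1 \<subseteq> cball 0 1 \<and>
      (\<forall>z\<in>cball 0 1. \<phi> (H z) = \<psi> z) \<and> H ` ball 0 1 \<subseteq> ball 0 1"
    if \<phi>: "polygon_map V E n \<phi> R" and \<psi>: "polygon_map V E n \<psi> R" for \<phi> \<psi> :: "complex \<Rightarrow> 'a"
  proof -
    obtain g where g: "homeomorphism (ball 0 1) R \<phi> g" using \<phi> by (auto simp: polygon_map_def)
    have im: "\<psi> ` ball 0 1 = R" using polygon_mapD(5)[OF \<psi>] .
    have c\<psi>: "continuous_on (ball 0 1) \<psi>"
      using polygon_mapD(3)[OF \<psi>] ball_subset_cball by (rule continuous_on_subset)
    have 1: "continuous_on (ball 0 1) (g \<circ> \<psi>)"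
      using c\<psi> g im by (intro continuous_on_compose) (auto simp: homeomorphism_def)
    have 2: "(g \<circ> \<psi>) ` ball 0 1 \<subseteq> ball 0 1"
      unfolding image_comp[symmetric] im using g by (auto simp: homeomorphism_def)
    have 3: "\<phi> ((g \<circ> \<psi>) z) = \<psi> z" if "z \<in> ball 0 1" for z
      using g im that unfolding homeomorphism_def by (metis comp_apply imageI)
    obtain H where "continuous_on (cball 0 1) H" "H ` cball 0 1 \<subseteq> cball 0 1"
      "\<And>z. z \<in> cball 0 1 \<Longrightarrow> \<phi> (H z) = \<psi> z" "\<And>z. z \<in> ball 0 1 \<Longrightarrow> H z = (g \<circ> \<psi>) z"
      using disc_transition_extension[OF polygon_mapD(3)[OF \<phi>] polygon_mapD(3)[OF \<psi>] 1 2 3 fin[OF \<phi> \<psi>]] by metis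
    then show ?thesis using 2 by (intro exI[of _ H]) (auto simp: image_subset_iff)
  qed
  obtain h where h: "continuous_on (cball 0 1) h" "h ` cball 0 1 \<subseteq> cball 0 1"
    "\<forall>z\<in>cball 0 1. \<phi> (h z) = \<psi> z" "h ` ball 0 1 \<subseteq> ball 0 1" using ext[OF \<phi> \<psi>] by blast
  obtain h' where h': "continuous_on (cball 0 1) h'" "h' ` cball 0 1 \<subseteq> cball 0 1"
    "\<forall>z\<in>cball 0 1. \<psi> (h' z) = \<phi> z" "h' ` ball 0 1 \<subseteq> ball 0 1" using ext[OF \<psi> \<phi>] by blast
  \<comment> \<open>The identity holds on the open disk by injectivity of the polygon map there, and
    extends to the closure by continuity.\<close>
  have inverse: "f' (f z) = z"
    if f: "continuous_on (cball 0 1) f" "f ` cball 0 1 \<subseteq> cball 0 1" "\<forall>z\<in>cball 0 1. \<phi> (f z) = \<psi> z" "f ` ball 0 1 \<subseteq> ball 0 1"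
      and f': "continuous_on (cball 0 1) f'" "\<forall>z\<in>cball 0 1. \<psi> (f' z) = \<phi> z" "f' ` ball 0 1 \<subseteq> ball 0 1"
      and \<psi>: "polygon_map V E n \<psi> R" and z: "z \<in> cball 0 1" for f f' z and \<phi> \<psi> :: "complex \<Rightarrow> 'a"
  proof -
    have c: "continuous_on (closure (ball 0 1)) (\<lambda>z. f' (f z) - z)"
      using f by (auto intro!: continuous_on_diff continuous_on_id continuous_on_compose2[OF f'(1) f(1)])
    have e: "f' (f w) - w = 0" if w: "w \<in> ball 0 1" for w
    proof -
      have fw: "f w \<in> ball 0 1" using f(4) w by blast
      have "\<psi> (f' (f w)) = \<phi> (f w)" using f'(2) fw by auto
      also have "\<dots> = \<psi> w" using f(3) w by auto
      finally have "f' (f w) = w"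
        using subsetD[OF f'(3) imageI[OF fw]] w by (intro inj_onD[OF polygon_mapD(4)[OF \<psi>]])
      then show ?thesis by simp
    qed
    have "f' (f z) - z = 0"
      by (rule continuous_constant_on_closure[where f = "\<lambda>z. f' (f z) - z", OF c e]) (use z in auto)
    then show ?thesis by simp
  qed
  have i1: "h' (h z) = z" if "z \<in> cball 0 1" for z
    using inverse[OF h h'(1,3,4) \<psi> that] .
  have i2: "h (h' z) = z" if "z \<in> cball 0 1" for z
    using inverse[OF h' h(1,3,4) \<phi> that] .
  have hom: "homeomorphism (cball 0 1) (cball 0 1) h h'"
    using h h' i1 i2 by (intro homeomorphismI) auto
  have hs: "h z \<in> sphere 0 1" if z: "z \<in> sphere 0 1" for z
  proof (rule ccontr)
    assume "h z \<notin> sphere 0 1"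
    moreover have "h z \<in> cball 0 1" using h(2) z by force
    ultimately have "h z \<in> ball 0 1" by auto
    then have "h' (h z) \<in> ball 0 1" using h'(4) by blast
    then show False using i1[of z] z by auto
  qed
  have h's: "h' z \<in> sphere 0 1" if z: "z \<in> sphere 0 1" for z
  proof (rule ccontr)
    assume "h' z \<notin> sphere 0 1"
    moreover have "h' z \<in> cball 0 1" using h'(2) z by force
    ultimately have "h' z \<in> ball 0 1" by auto
    then have "h (h' z) \<in> ball 0 1" using h(4) by blast
    then show False using i2[of z] z by auto
  qed
  have "h ` sphere 0 1 = sphere 0 1"
  proof (intro subset_antisym image_subsetI subsetI hs)
    fix z :: complex assume z: "z \<in> sphere 0 1"
    show "z \<in> h ` sphere 0 1"
      using i2[of z] h's[OF z] z by (intro image_eqI[of _ h "h' z"]) auto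
  qed
  then show thesis using that[OF hom] h(3) by auto
qed

section \<open>The transition homeomorphism permutes the sides\<close>

lemma connected_subset_disjoint_open:
  assumes "connected C" "C \<noteq> {}" "C \<subseteq> (\<Union>i\<in>I. A i)" "\<And>i. i \<in> I \<Longrightarrow> open (A i)"
    and "\<And>i j. i \<in> I \<Longrightarrow> j \<in> I \<Longrightarrow> i \<noteq> j \<Longrightarrow> A i \<inter> A j \<inter> C = {}"
  shows "\<exists>i\<in>I. C \<subseteq> A i"
proof -
  obtain x i where x: "x \<in> C" "i \<in> I" "x \<in> A i" using assms by blast
  have "open (\<Union>j\<in>I - {i}. A j)" using assms(4) by auto
  moreover have "C \<subseteq> A i \<union> (\<Union>j\<in>I - {i}. A j)" using assms(3) by blast
  moreover have "A i \<inter> (\<Union>j\<in>I - {i}. A j) \<inter> C = {}" using assms(5)[OF x(2)] by blast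
  moreover have "A i \<inter> C \<noteq> {}" using x by blast
  ultimately have "(\<Union>j\<in>I - {i}. A j) \<inter> C = {}"
    using connectedD[OF assms(1) assms(4)[OF x(2)]] by blast
  then show ?thesis using x(2) assms(3) by blast
qed

lemma polygon_side_open:
  assumes "0 < n" "k < n"
  shows "polygon_side n k = sphere 0 1 \<inter> side_coord n k ` strip" "open (side_coord n k ` strip)"
proof -
  show "open (side_coord n k ` strip)"
    using assms by (intro invariance_of_domain continuous_on_side_coord open_strip inj_on_side_coord)
  show "polygon_side n k = sphere 0 1 \<inter> side_coord n k ` strip"
  proof (intro set_eqI iffI)
    fix z assume "z \<in> polygon_side n k"
    then show "z \<in> sphere 0 1 \<inter> side_coord n k ` strip"
      using polygon_side_norm[of z n k] unfolding polygon_side_eq by (auto simp: strip_iff)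
  next
    fix z assume "z \<in> sphere 0 1 \<inter> side_coord n k ` strip"
    then obtain w where w: "w \<in> strip" "z = side_coord n k w" "norm (side_coord n k w) = 1" by auto
    then have "Im w = 0"
      using norm_side_coord_le_iff[OF assms(1), of k w] norm_side_coord_less_iff[OF assms(1), of k w] by auto
    then show "z \<in> polygon_side n k"
      unfolding polygon_side_eq using w by (intro image_eqI[of _ _ "Re w"]) (auto simp: strip_iff complex_is_Real_iff)
  qed
qed

lemma side_coord_disjoint:
  assumes "0 < n" "k < n" "k' < n" "k \<noteq> k'"
  shows "side_coord n k ` strip \<inter> side_coord n k' ` strip = {}"
  using side_coord_eq_iff[OF assms(1-3)] assms(4) by blast

lemma polygon_side_not_vertex:
  assumes "polygon_map V E n \<phi> R" "\<Union>E \<inter> V = {}" "k < n" "z \<in> polygon_side n k"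
  shows "\<phi> z \<notin> V"
  using polygon_mapD(7)[OF assms(1,3)] assms(2,4) by blast

lemma connected_polygon_side: "connected (polygon_side n k)"
  unfolding polygon_side_def circle_point_def
  by (cases "n = 0") (auto intro!: connected_continuous_image continuous_intros)

lemma polygon_side_nonempty: "polygon_side n k \<noteq> {}"
  by (auto simp: polygon_side_def)

text \<open>The image of a side avoids the vertices of the n-gon, since its points are mapped into
  edges; being connected, it stays in one side. The same for the inverse gives equality.\<close>

lemma polygon_map_unique_sides:
  fixes \<phi> \<psi> :: "complex \<Rightarrow> 'a::t2_space"
  assumes \<phi>: "polygon_map V E n \<phi> R" and \<psi>: "polygon_map V E n \<psi> R"
    and RV: "R \<inter> V = {}" "R \<inter> \<Union>E = {}" and EV: "\<Union>E \<inter> V = {}"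
  obtains h h' \<pi> where "homeomorphism (cball 0 1) (cball 0 1) h h'"
    "\<And>z. z \<in> cball 0 1 \<Longrightarrow> \<phi> (h z) = \<psi> z"
    "\<And>k. k < n \<Longrightarrow> \<pi> k < n \<and> h ` polygon_side n k = polygon_side n (\<pi> k)"
proof -
  obtain h h' where h: "homeomorphism (cball 0 1) (cball 0 1) h h'"
    "\<And>z. z \<in> cball 0 1 \<Longrightarrow> \<phi> (h z) = \<psi> z" "h ` sphere 0 1 = sphere 0 1"
    using polygon_map_unique[OF assms] by metis
  note n = polygon_mapD(2)[OF \<phi>]
  have step: "\<exists>j<n. f ` polygon_side n k \<subseteq> polygon_side n j"
    if k: "k < n" and f: "continuous_on (cball 0 1) f" "f ` sphere 0 1 \<subseteq> sphere 0 1" "\<And>z. z \<in> cball 0 1 \<Longrightarrow> \<phi> (f z) = \<psi> z"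
      and \<phi>: "polygon_map V E n \<phi> R" and \<psi>: "polygon_map V E n \<psi> R" for k f and \<phi> \<psi> :: "complex \<Rightarrow> 'a"
  proof -
    have sub: "f ` polygon_side n k \<subseteq> (\<Union>j\<in>{..<n}. polygon_side n j)"
    proof
      fix w assume "w \<in> f ` polygon_side n k"
      then obtain z where z: "z \<in> polygon_side n k" "w = f z" by blast
      then have nz: "norm z = 1" using polygon_side_norm by blast
      then have "norm w = 1" using f(2) z by force
      moreover have "\<phi> w \<notin> V" using polygon_side_not_vertex[OF \<psi> EV k z(1)] f(3)[of z] z nz by simp
      ultimately show "w \<in> (\<Union>j\<in>{..<n}. polygon_side n j)"
        using circle_point_or_side[OF _ polygon_mapD(2)[OF \<phi>]] polygon_mapD(6)[OF \<phi>] by blast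
    qed
    have "\<exists>j\<in>{..<n}. f ` polygon_side n k \<subseteq> side_coord n j ` strip"
    proof (rule connected_subset_disjoint_open)
      show "connected (f ` polygon_side n k)"
        using connected_polygon_side polygon_side_norm
        by (intro connected_continuous_image continuous_on_subset[OF f(1)]) auto
      show "f ` polygon_side n k \<subseteq> (\<Union>j\<in>{..<n}. side_coord n j ` strip)"
        by (rule order.trans[OF sub UN_mono]) (use polygon_side_open(1)[OF n] in auto)
      show "f ` polygon_side n k \<noteq> {}" using polygon_side_nonempty by simp
      show "open (side_coord n i ` strip)" if "i \<in> {..<n}" for i using polygon_side_open(2)[OF n] that by simp
      show "side_coord n i ` strip \<inter> side_coord n j ` strip \<inter> f ` polygon_side n k = {}"
        if "i \<in> {..<n}" "j \<in> {..<n}" "i \<noteq> j" for i j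
        using side_coord_disjoint[OF n, of i j] that by simp
    qed
    then obtain j where j: "j < n" "f ` polygon_side n k \<subseteq> side_coord n j ` strip" by blast
    have "f ` polygon_side n k \<subseteq> f ` sphere 0 1"
      using polygon_side_norm by (intro image_mono) auto
    then have "f ` polygon_side n k \<subseteq> sphere 0 1" using f(2) by (rule order.trans)
    then have "f ` polygon_side n k \<subseteq> polygon_side n j"
      unfolding polygon_side_open(1)[OF \<open>0 < n\<close> j(1)] using j(2) by (rule Int_greatest)
    then show ?thesis using j(1) by blast
  qed
  have hc: "continuous_on (cball 0 1) h" "continuous_on (cball 0 1) h'"
    "\<And>z. z \<in> cball 0 1 \<Longrightarrow> h' (h z) = z" "\<And>z. z \<in> cball 0 1 \<Longrightarrow> h (h' z) = z" "h' ` cball 0 1 = cball 0 1"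
    using h(1) by (auto simp: homeomorphism_def)
  have h's: "h' ` sphere 0 1 \<subseteq> sphere 0 1"
  proof (rule image_subsetI)
    fix z :: complex assume "z \<in> sphere 0 1"
    then obtain w where w: "w \<in> sphere 0 1" "z = h w" using h(3) by blast
    moreover have "w \<in> cball 0 1" using w(1) sphere_cball by blast
    ultimately show "h' z \<in> sphere 0 1" using hc(3)[of w] by simp
  qed
  have h'v: "\<psi> (h' z) = \<phi> z" if "z \<in> cball 0 1" for z
  proof -
    have "h' z \<in> cball 0 1" using hc(5) that by blast
    then show ?thesis using h(2)[of "h' z"] hc(4)[OF that] by simp
  qed
  have "\<exists>j<n. h ` polygon_side n k = polygon_side n j" if k: "k < n" for k
  proof -
    obtain j where j: "j < n" "h ` polygon_side n k \<subseteq> polygon_side n j"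
      using step[OF k hc(1) _ h(2) \<phi> \<psi>] h(3) by blast
    obtain i where i: "i < n" "h' ` polygon_side n j \<subseteq> polygon_side n i"
      using step[OF j(1) hc(2) h's h'v \<psi> \<phi>] by blast
    have cb: "polygon_side n j \<subseteq> cball 0 1" for j using polygon_side_norm by fastforce
    obtain z where z: "z \<in> polygon_side n k" using polygon_side_nonempty by blast
    then have "h' (h z) \<in> polygon_side n i" using i j by blast
    then have "z \<in> polygon_side n i" using hc(3) cb z by (metis subsetD)
    \<comment> \<open>The side returned by the inverse meets the original side \<open>k\<close>, and
      distinct sides are disjoint.\<close>
    then have "i = k" using side_coord_disjoint[OF n i(1) k] polygon_side_open(1)[OF n i(1)]
        polygon_side_open(1)[OF n k] z by blast
    have "polygon_side n j \<subseteq> h ` polygon_side n k"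
    proof
      fix w assume w: "w \<in> polygon_side n j"
      then have "h' w \<in> polygon_side n k" using i \<open>i = k\<close> by blast
      moreover have "h (h' w) = w" using hc(4) cb w by blast
      ultimately show "w \<in> h ` polygon_side n k" by (metis imageI)
    qed
    then show ?thesis using j by blast
  qed
  then obtain \<pi> where "\<And>k. k < n \<Longrightarrow> \<pi> k < n \<and> h ` polygon_side n k = polygon_side n (\<pi> k)" by metis
  then show thesis using that[OF h(1,2)] by blast
qed

lemma circle_point_in_closure:
  shows "circle_point n (real k) \<in> closure (polygon_side n k)"
    "circle_point n (real k + 1) \<in> closure (polygon_side n k)"
proof -
  have "closure {real k<..<real k + 1} = {real k..real k + 1}" by (rule closure_greaterThanLessThan) simp
  moreover have "continuous_on (closure {real k<..<real k + 1}) (circle_point n)"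
    unfolding circle_point_def by (cases "n = 0") (auto intro!: continuous_intros)
  then have "circle_point n ` closure {real k<..<real k + 1} \<subseteq> closure (polygon_side n k)"
    unfolding polygon_side_def by (intro image_closure_subset) (auto simp: closure_subset)
  ultimately show "circle_point n (real k) \<in> closure (polygon_side n k)"
    "circle_point n (real k + 1) \<in> closure (polygon_side n k)" by auto
qed

text \<open>Closed opposite quadrants meet only in 0, which is off the circle; hence the closures of
  sides 0 and 2 are disjoint.\<close>

lemma circle_point_4_quadrant:
  "z \<in> closure (polygon_side 4 0) \<Longrightarrow> 0 \<le> Re z \<and> 0 \<le> Im z"
  "z \<in> closure (polygon_side 4 2) \<Longrightarrow> Re z \<le> 0 \<and> Im z \<le> 0"
proof -
  have quarter: "0 \<le> cos (2 * pi * t / 4)" "0 \<le> sin (2 * pi * t / 4)" if "0 < t" "t < 1" for t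
  proof -
    have "0 \<le> pi * t" "pi * t \<le> pi * 1" using that by (auto intro: mult_left_mono)
    then have "0 \<le> 2 * pi * t / 4" "2 * pi * t / 4 \<le> pi / 2" by linarith+
    moreover have "0 < pi" by simp
    ultimately have "0 \<le> 2 * pi * t / 4" "2 * pi * t / 4 \<le> pi / 2" "- (pi / 2) \<le> 2 * pi * t / 4"
      "2 * pi * t / 4 \<le> pi" by linarith+
    then show "0 \<le> cos (2 * pi * t / 4)" "0 \<le> sin (2 * pi * t / 4)"
      using cos_ge_zero sin_ge_zero by blast+
  qed
  have "polygon_side 4 0 \<subseteq> {z. 0 \<le> Re z} \<inter> {z. 0 \<le> Im z}"
    using quarter by (auto simp: polygon_side_def circle_point_def)
  then have "closure (polygon_side 4 0) \<subseteq> {z. 0 \<le> Re z} \<inter> {z. 0 \<le> Im z}"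
    by (rule closure_minimal) (intro closed_Int closed_halfspace_Re_ge closed_halfspace_Im_ge)
  then show "z \<in> closure (polygon_side 4 0) \<Longrightarrow> 0 \<le> Re z \<and> 0 \<le> Im z" by auto
  have "polygon_side 4 2 \<subseteq> {z. Re z \<le> 0} \<inter> {z. Im z \<le> 0}"
  proof
    fix z assume "z \<in> polygon_side 4 2"
    then obtain t where t: "2 < t" "t < 3" "z = cis (2 * pi * t / 4)" by (auto simp: polygon_side_def circle_point_def)
    have "z = - cis (2 * pi * (t - 2) / 4)"
    proof -
      have "2 * pi * t / 4 = 2 * pi * (t - 2) / 4 + pi" by (simp add: field_simps)
      then have "z = cis (2 * pi * (t - 2) / 4) * cis pi" unfolding t(3) by (simp only: cis_mult)
      then show ?thesis by simp
    qed
    moreover have "0 \<le> cos (2 * pi * (t - 2) / 4)" "0 \<le> sin (2 * pi * (t - 2) / 4)"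
      using t quarter[of "t - 2"] by auto
    ultimately show "z \<in> {z. Re z \<le> 0} \<inter> {z. Im z \<le> 0}" by simp
  qed
  then have "closure (polygon_side 4 2) \<subseteq> {z. Re z \<le> 0} \<inter> {z. Im z \<le> 0}"
    by (rule closure_minimal) (intro closed_Int closed_halfspace_Re_le closed_halfspace_Im_le)
  then show "z \<in> closure (polygon_side 4 2) \<Longrightarrow> Re z \<le> 0 \<and> Im z \<le> 0" by auto
qed

text \<open>Sides of a 4-gon are opposite when their closures are disjoint, since consecutive sides
  share a vertex. The transition homeomorphism respects this property.\<close>

lemma quadrilateral_opposite_sides:
  fixes \<phi> \<psi> :: "complex \<Rightarrow> 'a::t2_space"
  assumes \<phi>: "polygon_map V E 4 \<phi> R" and \<psi>: "polygon_map V E 4 \<psi> R"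
    and RV: "R \<inter> V = {}" "R \<inter> \<Union>E = {}" and EV: "\<Union>E \<inter> V = {}"
  shows "{\<psi> ` polygon_side 4 0, \<psi> ` polygon_side 4 2} = {\<phi> ` polygon_side 4 0, \<phi> ` polygon_side 4 2} \<or>
         {\<psi> ` polygon_side 4 0, \<psi> ` polygon_side 4 2} = {\<phi> ` polygon_side 4 1, \<phi> ` polygon_side 4 3}"
proof -
  obtain h h' \<pi> where h: "homeomorphism (cball 0 1) (cball 0 1) h h'"
    "\<And>z. z \<in> cball 0 1 \<Longrightarrow> \<phi> (h z) = \<psi> z"
    "\<And>k. k < 4 \<Longrightarrow> \<pi> k < 4 \<and> h ` polygon_side 4 k = polygon_side 4 (\<pi> k)"
    using polygon_map_unique_sides[OF assms] by metis
  have cb: "polygon_side 4 k \<subseteq> cball 0 1" for k using polygon_side_norm by fastforce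
  have im: "\<psi> ` polygon_side 4 k = \<phi> ` polygon_side 4 (\<pi> k)" if k: "k < 4" for k
  proof -
    have "\<psi> ` polygon_side 4 k = \<phi> ` (h ` polygon_side 4 k)"
      unfolding image_image
    proof (rule image_cong[OF refl])
      fix z assume "z \<in> polygon_side 4 k"
      then show "\<psi> z = \<phi> (h z)" using h(2)[of z] cb by fastforce
    qed
    then show ?thesis using h(3)[OF k] by simp
  qed
  have cl: "closure (polygon_side 4 (\<pi> k)) \<subseteq> h ` closure (polygon_side 4 k)" if k: "k < 4" for k
  proof -
    have sub: "closure (polygon_side 4 k) \<subseteq> cball 0 1" using cb by (rule closure_minimal) simp
    have "compact (h ` closure (polygon_side 4 k))"
    proof (rule compact_continuous_image)
      show "continuous_on (closure (polygon_side 4 k)) h"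
        using h(1) sub unfolding homeomorphism_def by (metis continuous_on_subset)
      show "compact (closure (polygon_side 4 k))"
        using bounded_subset[OF bounded_cball cb] by (simp add: compact_closure)
    qed
    moreover have "polygon_side 4 (\<pi> k) \<subseteq> h ` closure (polygon_side 4 k)"
      using h(3)[OF k] closure_subset by blast
    ultimately show ?thesis using closure_minimal compact_imp_closed by blast
  qed
  have disj: "closure (polygon_side 4 (\<pi> 0)) \<inter> closure (polygon_side 4 (\<pi> 2)) = {}"
  proof (rule ccontr)
    assume "\<not> ?thesis"
    then obtain w where "w \<in> closure (polygon_side 4 (\<pi> 0))" "w \<in> closure (polygon_side 4 (\<pi> 2))" by blast
    then have "w \<in> h ` closure (polygon_side 4 0)" "w \<in> h ` closure (polygon_side 4 2)"
      using subsetD[OF cl[of 0], of w] subsetD[OF cl[of 2], of w] by simp_all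
    then have "\<exists>a. a \<in> closure (polygon_side 4 0) \<and> h a = w" "\<exists>b. b \<in> closure (polygon_side 4 2) \<and> h b = w"
      by (auto simp: image_iff)
    then obtain a b where ab: "a \<in> closure (polygon_side 4 0)" "b \<in> closure (polygon_side 4 2)" "h a = w" "h b = w"
      by (elim exE conjE)
    have sph: "closure (polygon_side 4 k) \<subseteq> sphere 0 1" for k
      using polygon_side_norm by (intro closure_minimal) auto
    then have n: "norm a = 1" "norm b = 1" using ab by (auto simp: subset_iff)
    then have "h' (h a) = a" "h' (h b) = b" using h(1) by (auto simp: homeomorphism_def)
    then have "a = b" using ab by simp
    then have "a = 0" using circle_point_4_quadrant(1)[OF ab(1)] circle_point_4_quadrant(2)[OF ab(2)]
      by (auto simp: complex_eq_iff)
    then show False using n by simp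
  qed
  have four: "circle_point 4 4 = circle_point 4 0" by (simp add: circle_point_def complex_eq_iff)
  \<comment> \<open>Two indices modulo 4 that are neither equal nor consecutive form an opposite
    pair; the last two exclusions handle the wrap from 3 to 0.\<close>
  have opposite: "p = 0 \<and> q = 2 \<or> p = 2 \<and> q = 0 \<or> p = 1 \<and> q = 3 \<or> p = 3 \<and> q = 1"
    if "p < 4" "q < 4" "q \<noteq> p" "q \<noteq> Suc p" "p \<noteq> Suc q" "\<not> (q = 0 \<and> p = 3)" "\<not> (p = 0 \<and> q = 3)"
    for p q :: nat
    using that by presburger
  have "\<pi> 0 < 4" "\<pi> 2 < 4" using h(3)[of 0] h(3)[of 2] by auto
  moreover have "\<pi> 2 \<noteq> \<pi> 0" using disj circle_point_in_closure[of 4 "\<pi> 0"] by auto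
  moreover have "\<not> (\<pi> 2 = Suc (\<pi> 0))" "\<not> (\<pi> 0 = Suc (\<pi> 2))"
    using disj circle_point_in_closure(2)[of 4 "\<pi> 0"] circle_point_in_closure(1)[of 4 "\<pi> 2"]
      circle_point_in_closure(2)[of 4 "\<pi> 2"] circle_point_in_closure(1)[of 4 "\<pi> 0"] by (auto simp: add.commute)
  moreover have "\<not> (\<pi> 2 = 0 \<and> \<pi> 0 = 3)" "\<not> (\<pi> 0 = 0 \<and> \<pi> 2 = 3)"
    using disj circle_point_in_closure(2)[of 4 3] circle_point_in_closure(1)[of 4 0] four by auto
  ultimately consider "\<pi> 0 = 0 \<and> \<pi> 2 = 2" | "\<pi> 0 = 2 \<and> \<pi> 2 = 0" | "\<pi> 0 = 1 \<and> \<pi> 2 = 3" | "\<pi> 0 = 3 \<and> \<pi> 2 = 1"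
    using opposite by blast
  then show ?thesis using im[of 0] im[of 2] by cases (simp_all add: insert_commute)
qed

section \<open>Quadrilaterals in the polygon\<close>

text \<open>The map \<open>half_disc\<close> squeezes the unit disk horizontally onto its right half, fixing the
right half circle; then \<open>quad_coord n k\<close> folds the half disk onto the sector at vertex k
of the n-gon.  The vertices 1, i, -1, -i go to vertex k, the middle of side k, the center,
and the middle of the preceding side.\<close>

definition half_disc :: "complex \<Rightarrow> complex" where
  "half_disc z = Complex ((Re z + sqrt (1 - (Im z)\<^sup>2)) / 2) (Im z)"

definition quad_coord :: "nat \<Rightarrow> nat \<Rightarrow> complex \<Rightarrow> complex" where
  "quad_coord n k z =
     circle_point n (real k) * (of_real (norm (half_disc z)) * cis (2 * Arg (half_disc z) / real n))"

definition sector :: "nat \<Rightarrow> nat \<Rightarrow> complex set" where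
  "sector n k = {of_real r * circle_point n t |r t. 0 < r \<and> r < 1 \<and> \<bar>t - real k\<bar> < 1/2}"

lemma circle_point_add: "circle_point n (s + t) = circle_point n s * circle_point n t"
  by (simp add: circle_point_def cis_mult add_divide_distrib distrib_left)

lemma circle_point_period: "0 < n \<Longrightarrow> circle_point n (t - real n) = circle_point n t"
  "0 < n \<Longrightarrow> circle_point n (t + real n) = circle_point n t"
proof -
  assume "0 < n"
  then have "circle_point n (real n) = 1" by (simp add: circle_point_def complex_eq_iff)
  then show "circle_point n (t + real n) = circle_point n t" for t
    by (simp add: circle_point_add)
  from this[of "t - real n"] show "circle_point n (t - real n) = circle_point n t" by simp
qed

lemmas pi_mult_mono =
  mult_less_cancel_left_pos[OF pi_gt_zero] mult_le_cancel_left_pos[OF pi_gt_zero]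

lemma sqrt_bounds:
  assumes "norm z \<le> 1"
  shows "\<bar>Re z\<bar> \<le> sqrt (1 - (Im z)\<^sup>2)" "norm z < 1 \<Longrightarrow> \<bar>Re z\<bar> < sqrt (1 - (Im z)\<^sup>2)"
proof -
  have "(Re z)\<^sup>2 + (Im z)\<^sup>2 \<le> 1" using assms by (simp add: cmod_def)
  then show "\<bar>Re z\<bar> \<le> sqrt (1 - (Im z)\<^sup>2)" by (intro real_le_rsqrt) simp
  assume "norm z < 1"
  then have "(Re z)\<^sup>2 + (Im z)\<^sup>2 < 1" by (simp add: cmod_def)
  then show "\<bar>Re z\<bar> < sqrt (1 - (Im z)\<^sup>2)" by (intro real_less_rsqrt) simp
qed

lemma half_disc_in:
  assumes "norm z \<le> 1"
  shows "0 \<le> Re (half_disc z)" "norm (half_disc z) \<le> 1"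
    "norm z < 1 \<Longrightarrow> 0 < Re (half_disc z)" "norm z < 1 \<Longrightarrow> norm (half_disc z) < 1"
proof -
  let ?s = "sqrt (1 - (Im z)\<^sup>2)" and ?X = "(Re z + sqrt (1 - (Im z)\<^sup>2)) / 2"
  note b = sqrt_bounds[OF assms]
  have "\<bar>Im z\<bar> \<le> 1" using assms abs_Im_le_cmod[of z] by linarith
  then have s2: "?s\<^sup>2 = 1 - (Im z)\<^sup>2" by (simp add: abs_square_le_1)
  \<comment> \<open>\<open>?X\<close> is the midpoint between \<open>Re z\<close> and the right end
    of the horizontal chord through \<open>z\<close>, whose length is twice
    \<open>?s\<close>.\<close>
  have X: "0 \<le> ?X" "?X \<le> ?s" using b(1) by (simp_all add: abs_le_iff)
  show "0 \<le> Re (half_disc z)" using X by (simp add: half_disc_def)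
  have "?X\<^sup>2 \<le> ?s\<^sup>2" using X by (intro power_mono) auto
  then show "norm (half_disc z) \<le> 1" using s2 by (simp add: half_disc_def cmod_def)
  assume "norm z < 1"
  then have X': "0 < ?X" "?X < ?s" using b(2) \<open>norm z < 1\<close> by (simp_all add: abs_less_iff)
  then show "0 < Re (half_disc z)" by (simp add: half_disc_def)
  have "?X\<^sup>2 < ?s\<^sup>2" using X' by (intro power_strict_mono) auto
  then show "norm (half_disc z) < 1" using s2 by (simp add: half_disc_def cmod_def)
qed

lemma half_disc_inj: "half_disc z = half_disc w \<Longrightarrow> z = w"
  by (auto simp: half_disc_def complex_eq_iff)

lemma half_disc_surj:
  assumes "0 < Re w" "norm w < 1"
  obtains z where "norm z < 1" "half_disc z = w"
proof -
  let ?s = "sqrt (1 - (Im w)\<^sup>2)"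
  \<comment> \<open>Solution of \<open>(Re z + ?s) / 2 = Re w\<close> on the same horizontal
    chord.\<close>
  let ?z = "Complex (2 * Re w - ?s) (Im w)"
  have "\<bar>Im w\<bar> \<le> 1" using assms abs_Im_le_cmod[of w] by linarith
  then have s2: "?s\<^sup>2 = 1 - (Im w)\<^sup>2" by (simp add: abs_square_le_1)
  have "\<bar>Re w\<bar> < ?s" using sqrt_bounds(2)[of w] assms(2) by simp
  then have "\<bar>2 * Re w - ?s\<bar> < \<bar>?s\<bar>" using assms(1) by linarith
  then have "\<bar>2 * Re w - ?s\<bar>\<^sup>2 < \<bar>?s\<bar>\<^sup>2" by (rule power_strict_mono) auto
  then have "(2 * Re w - ?s)\<^sup>2 < ?s\<^sup>2" by simp
  then have "norm ?z < 1" using s2 by (simp add: cmod_def)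
  moreover have "half_disc ?z = w" by (simp add: half_disc_def complex_eq_iff)
  ultimately show thesis using that by blast
qed

lemma Arg_bounds:
  assumes "w \<noteq> 0"
  shows "0 \<le> Re w \<Longrightarrow> \<bar>Arg w\<bar> \<le> pi / 2" "0 < Re w \<Longrightarrow> \<bar>Arg w\<bar> < pi / 2"
  using Re_Ln_pos_le[OF assms] Re_Ln_pos_lt[OF assms] Arg_eq_Im_Ln[OF assms] by auto

text \<open>Measuring the argument in multiples of pi makes \<open>u\<close> directly the offset of
  the index in \<open>circle_point\<close>.\<close>

lemma right_half_polar:
  assumes "0 \<le> Re w"
  obtains u where "\<bar>u\<bar> \<le> 1/2" "w = of_real (norm w) * cis (pi * u)" "0 < Re w \<Longrightarrow> \<bar>u\<bar> < 1/2"
proof (cases "w = 0")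
  case True
  then show ?thesis using that[of 0] by auto
next
  case False
  define u where "u = Arg w / pi"
  have "\<bar>Arg w\<bar> \<le> pi / 2" using Arg_bounds[OF False] assms by blast
  then have 1: "\<bar>u\<bar> \<le> 1/2" by (simp add: u_def abs_divide divide_simps)
  have 2: "\<bar>u\<bar> < 1/2" if "0 < Re w"
    using Arg_bounds(2)[OF False that] by (simp add: u_def abs_divide divide_simps)
  have "w = of_real (norm w) * cis (pi * u)"
    using rcis_cmod_Arg[of w] by (simp add: u_def rcis_def)
  then show ?thesis using that[of u] 1 2 by blast
qed

text \<open>Arguments in the right half plane fill an interval of length pi; the factor
  \<open>2 / n\<close> shrinks it to the central angle of one side.\<close>

lemma quad_coord_polar:
  assumes "half_disc z = of_real r * cis (pi * u)" "0 \<le> r" "\<bar>u\<bar> \<le> 1/2"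
  shows "quad_coord n k z = of_real r * circle_point n (real k + u)"
proof (cases "r = 0")
  case True
  then show ?thesis using assms(1) by (simp add: quad_coord_def)
next
  case False
  have u: "- pi < pi * u" "pi * u \<le> pi"
  proof -
    have "-1 < u" "u \<le> 1" using assms(3) by linarith+
    then have "pi * (-1) < pi * u" "pi * u \<le> pi * 1" by (simp_all only: pi_mult_mono)
    then show "- pi < pi * u" "pi * u \<le> pi" by auto
  qed
  have "Arg (of_real r * cis (pi * u)) = pi * u"
    using False assms(2) u by (metis Arg_times_of_real Arg_cis greaterThanAtMost_iff le_less)
  then have "quad_coord n k z = circle_point n (real k) * (of_real r * cis (2 * (pi * u) / real n))"
    using assms(1,2) by (simp add: quad_coord_def norm_mult)
  also have "cis (2 * (pi * u) / real n) = circle_point n u" by (simp add: circle_point_def mult_ac)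
  finally show ?thesis by (simp add: circle_point_add mult_ac)
qed

lemma norm_quad_coord: "norm (quad_coord n k z) = norm (half_disc z)"
  by (simp add: quad_coord_def norm_mult)

lemma polar_eqD:
  assumes "of_real r * circle_point n t = of_real r' * circle_point n t'" "0 < r" "0 < r'" "0 < n"
  obtains N :: int where "t = t' + of_int N * real n" "r = r'"
proof -
  have "norm (of_real r * circle_point n t) = norm (of_real r' * circle_point n t')" using assms(1) by simp
  then have "r = r'" using assms(2,3) by (simp add: norm_mult)
  then have "circle_point n t = circle_point n t'" using assms(1,2) by simp
  then show thesis using circle_point_eqD[OF _ assms(4)] that \<open>r = r'\<close> by metis
qed

lemma small_multiple:
  assumes "x = of_int N * real n" "\<bar>x\<bar> < real n"
  shows "N = (0::int)"
proof (rule ccontr)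
  assume "N \<noteq> 0"
  then have "1 \<le> \<bar>real_of_int N\<bar>" by linarith
  then have "1 * real n \<le> \<bar>real_of_int N\<bar> * real n" by (rule mult_right_mono) simp
  then show False using assms by (simp add: abs_mult)
qed

lemma inj_on_quad_coord:
  assumes "3 \<le> n" shows "inj_on (quad_coord n k) (cball 0 1)"
proof (rule inj_onI)
  fix z w :: complex assume zw: "z \<in> cball 0 1" "w \<in> cball 0 1" "quad_coord n k z = quad_coord n k w"
  have h: "0 \<le> Re (half_disc z)" "0 \<le> Re (half_disc w)" using zw half_disc_in(1) by auto
  obtain u where u: "\<bar>u\<bar> \<le> 1/2" "half_disc z = of_real (norm (half_disc z)) * cis (pi * u)"
    using right_half_polar[OF h(1)] by metis
  obtain v where v: "\<bar>v\<bar> \<le> 1/2" "half_disc w = of_real (norm (half_disc w)) * cis (pi * v)"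
    using right_half_polar[OF h(2)] by metis
  have eq: "of_real (norm (half_disc z)) * circle_point n (real k + u) =
      of_real (norm (half_disc w)) * circle_point n (real k + v)"
    using zw(3) quad_coord_polar[OF u(2) norm_ge_zero u(1)] quad_coord_polar[OF v(2) norm_ge_zero v(1)] by simp
  have n: "norm (half_disc z) = norm (half_disc w)" using zw(3) norm_quad_coord by metis
  show "z = w"
  proof (cases "half_disc z = 0")
    case True
    then show ?thesis using n half_disc_inj by simp
  next
    case False
    then obtain N :: int where N: "real k + u = real k + v + of_int N * real n"
      using polar_eqD[OF eq] n assms by (metis zero_less_norm_iff norm_eq_zero gr0I not_numeral_le_zero)
    \<comment> \<open>The offsets differ by at most 1, less than the period
      \<open>n\<close>.\<close>
    have "\<bar>u - v\<bar> < real n" "u - v = of_int N * real n" using N u(1) v(1) assms by linarith+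
    then have "N = 0" using small_multiple by blast
    then have "u = v" using N by simp
    then have "half_disc z = half_disc w" using u(2) v(2) n by metis
    then show ?thesis by (rule half_disc_inj)
  qed
qed

text \<open>The argument is continuous on the closed right half plane except at 0, where the factor
  \<open>norm w\<close> forces the limit.\<close>

lemma continuous_on_quad_coord:
  assumes "0 < n" shows "continuous_on (cball 0 1) (quad_coord n k)"
proof -
  have h: "continuous_on (cball 0 1) half_disc"
    unfolding half_disc_def Complex_eq by (intro continuous_intros) auto
  have "continuous_on {w. 0 \<le> Re w} (\<lambda>w. of_real (norm w) * cis (2 * Arg w / real n))"
    unfolding continuous_on_eq_continuous_within
  proof
    fix w :: complex assume w: "w \<in> {w. 0 \<le> Re w}"
    have "isCont (\<lambda>w. of_real (norm w) * cis (2 * Arg w / real n)) w"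
    proof (cases "w = 0")
      case True
      have "((\<lambda>w. of_real (norm w) * cis (2 * Arg w / real n)) \<longlongrightarrow> 0) (at 0)"
        by (rule tendsto_norm_zero_cancel) (auto simp: norm_mult intro!: tendsto_eq_intros)
      then show ?thesis using True by (simp add: isCont_def)
    next
      case False
      then have "w \<notin> \<real>\<^sub>\<le>\<^sub>0" using w by (auto simp: complex_nonpos_Reals_iff complex_eq_iff)
      then show ?thesis using assms unfolding cis_conv_exp by (auto intro!: continuous_intros continuous_at_Arg)
    qed
    then show "continuous (at w within {w. 0 \<le> Re w}) (\<lambda>w. of_real (norm w) * cis (2 * Arg w / real n))"
      by (rule continuous_at_imp_continuous_at_within)
  qed
  then have "continuous_on (cball 0 1) (\<lambda>z. of_real (norm (half_disc z)) * cis (2 * Arg (half_disc z) / real n))"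
    by (rule continuous_on_compose2[OF _ h]) (use half_disc_in(1) in auto)
  then show ?thesis unfolding quad_coord_def by (rule continuous_on_mult[OF continuous_on_const])
qed

lemma quad_coord_ball:
  shows "quad_coord n k ` ball 0 1 = sector n k"
proof (intro subset_antisym image_subsetI subsetI)
  fix z :: complex assume z: "z \<in> ball 0 1"
  then have h: "0 < Re (half_disc z)" "norm (half_disc z) < 1" using half_disc_in(3,4)[of z] by auto
  obtain u where u: "\<bar>u\<bar> \<le> 1/2" "half_disc z = of_real (norm (half_disc z)) * cis (pi * u)" "\<bar>u\<bar> < 1/2"
    using right_half_polar[of "half_disc z"] h(1) by (metis less_imp_le)
  have "0 < norm (half_disc z)" using h(1) by auto
  then show "quad_coord n k z \<in> sector n k"
    using quad_coord_polar[OF u(2) norm_ge_zero u(1), of n k] h(2) u(3) unfolding sector_def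
    by (intro CollectI exI[of _ "norm (half_disc z)"] exI[of _ "real k + u"]) auto
next
  fix y assume "y \<in> sector n k"
  then obtain r t where rt: "y = of_real r * circle_point n t" "0 < r" "r < 1" "\<bar>t - real k\<bar> < 1/2"
    unfolding sector_def by blast
  let ?u = "t - real k"
  have "0 < cos (pi * ?u)"
  proof (rule cos_gt_zero_pi)
    have "-1/2 < ?u" "?u < 1/2" using rt(4) by linarith+
    then have "pi * (-1/2) < pi * ?u" "pi * ?u < pi * (1/2)" by (simp_all only: pi_mult_mono)
    then show "- (pi / 2) < pi * ?u" "pi * ?u < pi / 2" by auto
  qed
  then have "0 < Re (of_real r * cis (pi * ?u))" using rt(2) by simp
  moreover have "norm (of_real r * cis (pi * ?u)) < 1" using rt by (simp add: norm_mult)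
  ultimately obtain z where z: "norm z < 1" "half_disc z = of_real r * cis (pi * ?u)" by (rule half_disc_surj)
  then have "quad_coord n k z = of_real r * circle_point n (real k + ?u)"
    using rt by (intro quad_coord_polar) auto
  then have "y = quad_coord n k z" using rt(1) by simp
  then show "y \<in> quad_coord n k ` ball 0 1" using z(1) by auto
qed

section \<open>Boundary values of the quadrilateral coordinates\<close>

lemma circle_point_4: "circle_point 4 t = cis (pi * (t / 2))"
  by (simp add: circle_point_def)

text \<open>The left half circle collapses onto the vertical diameter, which
  \<open>quad_coord\<close> folds into the two radii bounding the sector.\<close>

lemma half_disc_cis:
  "0 \<le> cos x \<Longrightarrow> half_disc (cis x) = cis x"
  "cos x \<le> 0 \<Longrightarrow> half_disc (cis x) = \<i> * of_real (sin x)"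
proof -
  have "sqrt (1 - (sin x)\<^sup>2) = \<bar>cos x\<bar>" by (simp add: cos_squared_eq[symmetric])
  then show "0 \<le> cos x \<Longrightarrow> half_disc (cis x) = cis x"
    "cos x \<le> 0 \<Longrightarrow> half_disc (cis x) = \<i> * of_real (sin x)"
    by (auto simp: half_disc_def complex_eq_iff)
qed

lemma quad_coord_arc:
  assumes "-1 \<le> t" "t \<le> 1"
  shows "quad_coord n k (circle_point 4 t) = circle_point n (real k + t / 2)"
proof -
  have "-1/2 \<le> t/2" "t/2 \<le> 1/2" using assms by linarith+
  then have "pi * (-1/2) \<le> pi * (t/2)" "pi * (t/2) \<le> pi * (1/2)" by (simp_all only: pi_mult_mono)
  then have "0 \<le> cos (pi * (t / 2))" by (intro cos_ge_zero) auto
  then have "half_disc (circle_point 4 t) = of_real 1 * cis (pi * (t / 2))"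
    by (simp add: circle_point_4 half_disc_cis)
  then have "quad_coord n k (circle_point 4 t) = of_real 1 * circle_point n (real k + t / 2)"
    using assms by (intro quad_coord_polar) auto
  then show ?thesis by simp
qed

text \<open>\<open>x\<close> is the angle from the vertex -1, which goes to the center of the n-gon,
  so \<open>sin x\<close> is the distance from that center.\<close>

lemma quad_coord_radius:
  assumes "0 \<le> x" "x \<le> pi / 2"
  shows "quad_coord n k (cis (pi - x)) = of_real (sin x) * circle_point n (real k + 1/2)"
    "quad_coord n k (cis (pi + x)) = of_real (sin x) * circle_point n (real k - 1/2)"
proof -
  have c: "0 \<le> cos x" "0 \<le> sin x" using assms cos_ge_zero[of x] sin_ge_zero[of x] by auto
  have "half_disc (cis (pi - x)) = of_real (sin x) * cis (pi * (1/2))"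
    using c by (subst half_disc_cis(2)) (auto simp: cis_pi_half mult.commute)
  then show "quad_coord n k (cis (pi - x)) = of_real (sin x) * circle_point n (real k + 1/2)"
    using c by (intro quad_coord_polar) auto
  have "half_disc (cis (pi + x)) = of_real (sin x) * cis (pi * (-1/2))"
    using c by (subst half_disc_cis(2)) (auto simp: complex_eq_iff)
  then have "quad_coord n k (cis (pi + x)) = of_real (sin x) * circle_point n (real k + -1/2)"
    using c by (intro quad_coord_polar) auto
  then show "quad_coord n k (cis (pi + x)) = of_real (sin x) * circle_point n (real k - 1/2)" by simp
qed

lemma open_segment_0: "c \<noteq> (0::complex) \<Longrightarrow> open_segment 0 c = (\<lambda>r. of_real r * c) ` {0<..<1}"
  by (auto simp: in_segment scaleR_conv_of_real image_iff)

lemma sin_image_quarter: "sin ` {0<..<pi/2} = {0<..<1::real}"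
proof (intro subset_antisym image_subsetI subsetI)
  fix x :: real assume "x \<in> {0<..<pi/2}"
  then show "sin x \<in> {0<..<1}"
    using sin_monotone_2pi[of x "pi/2"] sin_gt_zero[of x] by auto
next
  fix y :: real assume y: "y \<in> {0<..<1}"
  then have "sin (arcsin y) = y" "0 < arcsin y" "arcsin y < pi / 2"
    using arcsin_less_arcsin[of 0 y] arcsin_less_arcsin[of y 1] by auto
  then show "y \<in> sin ` {0<..<pi/2}" by (metis greaterThanLessThan_iff imageI)
qed

lemma quad_coord_sides:
  "quad_coord n k ` polygon_side 4 0 = circle_point n ` {real k<..<real k + 1/2}"
  "quad_coord n k ` polygon_side 4 1 = open_segment 0 (circle_point n (real k + 1/2))"
  "quad_coord n k ` polygon_side 4 2 = open_segment 0 (circle_point n (real k - 1/2))"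
  "quad_coord n k ` polygon_side 4 3 = circle_point n ` {real k - 1/2<..<real k}"
proof -
  have ne: "circle_point n t \<noteq> 0" for t using norm_circle_point[of n t] by force
  have "quad_coord n k ` polygon_side 4 0 = (\<lambda>t. circle_point n (real k + t / 2)) ` {0<..<1}"
    unfolding polygon_side_def image_image by (intro image_cong) (auto simp: quad_coord_arc)
  also have "\<dots> = circle_point n ` ((\<lambda>t. real k + t / 2) ` {0<..<1})" by (simp add: image_image)
  also have "(\<lambda>t. real k + t / 2) ` {0<..<1} = {real k<..<real k + 1/2}"
  proof (intro subset_antisym image_subsetI subsetI)
    fix x assume "x \<in> {real k<..<real k + 1/2}"
    then show "x \<in> (\<lambda>t. real k + t / 2) ` {0<..<1}" by (intro image_eqI[of _ _ "2 * (x - real k)"]) (auto simp: field_simps)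
  qed auto
  finally show "quad_coord n k ` polygon_side 4 0 = circle_point n ` {real k<..<real k + 1/2}" .
  have "quad_coord n k ` polygon_side 4 3 = (\<lambda>t. circle_point n (real k + (t - 4) / 2)) ` {3<..<4}"
    unfolding polygon_side_def image_image
  proof (rule image_cong)
    fix t :: real assume t: "t \<in> {3<..<4}"
    \<comment> \<open>The shift by one period brings side 3 into the range from -1 to 1 required by
      \<open>quad_coord_arc\<close>.\<close>
    have "circle_point 4 t = circle_point 4 (t - 4)" using circle_point_period(1)[of 4 t] by simp
    then show "quad_coord n k (circle_point 4 t) = circle_point n (real k + (t - 4) / 2)"
      using t by (simp add: quad_coord_arc)
  qed simp
  also have "\<dots> = circle_point n ` ((\<lambda>t. real k + (t - 4) / 2) ` {3<..<4})" by (simp add: image_image)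
  also have "(\<lambda>t. real k + (t - 4) / 2) ` {3<..<4} = {real k - 1/2<..<real k}"
  proof (intro subset_antisym image_subsetI subsetI)
    fix x assume "x \<in> {real k - 1/2<..<real k}"
    then show "x \<in> (\<lambda>t. real k + (t - 4) / 2) ` {3<..<4}" by (intro image_eqI[of _ _ "2 * (x - real k) + 4"]) (auto simp: field_simps)
  qed auto
  finally show "quad_coord n k ` polygon_side 4 3 = circle_point n ` {real k - 1/2<..<real k}" .
  have s1: "polygon_side 4 1 = (\<lambda>x. cis (pi - x)) ` {0<..<pi/2}"
  proof (intro subset_antisym image_subsetI subsetI)
    fix z assume "z \<in> polygon_side 4 1"
    then obtain t where t: "1 < t" "t < 2" "z = cis (pi * (t / 2))" by (auto simp: polygon_side_def circle_point_4)
    have "0 < 1 - t/2" "1 - t/2 < 1/2" using t by linarith+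
    then have "pi * 0 < pi * (1 - t/2)" "pi * (1 - t/2) < pi * (1/2)" by (simp_all only: pi_mult_mono)
    then show "z \<in> (\<lambda>x. cis (pi - x)) ` {0<..<pi/2}"
      using t by (intro image_eqI[of _ _ "pi * (1 - t/2)"]) (auto simp: algebra_simps)
  next
    fix x :: real assume x: "x \<in> {0<..<pi/2}"
    have "pi * ((2 - 2 * x / pi) / 2) = pi - x" by (simp add: diff_divide_distrib right_diff_distrib)
    then have "cis (pi - x) = circle_point 4 (2 - 2 * x / pi)" by (simp only: circle_point_4)
    moreover have "2 - 2 * x / pi \<in> {real 1<..<real 1 + 1}" using x by (auto simp: field_simps)
    ultimately show "cis (pi - x) \<in> polygon_side 4 1" unfolding polygon_side_def by blast
  qed
  have s2: "polygon_side 4 2 = (\<lambda>x. cis (pi + x)) ` {0<..<pi/2}"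
  proof (intro subset_antisym image_subsetI subsetI)
    fix z assume "z \<in> polygon_side 4 2"
    then obtain t where t: "2 < t" "t < 3" "z = cis (pi * (t / 2))" by (auto simp: polygon_side_def circle_point_4)
    have "0 < t/2 - 1" "t/2 - 1 < 1/2" using t by linarith+
    then have "pi * 0 < pi * (t/2 - 1)" "pi * (t/2 - 1) < pi * (1/2)" by (simp_all only: pi_mult_mono)
    then show "z \<in> (\<lambda>x. cis (pi + x)) ` {0<..<pi/2}"
      using t by (intro image_eqI[of _ _ "pi * (t/2 - 1)"]) (auto simp: algebra_simps)
  next
    fix x :: real assume x: "x \<in> {0<..<pi/2}"
    have "pi * ((2 + 2 * x / pi) / 2) = pi + x" by (simp add: add_divide_distrib distrib_left)
    then have "cis (pi + x) = circle_point 4 (2 + 2 * x / pi)" by (simp only: circle_point_4)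
    moreover have "2 + 2 * x / pi \<in> {real 2<..<real 2 + 1}" using x by (auto simp: field_simps)
    ultimately show "cis (pi + x) \<in> polygon_side 4 2" unfolding polygon_side_def by blast
  qed
  have "quad_coord n k ` polygon_side 4 1 = (\<lambda>r. of_real r * circle_point n (real k + 1/2)) ` (sin ` {0<..<pi/2})"
    unfolding s1 image_image by (intro image_cong) (auto simp: quad_coord_radius)
  then show "quad_coord n k ` polygon_side 4 1 = open_segment 0 (circle_point n (real k + 1/2))"
    unfolding sin_image_quarter open_segment_0[OF ne] .
  have "quad_coord n k ` polygon_side 4 2 = (\<lambda>r. of_real r * circle_point n (real k - 1/2)) ` (sin ` {0<..<pi/2})"
    unfolding s2 image_image by (intro image_cong) (auto simp: quad_coord_radius)
  then show "quad_coord n k ` polygon_side 4 2 = open_segment 0 (circle_point n (real k - 1/2))"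
    unfolding sin_image_quarter open_segment_0[OF ne] .
qed

lemma quad_coord_vertices:
  "quad_coord n k (circle_point 4 0) = circle_point n (real k)"
  "quad_coord n k (circle_point 4 1) = circle_point n (real k + 1/2)"
  "quad_coord n k (circle_point 4 2) = 0"
  "quad_coord n k (circle_point 4 3) = circle_point n (real k - 1/2)"
proof -
  show "quad_coord n k (circle_point 4 0) = circle_point n (real k)"
    "quad_coord n k (circle_point 4 1) = circle_point n (real k + 1/2)"
    using quad_coord_arc[of 0 n k] quad_coord_arc[of 1 n k] by auto
  show "quad_coord n k (circle_point 4 2) = 0"
    using quad_coord_radius(1)[of 0 n k] by (simp add: circle_point_4)
  have "circle_point 4 3 = circle_point 4 (-1)" using circle_point_period(1)[of 4 3] by simp
  then show "quad_coord n k (circle_point 4 3) = circle_point n (real k - 1/2)"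
    using quad_coord_arc[of "-1" n k] by simp
qed

section \<open>Decomposition of the open disk into center, radii and sectors\<close>

lemma ball_polar:
  assumes "z \<noteq> 0" "0 < n"
  obtains t where "0 \<le> t" "t < real n" "z = of_real (norm z) * circle_point n t"
proof
  define t where "t = Arg2pi z * real n / (2 * pi)"
  show "0 \<le> Arg2pi z * real n / (2 * pi)" "Arg2pi z * real n / (2 * pi) < real n"
    using Arg2pi[of z] assms by (auto simp: divide_simps)
  show "z = of_real (norm z) * circle_point n (Arg2pi z * real n / (2 * pi))"
    using Arg2pi[of z] assms by (simp add: circle_point_def cis_conv_exp mult.commute is_Arg_def)
qed

text \<open>The angular coordinate is rounded to the nearest integer \<open>j\<close>; a tie is a
  point on the radius to the middle of a side.\<close>

lemma ball_cases:
  assumes "norm z < 1" "0 < n"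
  shows "z = 0 \<or> (\<exists>k<n. z \<in> open_segment 0 (side_middle n k)) \<or> (\<exists>k<n. z \<in> sector n k)"
proof (cases "z = 0")
  case False
  then obtain t where t: "0 \<le> t" "t < real n" "z = of_real (norm z) * circle_point n t"
    using ball_polar[OF _ assms(2)] by metis
  have ne: "circle_point n t \<noteq> 0" for t using norm_circle_point[of n t] by force
  define j where "j = nat \<lfloor>t + 1/2\<rfloor>"
  have j: "real j \<le> t + 1/2" "t + 1/2 < real j + 1" using t(1) by (auto simp: j_def)
  show ?thesis
  proof (cases "real j = t + 1/2")
    case True
    then have "0 < j" "j - 1 < n" using t by linarith+
    then have "t = real (j - 1) + 1/2" using True by simp
    then have "z \<in> open_segment 0 (side_middle n (j - 1))"
      unfolding side_middle_def open_segment_0[OF ne] using t(3) False assms(1)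
      by (intro image_eqI[of _ _ "norm z"]) auto
    then show ?thesis using \<open>j - 1 < n\<close> by blast
  next
    case F: False
    then have tj: "\<bar>t - real j\<bar> < 1/2" using j by linarith
    show ?thesis
    proof (cases "j < n")
      case True
      have "z \<in> sector n j" unfolding sector_def
        using t(3) False assms(1) tj by (intro CollectI exI[of _ "norm z"] exI[of _ t]) auto
      then show ?thesis using True by blast
    next
      \<comment> \<open>Angles beyond the middle of the last side round up to \<open>n\<close> and
        belong to the sector at vertex 0.\<close>
      case F2: False
      then have "j = n" using j t(2) by linarith
      have "z = of_real (norm z) * circle_point n (t - real n)"
        using t(3) circle_point_period(1)[OF assms(2)] by simp
      then have "z \<in> sector n 0" unfolding sector_def
        using False assms(1) tj \<open>j = n\<close> by (intro CollectI exI[of _ "norm z"] exI[of _ "t - real n"]) auto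
      then show ?thesis using assms(2) by blast
    qed
  qed
qed simp

lemma sector_subset: "sector n k \<subseteq> ball 0 1 - {0}"
proof
  fix z assume "z \<in> sector n k"
  then obtain r t where "z = of_real r * circle_point n t" "0 < r" "r < 1" unfolding sector_def by blast
  moreover have "circle_point n t \<noteq> 0" using norm_circle_point[of n t] by force
  ultimately show "z \<in> ball 0 1 - {0}" by (simp add: norm_mult)
qed

lemma segment_polar:
  assumes "z \<in> open_segment 0 (side_middle n k)"
  obtains r where "0 < r" "r < 1" "z = of_real r * circle_point n (real k + 1/2)"
proof -
  have "circle_point n (real k + 1/2) \<noteq> 0" using norm_circle_point[of n "real k + 1/2"] by force
  then show thesis using assms that by (auto simp: side_middle_def open_segment_0)
qed

lemma sector_disjoint:
  assumes "k < n" "k' < n" "z \<in> sector n k" "z \<in> sector n k'" shows "k = k'"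
proof -
  obtain r t r' t' where *: "z = of_real r * circle_point n t" "0 < r" "\<bar>t - real k\<bar> < 1/2"
    "z = of_real r' * circle_point n t'" "0 < r'" "\<bar>t' - real k'\<bar> < 1/2"
    using assms(3,4) unfolding sector_def by blast
  then obtain N :: int where N: "t = t' + of_int N * real n"
    using polar_eqD[of r n t r' t'] assms(1) by (metis gr_implies_not0 gr0I)
  have "\<bar>real k - real k' - of_int N * real n\<bar> < 1" using * N by linarith
  moreover have "real k - real k' - of_int N * real n = of_int (int k - int k' - N * int n)" by simp
  ultimately have "\<bar>int k - int k' - N * int n\<bar> < 1" by linarith
  then have "int k - int k' = N * int n" by linarith
  then have "real k - real k' = of_int N * real n"
    by (metis of_int_diff of_int_mult of_int_of_nat_eq)
  then have "N = 0" using assms(1,2) by (intro small_multiple[of "real k - real k'" N n]) auto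
  then show ?thesis using \<open>int k - int k' = N * int n\<close> by simp
qed

lemma sector_segment_disjoint:
  assumes "k < n" "z \<in> sector n k" "z \<in> open_segment 0 (side_middle n j)" shows False
proof -
  obtain r t where *: "z = of_real r * circle_point n t" "0 < r" "\<bar>t - real k\<bar> < 1/2"
    using assms(2) unfolding sector_def by blast
  obtain r' where r': "0 < r'" "z = of_real r' * circle_point n (real j + 1/2)" using assms(3) by (rule segment_polar)
  then obtain N :: int where N: "t = real j + 1/2 + of_int N * real n"
    using polar_eqD[of r n t r' "real j + 1/2"] * assms(1) by (metis gr_implies_not0 gr0I)
  \<comment> \<open>The radius has a half-integral angle and the sector only angles closer than 1/2
    to an integer, which would leave an integer strictly between -1 and 0.\<close>
  have "- 1 < real j + of_int N * real n - real k" "real j + of_int N * real n - real k < 0" using * N by linarith+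
  moreover have "real j + of_int N * real n - real k = of_int (int j + N * int n - int k)" by simp
  ultimately have "-1 < int j + N * int n - int k" "int j + N * int n - int k < 0" by linarith+
  then show False by linarith
qed

lemma segment_disjoint:
  assumes "k < n" "k' < n" "z \<in> open_segment 0 (side_middle n k)" "z \<in> open_segment 0 (side_middle n k')"
  shows "k = k'"
proof -
  obtain r where r: "0 < r" "z = of_real r * circle_point n (real k + 1/2)" using assms(3) by (rule segment_polar)
  obtain r' where r': "0 < r'" "z = of_real r' * circle_point n (real k' + 1/2)" using assms(4) by (rule segment_polar)
  obtain N :: int where N: "real k + 1/2 = real k' + 1/2 + of_int N * real n"
    using polar_eqD[of r n "real k + 1/2" r' "real k' + 1/2"] r r' assms(1) by (metis gr_implies_not0 gr0I)
  have "N = 0" using N assms(1,2) by (intro small_multiple[of "real k - real k'" N n]) auto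
  then show ?thesis using N by simp
qed

section \<open>The tiles of the quadrilateral subdivision\<close>

text \<open>Each member is closed as well as open, since its complement is the union of the other
  members; a larger connected set would be split by it.\<close>

lemma components_openin_unique:
  assumes "pairwise disjnt A" "\<Union>A = X"
    and A: "\<And>C. C \<in> A \<Longrightarrow> openin (top_of_set X) C \<and> connected C \<and> C \<noteq> {}"
  shows "components X = A"
proof -
  have comp: "C \<in> components X" if C: "C \<in> A" for C
    unfolding in_components_maximal
  proof (intro conjI allI impI)
    show "C \<noteq> {}" "connected C" using A[OF C] by auto
    show "C \<subseteq> X" using assms(2) C by blast
    fix D assume D: "D \<noteq> {} \<and> C \<subseteq> D \<and> D \<subseteq> X \<and> connected D"
    have "openin (top_of_set X) (\<Union>(A - {C}))" using A by (intro openin_Union) auto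
    moreover have "X - C = \<Union>(A - {C})"
    proof -
      have "K \<inter> C = {}" if "K \<in> A - {C}" for K
        using assms(1) C that by (auto simp: pairwise_def disjnt_def)
      then show ?thesis using assms(2) C by blast
    qed
    ultimately have "closedin (top_of_set X) C"
      using \<open>C \<subseteq> X\<close> by (simp add: closedin_def)
    then have "closedin (top_of_set D) C" "openin (top_of_set D) C"
      using D A[OF C] by (auto intro: closedin_subset_trans openin_subset_trans)
    then show "D = C" using D A[OF C] connected_clopen by blast
  qed
  moreover have "K \<in> A" if K: "K \<in> components X" for K
  proof -
    obtain x where x: "x \<in> K" using in_components_nonempty[OF K] by blast
    then obtain C where C: "C \<in> A" "x \<in> C" using in_components_subset[OF K] assms(2) by blast
    then have "K = C" using components_nonoverlap[OF K comp[OF C(1)]] x by blast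
    then show ?thesis using C(1) by simp
  qed
  ultimately show ?thesis by blast
qed

lemma param_homeomorphism:
  assumes "closed_surface S" "surface_param S A \<gamma>"
  shows "homeomorphism A (\<gamma> ` A) \<gamma> (inv_into A \<gamma>)"
  using chartD(4)[OF chart_inv_param[OF assms]] surface_paramD[OF assms(2)]
  by (auto simp: homeomorphism_def)

lemma open_sector: "3 \<le> n \<Longrightarrow> open (sector n k)"
  unfolding quad_coord_ball[symmetric]
  by (intro invariance_of_domain continuous_on_subset[OF continuous_on_quad_coord ball_subset_cball]
      inj_on_subset[OF inj_on_quad_coord ball_subset_cball]) auto

lemma connected_sector: "0 < n \<Longrightarrow> connected (sector n k)"
  unfolding quad_coord_ball[symmetric]
  by (intro connected_continuous_image continuous_on_subset[OF continuous_on_quad_coord ball_subset_cball]) auto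

lemma sector_nonempty: "sector n k \<noteq> {}"
  unfolding quad_coord_ball[symmetric] by simp

lemma quad_coord_cball: "z \<in> cball 0 1 \<Longrightarrow> quad_coord n k z \<in> cball 0 1"
  using half_disc_in(2)[of z] by (simp add: norm_quad_coord)

lemma open_segment_side_middle_subset: "open_segment 0 (side_middle n k) \<subseteq> ball 0 1 - {0}"
proof
  fix z assume "z \<in> open_segment 0 (side_middle n k)"
  then obtain r where r: "0 < r" "r < 1" "z = of_real r * circle_point n (real k + 1/2)" by (rule segment_polar)
  moreover have "circle_point n (real k + 1/2) \<noteq> 0" using norm_circle_point[of n "real k + 1/2"] by force
  ultimately show "z \<in> ball 0 1 - {0}" by (simp add: norm_mult)
qed

locale quadrilateral_tiling = polygonal_tiling S V E n \<Phi>
  for S :: "'a::t2_space set" and V and E and n :: "'a set \<Rightarrow> nat" and \<Phi> :: "'a set \<Rightarrow> complex \<Rightarrow> 'a" +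
  fixes m :: "'a set \<Rightarrow> 'a"
  assumes m_in: "\<And>e. e \<in> E \<Longrightarrow> m e \<in> e"
    and m_side: "\<And>R k. R \<in> tiles S V E \<Longrightarrow> k < n R \<Longrightarrow>
      \<Phi> R (side_middle (n R) k) = m (\<Phi> R ` polygon_side (n R) k)"
begin

definition V4 :: "'a set" where
  "V4 = V \<union> m ` E \<union> (\<lambda>R. \<Phi> R 0) ` tiles S V E"

definition E4 :: "'a set set" where
  "E4 = half_edges m E \<union>
     {\<Phi> R ` open_segment 0 (side_middle (n R) k) | R k. R \<in> tiles S V E \<and> k < n R}"

text \<open>The order of the halves belongs to the side, not to the edge: it follows the direction
  of the tile coordinates.\<close>

definition first_half :: "'a set \<times> nat \<Rightarrow> 'a set" where
  "first_half s = (\<lambda>t. collar s (of_real t)) ` {0<..<1/2}"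

definition second_half :: "'a set \<times> nat \<Rightarrow> 'a set" where
  "second_half s = (\<lambda>t. collar s (of_real t)) ` {1/2<..<1}"

definition spoke :: "'a set \<times> nat \<Rightarrow> 'a set" where
  "spoke s = \<Phi> (fst s) ` open_segment 0 (side_middle (n (fst s)) (snd s))"

definition quad :: "'a set \<times> nat \<Rightarrow> 'a set" where
  "quad s = \<Phi> (fst s) ` sector (n (fst s)) (snd s)"

definition prev_side :: "'a set \<times> nat \<Rightarrow> 'a set \<times> nat" where
  "prev_side s = (fst s, if snd s = 0 then n (fst s) - 1 else snd s - 1)"

definition next_side :: "'a set \<times> nat \<Rightarrow> 'a set \<times> nat" where
  "next_side s = (fst s, if Suc (snd s) = n (fst s) then 0 else Suc (snd s))"

lemma side_cycle:
  assumes "s \<in> sides"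
  shows "prev_side s \<in> sides" "next_side s \<in> sides" "prev_side (next_side s) = s" "next_side (prev_side s) = s"
    "fst (prev_side s) = fst s" "fst (next_side s) = fst s"
  using assms by (auto simp: sides_def prev_side_def next_side_def)

lemma m_collar: "s \<in> sides \<Longrightarrow> collar s (of_real (1/2)) = m (side_edge s)"
  using m_side[OF sidesD(1,2)] unfolding collar_def side_edge_def side_coord_of_real side_middle_def .

text \<open>The continuous parameter of the edge separates the points below 1/2 from those above,
  which makes both intervals open in the punctured edge.\<close>

lemma halves:
  assumes s: "s \<in> sides"
  shows "components (side_edge s - {m (side_edge s)}) = {first_half s, second_half s}"
    "first_half s \<subseteq> side_edge s" "second_half s \<subseteq> side_edge s"
    "first_half s \<inter> second_half s = {}" "first_half s \<noteq> {}" "second_half s \<noteq> {}"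
proof -
  let ?c = "\<lambda>t. collar s (of_real t)" and ?X = "side_edge s - {m (side_edge s)}"
  note inj = inj_on_collar_real[OF s]
  have cont: "continuous_on {0<..<1} ?c"
    by (rule continuous_on_compose2[OF continuous_on_collar[OF s]])
      (use of_real_half_strip in \<open>auto intro!: continuous_intros\<close>)
  have pc: "side_parameter s (?c t) = t" if "0 < t" "t < 1" for t
    unfolding side_parameter_def using that by (intro inv_into_f_f[OF inj]) auto
  show sub: "first_half s \<subseteq> side_edge s" "second_half s \<subseteq> side_edge s"
    unfolding first_half_def second_half_def side_edge_collar by (intro image_mono; auto)+
  show disj: "first_half s \<inter> second_half s = {}"
  proof (rule ccontr)
    assume "\<not> ?thesis"
    then obtain t u where tu: "0 < t" "t < 1/2" "1/2 < u" "u < 1" "?c t = ?c u"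
      unfolding first_half_def second_half_def by fastforce
    then have "t = u" using pc[of t] pc[of u] by simp
    then show False using tu by simp
  qed
  show ne: "first_half s \<noteq> {}" "second_half s \<noteq> {}" by (auto simp: first_half_def second_half_def)
  have X: "?X = ?c ` ({0<..<1} - {1/2})"
  proof -
    have "?c ` ({0<..<1} - {1/2}) = ?c ` {0<..<1} - ?c ` {1/2}"
      by (intro inj_on_image_set_diff[OF inj]) auto
    then show ?thesis using m_collar[OF s] by (simp add: side_edge_collar)
  qed
  have U: "first_half s \<union> second_half s = ?X"
  proof -
    have "{0<..<1/2} \<union> {1/2<..<1} = {0<..<1} - {1/2::real}" by auto
    then show ?thesis unfolding X first_half_def second_half_def by (metis image_Un)
  qed
  have pX: "continuous_on ?X (side_parameter s)"
    using continuous_on_side_parameter[OF s] by (rule continuous_on_subset) auto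
  have F: "first_half s = ?X \<inter> side_parameter s -` {..<1/2}"
    unfolding X first_half_def using pc by (auto simp: image_iff)
  have G: "second_half s = ?X \<inter> side_parameter s -` {1/2<..}"
    unfolding X second_half_def using pc by (auto simp: image_iff)
  have "openin (top_of_set ?X) (first_half s)" "openin (top_of_set ?X) (second_half s)"
    unfolding F G by (intro continuous_openin_preimage_gen[OF pX]; simp)+
  moreover have "connected (first_half s)" "connected (second_half s)"
    unfolding first_half_def second_half_def
    by (intro connected_continuous_image continuous_on_subset[OF cont]; auto)+
  moreover have "first_half s \<noteq> second_half s" using disj ne by blast
  ultimately show "components ?X = {first_half s, second_half s}"
    using disj ne U by (intro components_openin_unique) (auto simp: pairwise_def disjnt_def)
qed

lemma half_edges_eq: "half_edges m E = first_half ` sides \<union> second_half ` sides"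
proof -
  have "components (e - {m e}) \<subseteq> first_half ` sides \<union> second_half ` sides" if e: "e \<in> E" for e
  proof -
    obtain s where "s \<in> sides" "side_edge s = e" using edge_two_sides[OF e] by metis
    then show ?thesis using halves(1)[of s] by blast
  qed
  moreover have "first_half s \<in> half_edges m E" "second_half s \<in> half_edges m E" if "s \<in> sides" for s
    unfolding half_edges_def using halves(1)[OF that] side_edge_in[OF that] by auto
  ultimately show ?thesis unfolding half_edges_def by blast
qed

lemma spokes_eq: "{\<Phi> R ` open_segment 0 (side_middle (n R) k) | R k. R \<in> tiles S V E \<and> k < n R} = spoke ` sides"
  by (force simp: spoke_def sides_def)

lemma E4_eq: "E4 = first_half ` sides \<union> second_half ` sides \<union> spoke ` sides"
  unfolding E4_def half_edges_eq spokes_eq ..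

text \<open>Both parametrizations take 1/2 to the middle point, so \<open>side_change\<close> fixes
  1/2. As the halves are components of the same set, one test point in each, at 1/4 and 3/4, decides
  which of them coincide.\<close>

lemma halves_change:
  assumes s: "s \<in> sides" "s' \<in> sides" "side_edge s = side_edge s'"
  shows "strict_antimono_on {0<..<1} (side_change s s') \<Longrightarrow> first_half s = second_half s' \<and> second_half s = first_half s'"
    "\<not> strict_antimono_on {0<..<1} (side_change s s') \<Longrightarrow> first_half s = first_half s' \<and> second_half s = second_half s'"
proof -
  let ?h = "side_change s s'"
  note ch = side_change[OF s]
  have "collar s' (of_real (?h (1/2))) = collar s' (of_real (1/2))"
    using ch(2)[of "1/2"] m_collar[OF s(1)] m_collar[OF s(2)] s(3) by simp
  then have half: "?h (1/2) = 1/2"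
    using ch(1)[of "1/2"] by (intro inj_onD[OF inj_on_collar_real[OF s(2)]]) auto
  have eqI: "A = B" if "A \<in> {first_half s, second_half s}" "B \<in> {first_half s', second_half s'}" "x \<in> A" "x \<in> B" for A B x
    using components_nonoverlap[of A "side_edge s - {m (side_edge s)}" B] halves(1)[OF s(1)] halves(1)[OF s(2)] s(3) that
    by auto
  have quarter: "collar s (of_real t) = collar s' (of_real (?h t))" "?h t \<in> {0<..<1}" if "t \<in> {1/4, 3/4}" for t
    using ch(1,2)[of t] that by auto
  have "collar s (of_real (1/4)) \<in> first_half s" "collar s (of_real (3/4)) \<in> second_half s"
    unfolding first_half_def second_half_def by (intro imageI; simp)+
  with quarter have q1: "collar s (of_real (1/4)) \<in> first_half s"
      "collar s (of_real (1/4)) = collar s' (of_real (?h (1/4)))" "?h (1/4) \<in> {0<..<1}"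
    and q3: "collar s (of_real (3/4)) \<in> second_half s"
      "collar s (of_real (3/4)) = collar s' (of_real (?h (3/4)))" "?h (3/4) \<in> {0<..<1}"
    by blast+
  show "first_half s = second_half s' \<and> second_half s = first_half s'" if a: "strict_antimono_on {0<..<1} ?h"
  proof -
    have "?h (1/2) < ?h (1/4)" "?h (3/4) < ?h (1/2)" using a by (auto simp: monotone_on_def)
    then have "collar s' (of_real (?h (1/4))) \<in> second_half s'" "collar s' (of_real (?h (3/4))) \<in> first_half s'"
      unfolding first_half_def second_half_def using half q1(3) q3(3) by (intro imageI; simp)+
    then show ?thesis using eqI q1(1,2) q3(1,2) by (metis insertCI)
  qed
  show "first_half s = first_half s' \<and> second_half s = second_half s'" if a: "\<not> strict_antimono_on {0<..<1} ?h"
  proof -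
    have "?h (1/4) < ?h (1/2)" "?h (1/2) < ?h (3/4)" using a ch(5) by (auto simp: monotone_on_def)
    then have "collar s' (of_real (?h (1/4))) \<in> first_half s'" "collar s' (of_real (?h (3/4))) \<in> second_half s'"
      unfolding first_half_def second_half_def using half q1(3) q3(3) by (intro imageI; simp)+
    then show ?thesis using eqI q1(1,2) q3(1,2) by (metis insertCI)
  qed
qed

lemma half_image:
  "first_half s = \<Phi> (fst s) ` circle_point (n (fst s)) ` {real (snd s)<..<real (snd s) + 1/2}"
  "second_half s = \<Phi> (fst s) ` circle_point (n (fst s)) ` {real (snd s) + 1/2<..<real (snd s) + 1}"
proof -
  have 1: "{real k<..<real k + 1/2} = (\<lambda>t. real k + t) ` {0<..<1/2}"
    "{real k + 1/2<..<real k + 1} = (\<lambda>t. real k + t) ` {1/2<..<1}" for k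
    by (auto simp: image_iff intro!: bexI[of _ "_ - real k"])
  show "first_half s = \<Phi> (fst s) ` circle_point (n (fst s)) ` {real (snd s)<..<real (snd s) + 1/2}"
    "second_half s = \<Phi> (fst s) ` circle_point (n (fst s)) ` {real (snd s) + 1/2<..<real (snd s) + 1}"
    unfolding 1 first_half_def second_half_def collar_def side_coord_of_real by (simp_all add: image_image)
qed

lemma prev_circle_point:
  assumes "s \<in> sides"
  shows "circle_point (n (fst s)) (real (snd s) - t) = circle_point (n (fst s)) (real (snd (prev_side s)) + (1 - t))"
proof (cases "snd s = 0")
  case True
  note n = sidesD(4)[OF assms]
  have "circle_point (n (fst s)) (real (snd (prev_side s)) + (1 - t)) = circle_point (n (fst s)) (- t + real (n (fst s)))"
    using True n by (intro arg_cong[of _ _ "circle_point (n (fst s))"]) (simp add: prev_side_def of_nat_diff)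
  also have "\<dots> = circle_point (n (fst s)) (- t)" by (rule circle_point_period(2)[OF n])
  finally show ?thesis using True by simp
next
  case False
  then show ?thesis by (simp add: prev_side_def of_nat_diff)
qed

lemma second_half_prev:
  assumes "s \<in> sides"
  shows "\<Phi> (fst s) ` circle_point (n (fst s)) ` {real (snd s) - 1/2<..<real (snd s)} = second_half (prev_side s)"
proof -
  have 1: "{real k - 1/2<..<real k} = (\<lambda>t. real k - t) ` {0<..<1/2}" for k
    by (auto simp: image_iff intro!: bexI[of _ "real k - _"])
  have 2: "{real k + 1/2<..<real k + 1} = (\<lambda>t. real k + (1 - t)) ` {0<..<1/2}" for k
    by (auto simp: image_iff intro!: bexI[of _ "real k + 1 - _"])
  show ?thesis
    unfolding half_image 1 2 image_image side_cycle(5)[OF assms] prev_circle_point[OF assms] ..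
qed

definition quad_map :: "'a set \<times> nat \<Rightarrow> complex \<Rightarrow> 'a" where
  "quad_map s z = \<Phi> (fst s) (quad_coord (n (fst s)) (snd s) z)"

text \<open>The two half edges are consecutive and so are the two spokes. Hence a pair of opposite
  edges consists of one half edge and one spoke: either \<open>first_half s\<close> with the spoke
  of the preceding side, or \<open>spoke s\<close> with the second half of the preceding
  side.\<close>

lemma quad_map_sides:
  assumes "s \<in> sides"
  shows "quad_map s ` polygon_side 4 0 = first_half s" "quad_map s ` polygon_side 4 1 = spoke s"
    "quad_map s ` polygon_side 4 2 = spoke (prev_side s)" "quad_map s ` polygon_side 4 3 = second_half (prev_side s)"
proof -
  have im: "quad_map s ` A = \<Phi> (fst s) ` (quad_coord (n (fst s)) (snd s) ` A)" for A
    by (simp add: quad_map_def image_image)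
  show "quad_map s ` polygon_side 4 0 = first_half s" "quad_map s ` polygon_side 4 1 = spoke s"
    unfolding im quad_coord_sides half_image spoke_def side_middle_def by simp_all
  show "quad_map s ` polygon_side 4 2 = spoke (prev_side s)"
    unfolding im quad_coord_sides spoke_def side_middle_def side_cycle(5)[OF assms] prev_circle_point[OF assms] by simp
  show "quad_map s ` polygon_side 4 3 = second_half (prev_side s)"
    unfolding im quad_coord_sides second_half_prev[OF assms] ..
qed

section \<open>Disjointness of the pieces and the tiles of T(4)\<close>

lemma Phi_inj:
  "R \<in> tiles S V E \<Longrightarrow> R' \<in> tiles S V E \<Longrightarrow> z \<in> ball 0 1 \<Longrightarrow> z' \<in> ball 0 1 \<Longrightarrow> \<Phi> R z = \<Phi> R' z' \<Longrightarrow> R = R' \<and> z = z'"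
proof -
  assume a: "R \<in> tiles S V E" "R' \<in> tiles S V E" "z \<in> ball 0 1" "z' \<in> ball 0 1" "\<Phi> R z = \<Phi> R' z'"
  have "\<Phi> R z \<in> R" "\<Phi> R' z' \<in> R'" using a polygon_mapD(5)[OF polygons] by blast+
  then have "R = R'" using tiles_facts(6)[OF a(1,2)] a(5) by auto
  then show ?thesis using a inj_onD[OF polygon_mapD(4)[OF polygons[OF a(1)]]] by metis
qed

lemma spoke_subset: "s \<in> sides \<Longrightarrow> spoke s \<subseteq> fst s"
  unfolding spoke_def using polygon_mapD(5)[OF sidesD(3)] open_segment_side_middle_subset by blast

lemma quad_subset: "s \<in> sides \<Longrightarrow> quad s \<subseteq> fst s"
  unfolding quad_def using polygon_mapD(5)[OF sidesD(3)] sector_subset by blast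

lemma spoke_inj: assumes "s \<in> sides" "s' \<in> sides" "spoke s \<inter> spoke s' \<noteq> {}" shows "s = s'"
proof -
  obtain z z' where z: "z \<in> open_segment 0 (side_middle (n (fst s)) (snd s))"
    "z' \<in> open_segment 0 (side_middle (n (fst s')) (snd s'))" "\<Phi> (fst s) z = \<Phi> (fst s') z'"
    using assms(3) unfolding spoke_def by auto
  then have "fst s = fst s' \<and> z = z'"
    using open_segment_side_middle_subset by (intro Phi_inj sidesD(1) assms(1,2)) blast+
  then show ?thesis
    using segment_disjoint[of "snd s" "n (fst s)" "snd s'" z] sidesD(2)[OF assms(1)] sidesD(2)[OF assms(2)] z
    by (auto simp: prod_eq_iff)
qed

lemma quad_inj: assumes "s \<in> sides" "s' \<in> sides" "quad s \<inter> quad s' \<noteq> {}" shows "s = s'"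
proof -
  obtain z z' where z: "z \<in> sector (n (fst s)) (snd s)" "z' \<in> sector (n (fst s')) (snd s')" "\<Phi> (fst s) z = \<Phi> (fst s') z'"
    using assms(3) unfolding quad_def by auto
  then have "fst s = fst s' \<and> z = z'"
    using sector_subset by (intro Phi_inj sidesD(1) assms(1,2)) blast+
  then show ?thesis
    using sector_disjoint[of "snd s" "n (fst s)" "snd s'" z] sidesD(2)[OF assms(1)] sidesD(2)[OF assms(2)] z
    by (auto simp: prod_eq_iff)
qed

lemma quad_nonempty: "quad s \<noteq> {}"
  unfolding quad_def using sector_nonempty by simp

lemma quad_eq_iff: "s \<in> sides \<Longrightarrow> s' \<in> sides \<Longrightarrow> quad s = quad s' \<longleftrightarrow> s = s'"
  using quad_inj[of s s'] quad_nonempty[of s] by auto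

lemma spoke_eq_iff: "s \<in> sides \<Longrightarrow> s' \<in> sides \<Longrightarrow> spoke s = spoke s' \<longleftrightarrow> s = s'"
proof -
  assume s: "s \<in> sides" "s' \<in> sides"
  have "side_middle (n (fst s)) (snd s) \<noteq> 0"
    unfolding side_middle_def using norm_circle_point by (metis norm_zero zero_neq_one)
  then have "spoke s \<noteq> {}" by (simp add: spoke_def open_segment_eq_empty)
  then show ?thesis using spoke_inj[OF s] by auto
qed

lemma spoke_not_half:
  assumes "s \<in> sides" "s' \<in> sides" "x \<in> spoke s" "x \<in> side_edge s'" shows False
  using tile_edge_disjoint[OF sidesD(1)[OF assms(1)] side_edge_in[OF assms(2)]] spoke_subset[OF assms(1)] assms(3,4)
  by blast

text \<open>Needed to apply \<open>quadrilateral_opposite_sides\<close> to the coordinates of a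
  pentagonal subdivision of T(4).\<close>

lemma E4_V4_disjoint: "\<Union>E4 \<inter> V4 = {}"
proof -
  have half: "x \<notin> V4" if s: "s \<in> sides" and x: "x \<in> side_edge s" "x \<noteq> m (side_edge s)" for s x
  proof -
    note e = side_edge_in[OF s]
    have "x \<notin> V" using graphD(7)[OF e] x by blast
    moreover have "x \<noteq> m e'" if "e' \<in> E" for e'
      using graphD(6)[OF e that] m_in[OF that] x by blast
    moreover have "x \<noteq> \<Phi> R 0" if R: "R \<in> tiles S V E" for R
    proof -
      have "\<Phi> R 0 \<in> R" using polygon_mapD(5)[OF polygons[OF R]] by (metis centre_in_ball imageI zero_less_one)
      then show ?thesis using tile_edge_disjoint[OF R e] x by blast
    qed
    ultimately show ?thesis by (auto simp: V4_def)
  qed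
  have sp: "x \<notin> V4" if s: "s \<in> sides" and x: "x \<in> spoke s" for s x
  proof -
    have xs: "x \<in> fst s" using spoke_subset[OF s] x by blast
    have "x \<notin> V" using tiles_facts(2)[OF sidesD(1)[OF s]] xs by blast
    moreover have "x \<noteq> m e'" if "e' \<in> E" for e'
      using tile_edge_disjoint[OF sidesD(1)[OF s] that xs] m_in[OF that] by blast
    moreover have "x \<noteq> \<Phi> R 0" if R: "R \<in> tiles S V E" for R
    proof
      assume e: "x = \<Phi> R 0"
      obtain z where z: "z \<in> open_segment 0 (side_middle (n (fst s)) (snd s))" "x = \<Phi> (fst s) z"
        using x by (auto simp: spoke_def)
      then have "z \<in> ball 0 1 - {0}" using open_segment_side_middle_subset by blast
      then show False using Phi_inj[OF sidesD(1)[OF s] R, of z 0] z e by auto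
    qed
    ultimately show ?thesis by (auto simp: V4_def)
  qed
  have "first_half s \<subseteq> side_edge s - {m (side_edge s)}" "second_half s \<subseteq> side_edge s - {m (side_edge s)}" if "s \<in> sides" for s
    using halves(1)[OF that] in_components_subset by blast+
  then show ?thesis unfolding E4_eq using half sp by blast
qed

text \<open>Half edges and middle points reassemble to the old edges, so the new graph adds only
  centers and spokes inside the old tiles.\<close>

lemma graph4_union:
  "V4 \<union> \<Union>E4 = V \<union> \<Union>E \<union> (\<lambda>R. \<Phi> R 0) ` tiles S V E \<union> (\<Union>s\<in>sides. spoke s)"
proof -
  have M: "m ` E \<union> \<Union>(half_edges m E) = \<Union>E"
  proof -
    have U: "\<Union>(half_edges m E) = (\<Union>e\<in>E. e - {m e})"
    proof -
      have "\<Union>(components (e - {m e})) = e - {m e}" for e by (rule Union_components)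
      then show ?thesis unfolding half_edges_def by blast
    qed
    show ?thesis
    proof (intro subset_antisym subsetI)
      fix x assume "x \<in> m ` E \<union> \<Union>(half_edges m E)"
      then show "x \<in> \<Union>E" unfolding U using m_in by auto
    next
      fix x assume "x \<in> \<Union>E"
      then obtain e where "e \<in> E" "x \<in> e" by blast
      then show "x \<in> m ` E \<union> \<Union>(half_edges m E)" unfolding U by (cases "x = m e") auto
    qed
  qed
  have "V4 \<union> \<Union>E4 = V \<union> (m ` E \<union> \<Union>(half_edges m E)) \<union> (\<lambda>R. \<Phi> R 0) ` tiles S V E \<union> (\<Union>s\<in>sides. spoke s)"
    unfolding V4_def E4_def spokes_eq by (simp add: Union_Un_distrib Un_ac)
  then show ?thesis unfolding M .
qed

text \<open>By \<open>ball_cases\<close> the sectors partition what remains of each tile, and they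
  are open and connected, hence the components.\<close>

lemma tiles4_eq: "tiles S V4 E4 = quad ` sides"
  unfolding tiles_def
proof (rule components_openin_unique)
  let ?X = "S - (V4 \<union> \<Union>E4)"
  show "pairwise disjnt (quad ` sides)"
    unfolding pairwise_def disjnt_def using quad_inj by blast
  have qX: "quad s \<subseteq> ?X" if s: "s \<in> sides" for s
  proof
    fix x assume x: "x \<in> quad s"
    then obtain z where z: "z \<in> sector (n (fst s)) (snd s)" "x = \<Phi> (fst s) z" by (auto simp: quad_def)
    have zb: "z \<in> ball 0 1 - {0}" using z sector_subset by blast
    have xs: "x \<in> fst s" using quad_subset[OF s] x by blast
    note R = sidesD(1)[OF s]
    have "x \<in> S" "x \<notin> V" "x \<notin> \<Union>E" using tiles_facts(1-3)[OF R] xs by blast+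
    moreover have "x \<noteq> \<Phi> R' 0" if "R' \<in> tiles S V E" for R'
      using Phi_inj[OF R that, of z 0] z zb by auto
    moreover have "x \<notin> spoke s'" if s': "s' \<in> sides" for s'
    proof
      assume "x \<in> spoke s'"
      then obtain z' where z': "z' \<in> open_segment 0 (side_middle (n (fst s')) (snd s'))" "x = \<Phi> (fst s') z'"
        by (auto simp: spoke_def)
      then have "z' \<in> ball 0 1" using open_segment_side_middle_subset by blast
      then have "fst s = fst s' \<and> z = z'" using Phi_inj[OF R sidesD(1)[OF s'], of z z'] z z' zb by auto
      then show False using sector_segment_disjoint[OF sidesD(2)[OF s] z(1)] z'(1) by metis
    qed
    ultimately show "x \<in> ?X" unfolding graph4_union by blast
  qed
  show "\<Union>(quad ` sides) = ?X"
  proof (intro subset_antisym subsetI)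
    fix x assume x: "x \<in> ?X"
    then obtain R where R: "R \<in> tiles S V E" "x \<in> R"
      using tiles_cover[of x S V E] unfolding graph4_union by blast
    then have "x \<in> \<Phi> R ` ball 0 1" using polygon_mapD(5)[OF polygons[OF R(1)]] by simp
    then obtain z where z: "norm z < 1" "x = \<Phi> R z" by auto
    have "z \<noteq> 0" using x z R(1) unfolding graph4_union by blast
    moreover have "z \<notin> open_segment 0 (side_middle (n R) k)" if "k < n R" for k
    proof
      assume "z \<in> open_segment 0 (side_middle (n R) k)"
      then have "x \<in> spoke (R, k)" using z by (auto simp: spoke_def)
      moreover have "(R, k) \<in> sides" using R that by (simp add: sides_def)
      ultimately show False using x unfolding graph4_union by blast
    qed
    ultimately obtain k where k: "k < n R" "z \<in> sector (n R) k"
      using ball_cases[OF z(1) polygon_mapD(2)[OF polygons[OF R(1)]]] by blast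
    then have "x \<in> quad (R, k)" "(R, k) \<in> sides" using z R by (auto simp: quad_def sides_def)
    then show "x \<in> \<Union>(quad ` sides)" by blast
  qed (use qX in blast)
  fix C assume "C \<in> quad ` sides"
  then obtain s where s: "s \<in> sides" "C = quad s" by blast
  note n3 = polygon_mapD(1)[OF sidesD(3)[OF s(1)]]
  have "sector (n (fst s)) (snd s) \<subseteq> ball 0 1" using sector_subset by blast
  then have sp: "surface_param S (sector (n (fst s)) (snd s)) (\<Phi> (fst s))"
    using surface_param_subset[OF param_tile[OF sidesD(1)[OF s(1)]] open_sector[OF n3]] by blast
  have "openin (top_of_set S) C" using openin_param_image[OF surface sp] s(2) by (simp add: quad_def)
  then have "openin (top_of_set ?X) C" using qX[OF s(1)] s(2) by (auto intro: openin_subset_trans)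
  moreover have "connected C"
    unfolding s(2) quad_def using surface_paramD(2)[OF sp] connected_sector[OF sidesD(4)[OF s(1)]]
    by (rule connected_continuous_image)
  moreover have "C \<noteq> {}" using s(2) quad_nonempty by simp
  ultimately show "openin (top_of_set ?X) C \<and> connected C \<and> C \<noteq> {}" by blast
qed

text \<open>Injectivity on a boundary side is inherited from \<open>\<Phi>\<close>: a half edge lies
  within one side of the n-gon, and a spoke within the open disk.\<close>

lemma polygon_map_quad:
  assumes s: "s \<in> sides" shows "polygon_map V4 E4 4 (quad_map s) (quad s)"
  unfolding polygon_map_def
proof (intro conjI allI impI)
  let ?R = "fst s" and ?q = "quad_coord (n (fst s)) (snd s)"
  note pm = polygon_mapD[OF sidesD(3)[OF s]] and p = sidesD(2)[OF side_cycle(1)[OF s]]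
  note qinj = inj_on_quad_coord[OF pm(1)]
  show cont: "continuous_on (cball 0 1) (quad_map s)"
    unfolding quad_map_def
    by (rule continuous_on_compose2[OF pm(3) continuous_on_quad_coord[OF pm(2)]]) (use quad_coord_cball in blast)
  have im: "quad_map s ` A = \<Phi> (fst s) ` (?q ` A)" for A
    by (simp add: quad_map_def image_image)
  have inj: "inj_on (quad_map s) A" if "A \<subseteq> cball 0 1" "inj_on (\<Phi> ?R) (?q ` A)" for A
    using comp_inj_on[OF inj_on_subset[OF qinj that(1)] that(2)] by (simp add: quad_map_def[abs_def] o_def)
  have qb: "?q ` ball 0 1 \<subseteq> ball 0 1" unfolding quad_coord_ball using sector_subset by blast
  have bim: "quad_map s ` ball 0 1 = quad s" unfolding im quad_coord_ball quad_def ..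
  have "surface_param S (ball 0 1) (quad_map s)"
    unfolding surface_param_def bim
  proof (intro conjI)
    show "continuous_on (ball 0 1) (quad_map s)" using cont ball_subset_cball by (rule continuous_on_subset)
    show "inj_on (quad_map s) (ball 0 1)" by (rule inj) (use inj_on_subset[OF pm(4) qb] in auto)
    show "quad s \<subseteq> S" using quad_subset[OF s] tiles_facts(1)[OF sidesD(1)[OF s]] by blast
  qed simp
  from param_homeomorphism[OF surface this]
  show "\<exists>\<psi>. homeomorphism (ball 0 1) (quad s) (quad_map s) \<psi>" unfolding bim by blast
  have mid: "\<Phi> ?R (circle_point (n ?R) (real k + 1/2)) \<in> m ` E" if "k < n ?R" for k
    using m_side[OF sidesD(1)[OF s] that] pm(7)[OF that] unfolding side_middle_def by auto
  fix k :: nat assume "k < 4"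
  then consider "k = 0" | "k = 1" | "k = 2" | "k = 3" by linarith
  note k = this
  show "quad_map s (circle_point 4 (real k)) \<in> V4"
    using k
  proof cases
    case 1
    then show ?thesis using pm(6)[OF sidesD(2)[OF s]] quad_coord_vertices(1) by (simp add: quad_map_def V4_def)
  next
    case 2
    then show ?thesis using mid[OF sidesD(2)[OF s]] quad_coord_vertices(2) by (simp add: quad_map_def V4_def)
  next
    case 3
    then show ?thesis using sidesD(1)[OF s] quad_coord_vertices(3) by (simp add: quad_map_def V4_def)
  next
    case 4
    have "\<Phi> ?R (circle_point (n ?R) (real (snd s) - 1/2)) \<in> m ` E"
      unfolding prev_circle_point[OF s] using mid[of "snd (prev_side s)"] p side_cycle(5)[OF s] by simp
    then show ?thesis using 4 quad_coord_vertices(4) by (simp add: quad_map_def V4_def)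
  qed
  show "quad_map s ` polygon_side 4 k \<in> E4"
    using k by cases (use quad_map_sides[OF s] s side_cycle(1)[OF s] in \<open>auto simp: E4_eq\<close>)
  have cb: "polygon_side 4 k \<subseteq> cball 0 1" using polygon_side_norm by fastforce
  have seg: "inj_on (\<Phi> ?R) A" if "A \<subseteq> ball 0 1" for A
    using pm(4) that by (rule inj_on_subset)
  have arcs: "inj_on (\<Phi> ?R) (circle_point (n ?R) ` A)" if "A \<subseteq> {real j<..<real j + 1}" "j < n ?R" for A j
    using pm(8)[OF that(2)] by (rule inj_on_subset) (use that(1) in \<open>auto simp: polygon_side_def\<close>)
  show "inj_on (quad_map s) (polygon_side 4 k)"
    using k
  proof cases
    case 1
    have "{real (snd s)<..<real (snd s) + 1/2} \<subseteq> {real (snd s)<..<real (snd s) + 1}" by auto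
    from arcs[OF this sidesD(2)[OF s]]
    show ?thesis using 1 cb by (intro inj) (simp_all add: quad_coord_sides)
  next
    case 2
    have "?q ` polygon_side 4 k \<subseteq> ball 0 1"
      using open_segment_side_middle_subset[of "n ?R" "snd s"]
      unfolding 2 quad_coord_sides side_middle_def by blast
    then show ?thesis by (rule inj[OF cb seg])
  next
    case 3
    have "side_middle (n ?R) (snd (prev_side s)) = circle_point (n ?R) (real (snd s) - 1/2)"
      unfolding prev_circle_point[OF s] side_middle_def by simp
    then have "?q ` polygon_side 4 k \<subseteq> ball 0 1"
      using open_segment_side_middle_subset[of "n ?R" "snd (prev_side s)"]
      unfolding 3 quad_coord_sides by auto
    then show ?thesis by (rule inj[OF cb seg])
  next
    case 4
    have "?q ` polygon_side 4 3 = circle_point (n ?R) ` {real (snd (prev_side s)) + 1/2<..<real (snd (prev_side s)) + 1}"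
    proof -
      have 1: "{real k - 1/2<..<real k} = (\<lambda>t. real k - t) ` {0<..<1/2}" for k
        by (auto simp: image_iff intro!: bexI[of _ "real k - _"])
      have 2: "{real k + 1/2<..<real k + 1} = (\<lambda>t. real k + (1 - t)) ` {0<..<1/2}" for k
        by (auto simp: image_iff intro!: bexI[of _ "real k + 1 - _"])
      show ?thesis unfolding quad_coord_sides 1 2 image_image prev_circle_point[OF s] ..
    qed
    then have "inj_on (\<Phi> ?R) (?q ` polygon_side 4 3)"
      using arcs[of "{real (snd (prev_side s)) + 1/2<..<real (snd (prev_side s)) + 1}" "snd (prev_side s)"]
        p side_cycle(5)[OF s] by (simp add: subset_iff)
    then show ?thesis using inj[OF cb] unfolding 4 by blast
  qed
qed simp

end

section \<open>Pentagonal subdivisions\<close>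

lemma Ex1_pairD: "\<exists>!(x, y). Q x y \<Longrightarrow> Q a b \<Longrightarrow> Q c d \<Longrightarrow> a = c \<and> b = d"
  by (metis (mono_tags, lifting) case_prod_conv prod.inject)

lemma greaterThanLessThan_shift: "{x + c<..<y + c} = (\<lambda>t. t + c) ` {x<..<y::real}"
proof (intro subset_antisym image_subsetI subsetI)
  fix t assume "t \<in> {x + c<..<y + c}"
  then show "t \<in> (\<lambda>t. t + c) ` {x<..<y}" by (intro image_eqI[of _ _ "t - c"]) auto
qed auto

lemma rotate_polygon_side:
  assumes "k < 4" shows "(\<lambda>z. \<i> * z) ` polygon_side 4 k = polygon_side 4 (Suc k mod 4)"
proof -
  have rot: "\<i> * circle_point 4 t = circle_point 4 (t + 1)" for t
    using circle_point_add[of 4 t 1] by (simp add: circle_point_4[of 1] cis_pi_half mult.commute)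
  have iv: "{x + 1<..<x + 1 + 1} = (\<lambda>t. t + 1) ` {x<..<x + (1::real)}" for x
    by (rule greaterThanLessThan_shift)
  have eq: "(\<lambda>z. \<i> * z) ` polygon_side 4 k = polygon_side 4 (Suc k)"
    unfolding polygon_side_def image_image rot of_nat_Suc add.commute[of 1] iv ..
  have "polygon_side 4 4 = polygon_side 4 0"
  proof -
    have 1: "{real 4<..<real 4 + 1} = (\<lambda>t. t + real 4) ` {real 0<..<real 0 + 1}"
      using greaterThanLessThan_shift[of "real 0" "real 4" "real 0 + 1"] by simp
    show ?thesis unfolding polygon_side_def 1 image_image using circle_point_period(2)[of 4] by simp
  qed
  then show ?thesis using eq assms by (cases "k = 3") auto
qed

text \<open>A quarter turn moves the other pair of opposite sides into positions 0 and 2.\<close>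

lemma polygon_map_rotate:
  assumes "polygon_map V E 4 \<phi> R"
  shows "polygon_map V E 4 (\<lambda>z. \<phi> (\<i> * z)) R"
  unfolding polygon_map_def
proof (intro conjI allI impI)
  note pm = polygon_mapD[OF assms]
  show "continuous_on (cball 0 1) (\<lambda>z. \<phi> (\<i> * z))"
    by (rule continuous_on_compose2[OF pm(3)]) (auto simp: norm_mult intro!: continuous_intros)
  obtain g where g: "homeomorphism (ball 0 1) R \<phi> g" using assms by (auto simp: polygon_map_def)
  have "homeomorphism (ball 0 1) (ball 0 1) (\<lambda>z. \<i> * z) (\<lambda>z. - \<i> * z)"
    by (intro homeomorphismI) (auto simp: norm_mult mult.assoc[symmetric] intro!: continuous_intros)
  from homeomorphism_compose[OF this g]
  show "\<exists>\<psi>. homeomorphism (ball 0 1) R (\<lambda>z. \<phi> (\<i> * z)) \<psi>" by (auto simp: o_def)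
  fix k :: nat assume k: "k < 4"
  have im: "(\<lambda>z. \<phi> (\<i> * z)) ` A = \<phi> ` ((\<lambda>z. \<i> * z) ` A)" for A by (simp add: image_image)
  have j: "Suc k mod 4 < 4" by simp
  show "(\<lambda>z. \<phi> (\<i> * z)) ` polygon_side 4 k \<in> E"
    unfolding im rotate_polygon_side[OF k] by (rule pm(7)[OF j])
  have "inj_on (\<phi> \<circ> (\<lambda>z. \<i> * z)) (polygon_side 4 k)"
    by (rule comp_inj_on) (use pm(8)[OF j] rotate_polygon_side[OF k] in \<open>auto simp: inj_on_def\<close>)
  then show "inj_on (\<lambda>z. \<phi> (\<i> * z)) (polygon_side 4 k)" by (simp add: o_def)
  have "\<i> * circle_point 4 (real k) = circle_point 4 (real (Suc k))"
    using circle_point_add[of 4 "real k" 1] by (simp add: circle_point_4[of 1] cis_pi_half mult.commute add.commute)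
  then show "\<phi> (\<i> * circle_point 4 (real k)) \<in> V" using polygon_map_vertex[OF assms, of "Suc k"] k by simp
qed simp

text \<open>The disk is strictly convex, so the straight chord between the two middle points is an
  admissible arc.\<close>

lemma chord:
  assumes "p \<in> polygon_side 4 0" "q \<in> polygon_side 4 2"
  shows "arc (linepath p q)" "linepath p q ` {0<..<1} \<subseteq> ball 0 1"
proof -
  have n: "norm p = 1" "norm q = 1" using assms polygon_side_norm by blast+
  have "p \<noteq> q"
    using side_coord_disjoint[of 4 0 2] polygon_side_open(1)[of 4 0] polygon_side_open(1)[of 4 2] assms by auto
  then show "arc (linepath p q)" by (rule arc_linepath)
  show "linepath p q ` {0<..<1} \<subseteq> ball 0 1"
  proof
    fix z assume "z \<in> linepath p q ` {0<..<1}"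
    then have "z \<in> open_segment p q" using \<open>p \<noteq> q\<close> by (auto simp: in_segment linepath_def)
    then have "dist 0 z < dist 0 p \<or> dist 0 z < dist 0 q" by (rule dist_decreases_open_segment)
    then show "z \<in> ball 0 1" using n by auto
  qed
qed

context quadrilateral_tiling
begin

text \<open>In one direction the quadrilateral at the start of \<open>s\<close> uses the first half
  of \<open>s\<close>; in the other, the quadrilateral at its end uses the second half.\<close>

definition used_half :: "('a set \<Rightarrow> bool) \<Rightarrow> 'a set \<times> nat \<Rightarrow> 'a set" where
  "used_half \<sigma> s = (if \<sigma> (fst s) then first_half s else second_half s)"

lemma used_half_neq_iff:
  assumes "s \<in> sides" "s' \<in> sides" "side_edge s = side_edge s'"
  shows "used_half \<sigma> s \<noteq> used_half \<sigma> s' \<longleftrightarrow>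
    (\<sigma> (fst s) = \<sigma> (fst s') \<longleftrightarrow> strict_antimono_on {0<..<1} (side_change s s'))"
proof -
  have "first_half s \<noteq> second_half s" "first_half s' \<noteq> second_half s'"
    using halves(4-6)[OF assms(1)] halves(4-6)[OF assms(2)] by auto
  then show ?thesis
    using halves_change[OF assms] by (cases "strict_antimono_on {0<..<1} (side_change s s')") (auto simp: used_half_def)
qed

lemma coherent_iff:
  "coherent \<sigma> \<longleftrightarrow> (\<forall>s\<in>sides. \<forall>s'\<in>sides. s \<noteq> s' \<longrightarrow> side_edge s = side_edge s' \<longrightarrow> used_half \<sigma> s \<noteq> used_half \<sigma> s')"
  unfolding coherent_def using used_half_neq_iff by blast

lemma half_spoke_neq:
  assumes "s \<in> sides" "s' \<in> sides"
  shows "first_half s \<noteq> spoke s'" "second_half s \<noteq> spoke s'"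
  using spoke_not_half[OF assms(2,1)] halves(2,3,5,6)[OF assms(1)] by blast+

text \<open>That every spoke is used makes the choice of pairs constant around each tile; that no
  half edge is used twice then gives coherence.\<close>

lemma subdivisible_imp_coherent:
  assumes "pentagonally_subdivisible S V4 E4"
  shows "\<exists>\<sigma>. coherent \<sigma>"
proof -
  obtain V' E' m' \<Psi> \<gamma> where V': "V' = V4 \<union> m' ` E4"
    and P0: "\<forall>T\<in>tiles S V4 E4. polygon_map V4 E4 4 (\<Psi> T) T \<and>
           arc (\<gamma> T) \<and> \<gamma> T ` {0<..<1} \<subseteq> ball 0 1 \<and>
           pathstart (\<gamma> T) \<in> polygon_side 4 0 \<and>
           \<Psi> T (pathstart (\<gamma> T)) = m' (\<Psi> T ` polygon_side 4 0) \<and>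
           pathfinish (\<gamma> T) \<in> polygon_side 4 2 \<and>
           \<Psi> T (pathfinish (\<gamma> T)) = m' (\<Psi> T ` polygon_side 4 2)"
    and U0: "\<forall>e\<in>E4. \<exists>!(T, i). T \<in> tiles S V4 E4 \<and> i \<in> {0, 2::nat} \<and> \<Psi> T ` polygon_side 4 i = e"
    using assms unfolding pentagonally_subdivisible_def simple_pentagonal_subdivision_def
    by (elim exE conjE)
  have \<Psi>: "polygon_map V4 E4 4 (\<Psi> T) T" if "T \<in> tiles S V4 E4" for T using P0 that by blast
  have uniq: "\<exists>!(T, i). T \<in> tiles S V4 E4 \<and> i \<in> {0, 2::nat} \<and> \<Psi> T ` polygon_side 4 i = e" if "e \<in> E4" for e
    using U0 that by (rule bspec)
  define P where "P q = {\<Psi> (quad q) ` polygon_side 4 0, \<Psi> (quad q) ` polygon_side 4 2}" for q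
  define b where "b q \<longleftrightarrow> P q = {first_half q, spoke (prev_side q)}" for q
  have qt: "quad q \<in> tiles S V4 E4" if "q \<in> sides" for q using that by (simp add: tiles4_eq)
  have P: "b q \<or> P q = {spoke q, second_half (prev_side q)}" if q: "q \<in> sides" for q
    using quadrilateral_opposite_sides[OF polygon_map_quad[OF q] \<Psi>[OF qt[OF q]]
        tiles_facts(2,3)[OF qt[OF q]] E4_V4_disjoint]
    unfolding b_def P_def quad_map_sides[OF q] by blast
  \<comment> \<open>Only the quadrilaterals at \<open>q\<close> and \<open>next_side q\<close>
    contain \<open>spoke q\<close>. If the first takes the spoke of the preceding side instead, the
    second must take \<open>spoke q\<close>.\<close>
  have step: "b (next_side q)" if q: "q \<in> sides" and bq: "b q" for q
  proof -
    have "spoke q \<in> E4" using q by (auto simp: E4_eq)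
    then obtain T i where "T \<in> tiles S V4 E4" "i \<in> {0, 2::nat}" "\<Psi> T ` polygon_side 4 i = spoke q"
      using uniq by blast
    then obtain p where p: "p \<in> sides" "spoke q \<in> P p" unfolding tiles4_eq P_def by blast
    show ?thesis
    proof (cases "b p")
      case True
      then have "spoke q = spoke (prev_side p)" using p half_spoke_neq(1)[OF p(1) q] by (auto simp: b_def)
      then have "q = prev_side p" using spoke_eq_iff[OF q side_cycle(1)[OF p(1)]] by simp
      then show ?thesis using True side_cycle(4)[OF p(1)] by simp
    next
      case False
      then have "spoke q = spoke p"
        using p P[OF p(1)] half_spoke_neq(2)[OF side_cycle(1)[OF p(1)] q] by auto
      then show ?thesis using spoke_eq_iff[OF q p(1)] False bq by simp
    qed
  qed
  define \<sigma> where "\<sigma> R = b (R, 0)" for R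
  have const: "b q \<longleftrightarrow> \<sigma> (fst q)" if q: "q \<in> sides" for q
  proof -
    obtain R k where Rk: "q = (R, k)" "R \<in> tiles S V E" "k < n R" using q by (auto simp: sides_def)
    have s: "(R, j) \<in> sides" if "j < n R" for j using that Rk by (simp add: sides_def)
    have up: "b (R, j + i)" if "b (R, j)" "j + i < n R" for i j
      using that
    proof (induction i)
      case (Suc i)
      then have "b (next_side (R, j + i))" by (intro step s) auto
      then show ?case using Suc.prems by (simp add: next_side_def split: if_splits)
    qed simp
    have "b (R, 0) \<Longrightarrow> b (R, k)" using up[of 0 k] Rk by simp
    \<comment> \<open>The implication only runs forward, so the converse goes on to the last side
      and wraps around to 0.\<close>
    moreover have "b (R, 0)" if "b (R, k)"
    proof -
      have "b (R, n R - 1)" using up[of k "n R - 1 - k"] that Rk by simp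
      then have "b (next_side (R, n R - 1))" using Rk by (intro step s) auto
      then show ?thesis using Rk by (simp add: next_side_def)
    qed
    ultimately show ?thesis using Rk by (auto simp: \<sigma>_def)
  qed
  \<comment> \<open>The side whose quadrilateral uses \<open>used_half \<sigma> s\<close>. It stays
    in the tile of \<open>s\<close>, so \<open>s\<close> can be recovered from it.\<close>
  define ow where "ow s = (if \<sigma> (fst s) then s else next_side s)" for s
  have ow: "ow s \<in> sides" "fst (ow s) = fst s" if "s \<in> sides" for s
    using side_cycle[OF that] that by (auto simp: ow_def)
  have used: "used_half \<sigma> s \<in> P (ow s)" if s: "s \<in> sides" for s
  proof (cases "\<sigma> (fst s)")
    case True
    then show ?thesis using const[OF s] by (simp add: ow_def used_half_def b_def)
  next
    case False
    then have "\<not> b (next_side s)" using const[OF side_cycle(2)[OF s]] side_cycle(6)[OF s] by simp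
    then show ?thesis using P[OF side_cycle(2)[OF s]] side_cycle(3)[OF s] False by (simp add: ow_def used_half_def)
  qed
  have "used_half \<sigma> s \<noteq> used_half \<sigma> s'" if s: "s \<in> sides" "s' \<in> sides" "s \<noteq> s'" for s s'
  proof
    assume eq: "used_half \<sigma> s = used_half \<sigma> s'"
    have e: "used_half \<sigma> s \<in> E4" using s(1) by (auto simp: used_half_def E4_eq)
    obtain i where i: "i \<in> {0, 2::nat}" "\<Psi> (quad (ow s)) ` polygon_side 4 i = used_half \<sigma> s"
      using used[OF s(1)] unfolding P_def by blast
    obtain i' where i': "i' \<in> {0, 2::nat}" "\<Psi> (quad (ow s')) ` polygon_side 4 i' = used_half \<sigma> s"
      using used[OF s(2)] eq unfolding P_def by auto
    have "quad (ow s) = quad (ow s') \<and> i = i'"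
      by (rule Ex1_pairD[OF uniq[OF e]]) (intro conjI i i' qt ow(1) s)+
    then have oo: "ow s = ow s'" using quad_eq_iff ow(1) s by simp
    then have "fst s = fst s'" using ow(2) s by metis
    then show False using oo s side_cycle(3) by (metis ow_def)
  qed
  then have "coherent \<sigma>" unfolding coherent_iff by blast
  then show ?thesis by blast
qed

text \<open>The direction in each old tile selects the pair in all its quadrilaterals. Spokes are
  then used once by the rotation around the center, and half edges once by coherence.\<close>

lemma coherent_imp_subdivisible:
  assumes "coherent \<sigma>"
  shows "pentagonally_subdivisible S V4 E4"
proof -
  define side where "side T = inv_into sides quad T" for T
  have inj: "inj_on quad sides" using quad_eq_iff by (auto simp: inj_on_def)
  have side_quad: "side (quad s) = s" if "s \<in> sides" for s unfolding side_def using inj that by simp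
  have side: "side T \<in> sides" "quad (side T) = T" if "T \<in> tiles S V4 E4" for T
    using that side_quad unfolding tiles4_eq by auto
  \<comment> \<open>The quarter turn exchanges the two opposite pairs when the direction of the tile
    is reversed.\<close>
  define \<Psi> where "\<Psi> T = (if \<sigma> (fst (side T)) then quad_map (side T) else (\<lambda>z. quad_map (side T) (\<i> * z)))" for T
  have \<Psi>: "polygon_map V4 E4 4 (\<Psi> T) T" if T: "T \<in> tiles S V4 E4" for T
    using polygon_map_quad[OF side(1)[OF T]] polygon_map_rotate[OF polygon_map_quad[OF side(1)[OF T]]] side(2)[OF T]
    by (simp add: \<Psi>_def)
  have P: "\<Psi> (quad s) ` polygon_side 4 0 = (if \<sigma> (fst s) then first_half s else spoke s)"
     "\<Psi> (quad s) ` polygon_side 4 2 = (if \<sigma> (fst s) then spoke (prev_side s) else second_half (prev_side s))"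
    if s: "s \<in> sides" for s
  proof -
    have rot: "(\<lambda>z. quad_map s (\<i> * z)) ` polygon_side 4 k = quad_map s ` polygon_side 4 (Suc k mod 4)" if "k < 4" for k
      unfolding rotate_polygon_side[OF that, symmetric] by (simp add: image_image)
    show "\<Psi> (quad s) ` polygon_side 4 0 = (if \<sigma> (fst s) then first_half s else spoke s)"
      "\<Psi> (quad s) ` polygon_side 4 2 = (if \<sigma> (fst s) then spoke (prev_side s) else second_half (prev_side s))"
      using rot[of 0] rot[of 2] quad_map_sides[OF s] by (simp_all add: \<Psi>_def side_quad[OF s])
  qed
  \<comment> \<open>Any point of an open edge may serve as its middle point.\<close>
  define mid where "mid e = (SOME x. x \<in> e)" for e :: "'a set"
  have "e \<noteq> {}" if "e \<in> E4" for e
  proof -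
    have "spoke s \<noteq> {}" for s
    proof -
      have "side_middle (n (fst s)) (snd s) \<noteq> 0"
        unfolding side_middle_def using norm_circle_point by (metis norm_zero zero_neq_one)
      then show ?thesis by (simp add: spoke_def open_segment_eq_empty)
    qed
    then show ?thesis using \<open>e \<in> E4\<close> halves(5,6) unfolding E4_eq by blast
  qed
  then have mid: "mid e \<in> e" if "e \<in> E4" for e using that by (simp add: mid_def some_in_eq)
  define pt where "pt T k = (SOME p. p \<in> polygon_side 4 k \<and> \<Psi> T p = mid (\<Psi> T ` polygon_side 4 k))" for T k
  have pt: "pt T k \<in> polygon_side 4 k" "\<Psi> T (pt T k) = mid (\<Psi> T ` polygon_side 4 k)"
    if T: "T \<in> tiles S V4 E4" and k: "k < 4" for T k
  proof -
    have "mid (\<Psi> T ` polygon_side 4 k) \<in> \<Psi> T ` polygon_side 4 k"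
      by (rule mid[OF polygon_mapD(7)[OF \<Psi>[OF T] k]])
    then have "\<exists>p. p \<in> polygon_side 4 k \<and> \<Psi> T p = mid (\<Psi> T ` polygon_side 4 k)" by force
    from someI_ex[OF this] show "pt T k \<in> polygon_side 4 k" "\<Psi> T (pt T k) = mid (\<Psi> T ` polygon_side 4 k)"
      by (simp_all add: pt_def)
  qed
  have tiles: "polygon_map V4 E4 4 (\<Psi> T) T \<and>
           arc (linepath (pt T 0) (pt T 2)) \<and> linepath (pt T 0) (pt T 2) ` {0<..<1} \<subseteq> ball 0 1 \<and>
           pathstart (linepath (pt T 0) (pt T 2)) \<in> polygon_side 4 0 \<and>
           \<Psi> T (pathstart (linepath (pt T 0) (pt T 2))) = mid (\<Psi> T ` polygon_side 4 0) \<and>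
           pathfinish (linepath (pt T 0) (pt T 2)) \<in> polygon_side 4 2 \<and>
           \<Psi> T (pathfinish (linepath (pt T 0) (pt T 2))) = mid (\<Psi> T ` polygon_side 4 2)"
    if T: "T \<in> tiles S V4 E4" for T
    using \<Psi>[OF T] pt[OF T, of 0] pt[OF T, of 2] chord[of "pt T 0" "pt T 2"] by simp
  \<comment> \<open>The quadrilateral and position 0 or 2 in which the half edge of \<open>s\<close>
    is used; \<open>spoke_at\<close> does the same for spokes. Together they exhaust all positions,
    which yields uniqueness.\<close>
  define half_at where "half_at s = (if \<sigma> (fst s) then (quad s, 0) else (quad (next_side s), 2::nat))" for s
  define spoke_at where "spoke_at s = (if \<sigma> (fst s) then (quad (next_side s), 2) else (quad s, 0::nat))" for s
  have at: "case half_at s of (T, i) \<Rightarrow> T \<in> tiles S V4 E4 \<and> i \<in> {0, 2} \<and> \<Psi> T ` polygon_side 4 i = used_half \<sigma> s"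
    "case spoke_at s of (T, i) \<Rightarrow> T \<in> tiles S V4 E4 \<and> i \<in> {0, 2} \<and> \<Psi> T ` polygon_side 4 i = spoke s"
    if s: "s \<in> sides" for s
    using P[OF s] P[OF side_cycle(2)[OF s]] side_cycle[OF s] s
    by (auto simp: half_at_def spoke_at_def used_half_def tiles4_eq)
  have inv: "\<exists>s\<in>sides. (T, i) = half_at s \<and> \<Psi> T ` polygon_side 4 i = used_half \<sigma> s \<or>
                 (T, i) = spoke_at s \<and> \<Psi> T ` polygon_side 4 i = spoke s"
    if T: "T \<in> tiles S V4 E4" and i: "i \<in> {0, 2}" for T i
  proof -
    obtain q where q: "q \<in> sides" "T = quad q" using T unfolding tiles4_eq by blast
    note c = side_cycle[OF q(1)]
    consider "i = 0" | "i = 2" using i by blast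
    then show ?thesis
    proof cases
      case 1
      then show ?thesis using P(1)[OF q(1)] q
        by (intro bexI[of _ q]) (auto simp: half_at_def spoke_at_def used_half_def)
    next
      case 2
      then show ?thesis using P(2)[OF q(1)] q c
        by (intro bexI[of _ "prev_side q"]) (auto simp: half_at_def spoke_at_def used_half_def)
    qed
  qed
  have uh: "used_half \<sigma> s \<noteq> spoke s'" if "s \<in> sides" "s' \<in> sides" for s s'
    using half_spoke_neq[OF that] by (simp add: used_half_def)
  have uniq: "\<exists>!(T, i). T \<in> tiles S V4 E4 \<and> i \<in> {0, 2} \<and> \<Psi> T ` polygon_side 4 i = e" if e: "e \<in> E4" for e
  proof -
    \<comment> \<open>The old edge \<open>d\<close> has two sides and only the halves
      \<open>e\<close> and \<open>e'\<close>. By coherence the two sides use different halves, so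
      one of them uses \<open>e\<close>; any other side using \<open>e\<close> would lie on the same
      edge and contradict coherence.\<close>
    have half: ?thesis if h: "components (d - {m d}) = {e, e'}" "d \<in> E" "e \<in> first_half ` sides \<union> second_half ` sides" for d e'
    proof -
      obtain s s' where s: "s \<in> sides" "s' \<in> sides" "s \<noteq> s'" "side_edge s = d" "side_edge s' = d"
        using edge_two_sides[OF h(2)] by (metis (no_types))
      have ne: "used_half \<sigma> s \<noteq> used_half \<sigma> s'" using assms s unfolding coherent_iff by simp
      have mem: "used_half \<sigma> s \<in> {e, e'}" "used_half \<sigma> s' \<in> {e, e'}"
        using halves(1)[OF s(1)] halves(1)[OF s(2)] s h(1) by (auto simp: used_half_def)
      then have "used_half \<sigma> s = e \<or> used_half \<sigma> s' = e" using ne by blast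
      then obtain t where t: "t \<in> sides" "side_edge t = d" "used_half \<sigma> t = e" using s by blast
      show ?thesis
      proof (rule ex1I[of _ "half_at t"])
        show "case half_at t of (T, i) \<Rightarrow> T \<in> tiles S V4 E4 \<and> i \<in> {0, 2} \<and> \<Psi> T ` polygon_side 4 i = e"
          using at(1)[OF t(1)] t(3) by simp
        fix x assume x: "case x of (T, i) \<Rightarrow> T \<in> tiles S V4 E4 \<and> i \<in> {0, 2} \<and> \<Psi> T ` polygon_side 4 i = e"
        obtain T i where Ti: "x = (T, i)" by fastforce
        then have T: "T \<in> tiles S V4 E4" "i \<in> {0, 2}" "\<Psi> T ` polygon_side 4 i = e" using x by auto
        obtain r where r: "r \<in> sides" "(T, i) = half_at r \<and> e = used_half \<sigma> r \<or> (T, i) = spoke_at r \<and> e = spoke r"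
          using inv[OF T(1,2)] T(3) by metis
        have "e \<noteq> spoke r" using uh[OF t(1) r(1)] t(3) by simp
        then have r': "(T, i) = half_at r" "used_half \<sigma> r = e" using r(2) by auto
        have "used_half \<sigma> r \<subseteq> side_edge r" "used_half \<sigma> t \<subseteq> side_edge t" "used_half \<sigma> t \<noteq> {}"
          using halves(2,3,5,6)[OF r(1)] halves(2,3,5,6)[OF t(1)] by (auto simp: used_half_def)
        then have "side_edge r = side_edge t"
          using r'(2) t(3) graphD(6)[OF side_edge_in[OF r(1)] side_edge_in[OF t(1)]] by blast
        then have "r = t" using assms r'(2) t r(1) unfolding coherent_iff by metis
        then show "x = half_at t" using r'(1) Ti by simp
      qed
    qed
    show ?thesis
    proof (cases "e \<in> spoke ` sides")
      case True
      then obtain t where t: "t \<in> sides" "e = spoke t" by blast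
      show ?thesis
      proof (rule ex1I[of _ "spoke_at t"])
        show "case spoke_at t of (T, i) \<Rightarrow> T \<in> tiles S V4 E4 \<and> i \<in> {0, 2} \<and> \<Psi> T ` polygon_side 4 i = e"
          using at(2)[OF t(1)] t(2) by simp
        fix x assume x: "case x of (T, i) \<Rightarrow> T \<in> tiles S V4 E4 \<and> i \<in> {0, 2} \<and> \<Psi> T ` polygon_side 4 i = e"
        obtain T i where Ti: "x = (T, i)" by fastforce
        then have T: "T \<in> tiles S V4 E4" "i \<in> {0, 2}" "\<Psi> T ` polygon_side 4 i = e" using x by auto
        obtain r where r: "r \<in> sides" "(T, i) = half_at r \<and> e = used_half \<sigma> r \<or> (T, i) = spoke_at r \<and> e = spoke r"
          using inv[OF T(1,2)] T(3) by metis
        have "e \<noteq> used_half \<sigma> r" using uh[OF r(1) t(1)] t(2) by metis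
        then have "(T, i) = spoke_at r" "spoke r = spoke t" using r(2) t(2) by auto
        then show "x = spoke_at t" using spoke_eq_iff[OF r(1) t(1)] Ti by simp
      qed
    next
      case False
      then have eh: "e \<in> first_half ` sides \<union> second_half ` sides" using e unfolding E4_eq by blast
      then obtain s where s: "s \<in> sides" "e = first_half s \<or> e = second_half s" by blast
      have "components (side_edge s - {m (side_edge s)}) = {first_half s, second_half s}"
        "components (side_edge s - {m (side_edge s)}) = {second_half s, first_half s}"
        using halves(1)[OF s(1)] by (simp_all add: insert_commute)
      with s(2) have "\<exists>e'. components (side_edge s - {m (side_edge s)}) = {e, e'}" by metis
      then show ?thesis using half[OF _ side_edge_in[OF s(1)] eh] by (elim exE)
    qed
  qed
  have "simple_pentagonal_subdivision S V4 E4 (V4 \<union> mid ` E4)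
     (half_edges mid E4 \<union> {\<Psi> T ` linepath (pt T 0) (pt T 2) ` {0<..<1} | T. T \<in> tiles S V4 E4})"
    unfolding simple_pentagonal_subdivision_def
    by (rule exI[of _ mid], rule exI[of _ \<Psi>], rule exI[of _ "\<lambda>T. linepath (pt T 0) (pt T 2)"])
      (use mid tiles uniq in \<open>simp\<close>)
  then show ?thesis unfolding pentagonally_subdivisible_def by blast
qed

theorem subdivisible_iff_orientable: "pentagonally_subdivisible S V4 E4 \<longleftrightarrow> orientable S"
  using orientable_iff_coherent subdivisible_imp_coherent coherent_imp_subdivisible by blast

end

theorem theorem3p6:
  fixes S :: "'a::t2_space set"
    and V V4 :: "'a set" and E E4 :: "'a set set"
  assumes "closed_surface S"
    and "tiling S V E"
    and "quadrilateral_subdivision S V E V4 E4"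
  shows "pentagonally_subdivisible S V4 E4 \<longleftrightarrow> orientable S"
proof -
  obtain m n \<Phi> where m: "\<forall>e\<in>E. m e \<in> e"
    and \<Phi>: "\<forall>R\<in>tiles S V E. polygon_map V E (n R) (\<Phi> R) R \<and>
           (\<forall>k<n R. \<Phi> R (side_middle (n R) k) = m (\<Phi> R ` polygon_side (n R) k))"
    and V4: "V4 = V \<union> m ` E \<union> (\<lambda>R. \<Phi> R 0) ` tiles S V E"
    and E4: "E4 = half_edges m E \<union>
             {\<Phi> R ` open_segment 0 (side_middle (n R) k) | R k. R \<in> tiles S V E \<and> k < n R}"
    using assms(3) unfolding quadrilateral_subdivision_def by blast
  interpret T: quadrilateral_tiling S V E n \<Phi> m
    using assms(1,2) m \<Phi> by unfold_locales (auto simp: tiling_def)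
  show ?thesis
    using T.subdivisible_iff_orientable unfolding V4 E4 T.V4_def T.E4_def .
qed

end
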